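(* There exists $X\in 2^{\omega}$ of effective Hausdorff dimension $1/2$ such that no decidably-sided strongly left-c.e. martingale succeeds on $X$, and, for every computable prediction function $f$, no mixture (sum with finite total initial capital) of a computable family of $f$-sided martingales succeeds on $X$.
   Context: $2^{<\omega}$ denotes the set of finite binary strings, $\lambda$ the empty string, $\sigma\ast i$ the extension of $\sigma$ by the bit $i$, and $X\restriction_n$ the first $n$ bits of $X\in 2^{\omega}$. A martingale is a function $M:2^{<\omega}\to\mathbb{R}^{\geq 0}$ with $2M(\sigma)=M(\sigma\ast 0)+M(\sigma\ast 1)$ for all $\sigma$; it succeeds on $X$ if $\limsup_n M(X\restriction_n)=\infty$. Its wager at $\sigma$ is $w_M(\sigma)=M(\sigma\ast 1)-M(\sigma)$. $M$ is left-c.e. if $M(\sigma)$ can be approximated by an increasing computable sequence of rationals, uniformly in $\sigma$; $M$ is strongly left-c.e. if it is left-c.e. and the wagers $w_M(\sigma)$ can be approximated by strictly monotone computable sequences of rationals, uniformly in $\sigma$. A prediction function is a function $f:2^{<\omega}\to\{0,1\}$. A martingale $M$ is $f$-sided if for all $\sigma$ and $i\in\{0,1\}$: $M(\sigma\ast i)>M(\sigma)$ implies $f(\sigma)=i$, and $M(\sigma\ast i)<M(\sigma)$ implies $f(\sigma)=1-i$. $M$ is decidably-sided if it is $f$-sided for some total computable prediction function $f$. The effective Hausdorff dimension of $X$ is $\liminf_n K(X\restriction_n)/n$, where $K$ is prefix-free Kolmogorov complexity. *)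

theory Defs
  imports Complex_Main "HOL-Library.Sublist" "HOL-Library.Extended_Real"
begin

section \<open>Partial recursive functions\<close>

datatype recf =
    Zero
  | Succ
  | Proj nat
  | Comp recf "recf list"
  | PrimRec recf recf
  | Mu recf

text \<open>
  Kleene's schemes. The result \<^const>\<open>None\<close> stands for divergence, and is also
  returned if an argument list is too short for the scheme. Primitive recursion is on the
  first argument; the minimum found by \<^const>\<open>Mu\<close> is passed as the first argument and
  requires convergence at all smaller arguments.
\<close>

fun eval :: "recf \<Rightarrow> nat list \<Rightarrow> nat option" where
  "eval Zero xs = Some 0"
| "eval Succ xs = (case xs of [] \<Rightarrow> None | x # _ \<Rightarrow> Some (Suc x))"
| "eval (Proj i) xs = (if i < length xs then Some (xs ! i) else None)"
| "eval (Comp f gs) xs = Option.bind (those (map (\<lambda>g. eval g xs) gs)) (eval f)"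
| "eval (PrimRec f g) xs =
     (case xs of
        [] \<Rightarrow> None
      | n # ys \<Rightarrow> rec_nat (eval f ys) (\<lambda>m r. Option.bind r (\<lambda>y. eval g (m # y # ys))) n)"
| "eval (Mu f) xs =
     (if \<exists>n. eval f (n # xs) = Some 0 \<and> (\<forall>m<n. \<exists>y. eval f (m # xs) = Some (Suc y))
      then Some (LEAST n. eval f (n # xs) = Some 0) else None)"

definition computable :: "nat \<Rightarrow> (nat list \<Rightarrow> nat) \<Rightarrow> bool" where
  "computable k g \<longleftrightarrow> (\<exists>r. \<forall>xs. length xs = k \<longrightarrow> eval r xs = Some (g xs))"

definition computable_rat :: "nat \<Rightarrow> (nat list \<Rightarrow> rat) \<Rightarrow> bool" where
  "computable_rat k q \<longleftrightarrow>
     (\<exists>a b c. computable k a \<and> computable k b \<and> computable k c \<and>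
        (\<forall>xs. length xs = k \<longrightarrow> q xs = (of_nat (a xs) - of_nat (b xs)) / of_nat (Suc (c xs))))"

section \<open>Strings and sequences\<close>

text \<open>The bits 0 and 1 are \<^const>\<open>False\<close> and \<^const>\<open>True\<close>.\<close>

type_synonym str = "bool list"

fun str_code :: "str \<Rightarrow> nat" where
  "str_code [] = 0"
| "str_code (b # \<sigma>) = 2 * str_code \<sigma> + (if b then 2 else 1)"

lemma bij_str_code: "bij str_code"
proof (rule bijI)
  show "inj str_code"
  proof (rule injI)
    fix \<sigma> \<tau> show "str_code \<sigma> = str_code \<tau> \<Longrightarrow> \<sigma> = \<tau>"
    proof (induction \<sigma> arbitrary: \<tau>)
      case Nil
      then show ?case by (cases \<tau>) (auto split: if_splits)
    next
      case (Cons b \<sigma>)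
      then obtain c \<upsilon> where \<tau>: "\<tau> = c # \<upsilon>" by (cases \<tau>) (auto split: if_splits)
      have "str_code \<sigma> = str_code \<upsilon> \<and> b = c"
        using Cons.prems unfolding \<tau> by (simp split: if_splits) presburger+
      then show ?case using Cons.IH \<tau> by blast
    qed
  qed
  have "\<exists>\<sigma>. str_code \<sigma> = n" for n
  proof (induction n rule: less_induct)
    case (less n)
    show ?case
    proof (cases "n = 0")
      case True
      then show ?thesis by (metis str_code.simps(1))
    next
      case False
      then have "(n - 1) div 2 < n" by linarith
      then obtain \<sigma> where "str_code \<sigma> = (n - 1) div 2" using less by blast
      then have "str_code (even n # \<sigma>) = n" using False by (auto elim!: evenE oddE)
      then show ?thesis ..
    qed
  qed
  then show "surj str_code" by (metis surjI)
qed

definition initial :: "(nat \<Rightarrow> bool) \<Rightarrow> nat \<Rightarrow> str" where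
  "initial X n = map X [0..<n]"

section \<open>Prefix-free complexity and effective Hausdorff dimension\<close>

definition prefix_free_machine :: "(str \<Rightarrow> str option) \<Rightarrow> bool" where
  "prefix_free_machine V \<longleftrightarrow>
     (\<exists>r. \<forall>p. eval r [str_code p] = map_option str_code (V p)) \<and>
     (\<forall>p\<in>dom V. \<forall>q\<in>dom V. prefix p q \<longrightarrow> p = q)"

definition optimal_prefix_free_machine :: "(str \<Rightarrow> str option) \<Rightarrow> bool" where
  "optimal_prefix_free_machine U \<longleftrightarrow>
     prefix_free_machine U \<and>
     (\<forall>V. prefix_free_machine V \<longrightarrow>
        (\<exists>c. \<forall>p \<sigma>. V p = Some \<sigma> \<longrightarrow> (\<exists>q. U q = Some \<sigma> \<and> length q \<le> length p + c)))"

text \<open>An optimal machine is onto, so for it the minimum below is over a nonempty set.\<close>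

definition prefix_complexity :: "(str \<Rightarrow> str option) \<Rightarrow> str \<Rightarrow> nat" where
  "prefix_complexity U \<sigma> = (LEAST n. \<exists>p. U p = Some \<sigma> \<and> length p = n)"

definition effective_hdim :: "(str \<Rightarrow> str option) \<Rightarrow> (nat \<Rightarrow> bool) \<Rightarrow> ereal" where
  "effective_hdim U X =
     liminf (\<lambda>n. ereal (real (prefix_complexity U (initial X n)) / real n))"

section \<open>Martingales\<close>

definition martingale :: "(str \<Rightarrow> real) \<Rightarrow> bool" where
  "martingale M \<longleftrightarrow>
     (\<forall>\<sigma>. 0 \<le> M \<sigma> \<and> 2 * M \<sigma> = M (\<sigma> @ [False]) + M (\<sigma> @ [True]))"

definition succeeds :: "(str \<Rightarrow> real) \<Rightarrow> (nat \<Rightarrow> bool) \<Rightarrow> bool" where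
  "succeeds M X \<longleftrightarrow> limsup (\<lambda>n. ereal (M (initial X n))) = \<infinity>"

definition wager :: "(str \<Rightarrow> real) \<Rightarrow> str \<Rightarrow> real" where
  "wager M \<sigma> = M (\<sigma> @ [True]) - M \<sigma>"

definition left_ce :: "(str \<Rightarrow> real) \<Rightarrow> bool" where
  "left_ce M \<longleftrightarrow>
     (\<exists>q. computable_rat 2 q \<and>
        (\<forall>\<sigma>. incseq (\<lambda>s. q [str_code \<sigma>, s]) \<and>
             (\<lambda>s. real_of_rat (q [str_code \<sigma>, s])) \<longlonglongrightarrow> M \<sigma>))"

text \<open>Whether the approximation of the wager increases or decreases may depend on the string.\<close>

definition strongly_left_ce :: "(str \<Rightarrow> real) \<Rightarrow> bool" where
  "strongly_left_ce M \<longleftrightarrow>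
     left_ce M \<and>
     (\<exists>q. computable_rat 2 q \<and>
        (\<forall>\<sigma>. ((\<forall>s. q [str_code \<sigma>, s] < q [str_code \<sigma>, Suc s]) \<or>
              (\<forall>s. q [str_code \<sigma>, s] > q [str_code \<sigma>, Suc s])) \<and>
             (\<lambda>s. real_of_rat (q [str_code \<sigma>, s])) \<longlonglongrightarrow> wager M \<sigma>))"

definition computable_prediction :: "(str \<Rightarrow> bool) \<Rightarrow> bool" where
  "computable_prediction f \<longleftrightarrow> (\<exists>r. \<forall>\<sigma>. eval r [str_code \<sigma>] = Some (of_bool (f \<sigma>)))"

definition sided :: "(str \<Rightarrow> bool) \<Rightarrow> (str \<Rightarrow> real) \<Rightarrow> bool" where
  "sided f M \<longleftrightarrow>
     (\<forall>\<sigma> i. (M (\<sigma> @ [i]) > M \<sigma> \<longrightarrow> f \<sigma> = i) \<and> (M (\<sigma> @ [i]) < M \<sigma> \<longrightarrow> f \<sigma> = (\<not> i)))"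

definition decidably_sided :: "(str \<Rightarrow> real) \<Rightarrow> bool" where
  "decidably_sided M \<longleftrightarrow> (\<exists>f. computable_prediction f \<and> sided f M)"

text \<open>Real-valued martingales, computable uniformly in the index.\<close>

definition computable_martingale_family :: "(nat \<Rightarrow> str \<Rightarrow> real) \<Rightarrow> bool" where
  "computable_martingale_family N \<longleftrightarrow>
     (\<forall>i. martingale (N i)) \<and>
     (\<exists>q. computable_rat 3 q \<and>
        (\<forall>i \<sigma> s. \<bar>real_of_rat (q [i, str_code \<sigma>, s]) - N i \<sigma>\<bar> \<le> (1 / 2) ^ s))"

text \<open>
  By the martingale equation, N i is at most 2 to the power n times its initial capital on strings
  of length n, so finite total initial capital makes the sum converge at every string.
\<close>

definition mixture :: "(nat \<Rightarrow> str \<Rightarrow> real) \<Rightarrow> (str \<Rightarrow> real) \<Rightarrow> bool" where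
  "mixture N M \<longleftrightarrow> summable (\<lambda>i. N i []) \<and> (\<forall>\<sigma>. M \<sigma> = (\<Sum>i. N i \<sigma>))"

end

theory Submission
  imports Defs "HOL-Library.Countable"
begin

text \<open>
  A mixture of a computable family of \<open>f\<close>-sided martingales is strongly left-c.e., since all
  its wagers have the sign that \<open>f\<close> dictates. So \<open>X\<close> only has to defeat the strongly left-c.e.
  martingales.

  Let \<open>M\<close> be a finite sum of scaled opponents. Whether the approximation of a wager increases or
  decreases is decidable, so the growth of an opponent after stage \<open>s\<close> is itself a
  martingale that bets on a decidable side. Along a string of length \<open>n\<close> that follows this side about
  \<open>n / 2\<close> times, the growth after stage \<open>s\<close> is at most \<open>2 ^ (n / 2)\<close> times the growth at the empty string.
  So slightly more than \<open>n / 2\<close> bits of the value of \<open>M\<close> at the empty string suffice for a machine to find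
  a stage and a string along which \<open>M\<close> stays small for ever. Such strings exist: descend
  greedily along \<open>M\<close> plus a small multiple of the martingales that bet a little on each decidable
  side. Iterating gives \<open>X\<close>, of dimension at most 1/2.

  Conversely, betting on the ones, respectively on the zeros, of every string \<open>U p\<close> with capital
  \<open>2 ^ - length p\<close> gives two strongly left-c.e. martingales. As neither succeeds on \<open>X\<close>, the product
  of their values is bounded along \<open>X\<close>, which forces \<open>n \<le> 2 * K (X n) + O(1)\<close>.
\<close>
section \<open>Closure properties of computable functions\<close>

text \<open>A program knows the value at the empty string only to some precision, and this precision
  decays along the string. On strings of length \<open>2 * m * a\<close> the decay is held to
  \<open>a * (m + 2)\<close> bits. The excess \<open>2 * a\<close> over half the length is what a
  martingale with stake \<open>1 / m\<close> can enforce. Knowing \<open>a * (m + 3)\<close> bits at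
  the root then leaves an error of order \<open>(1 / 2) ^ a\<close> everywhere, and with the unary
  header and the machine constant the description has at most \<open>a * (m + 6)\<close> bits. Its
  ratio to the length is \<open>1 / 2 + 3 / m\<close>, and \<open>m\<close> grows along the
  construction.

  A sum of opponents has no side of its own. The property \<open>tame\<close> therefore keeps only
  what the search uses and what survives sums and rational multiples. Values and wagers are moreover
  approximated by separate sequences that need not fit together at any given stage, so the growth
  after a stage is a martingale only approximately; the acceptance of a string includes a check that
  it nearly is one.\<close>

lemma computable_cong:
  assumes "\<And>xs. length xs = k \<Longrightarrow> f xs = g xs" "computable k f"
  shows "computable k g"
  using assms unfolding computable_def by metis

lemma those_eq_Some:
  assumes "\<And>f. f \<in> set fs \<Longrightarrow> h f = Some (v f)"
  shows "those (map h fs) = Some (map v fs)"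
  using assms by (induction fs) auto

lemma computable_compose:
  assumes "computable (length fs) g" "\<And>f. f \<in> set fs \<Longrightarrow> computable k f"
  shows "computable k (\<lambda>xs. g (map (\<lambda>f. f xs) fs))"
proof -
  obtain r where r: "\<And>ys. length ys = length fs \<Longrightarrow> eval r ys = Some (g ys)"
    using assms(1) unfolding computable_def by blast
  obtain R where R: "\<And>f xs. f \<in> set fs \<Longrightarrow> length xs = k \<Longrightarrow> eval (R f) xs = Some (f xs)"
    using assms(2) unfolding computable_def by metis
  have "eval (Comp r (map R fs)) xs = Some (g (map (\<lambda>f. f xs) fs))" if "length xs = k" for xs
    using those_eq_Some[of fs "\<lambda>f. eval (R f) xs" "\<lambda>f. f xs"] R that r
    by (simp add: comp_def)
  then show ?thesis unfolding computable_def by blast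
qed

lemma computable_const: "computable k (\<lambda>_. c)"
proof (induction c)
  case 0 show ?case unfolding computable_def by (rule exI[of _ Zero]) simp
next
  case (Suc c)
  have "computable (length [\<lambda>_::nat list. c]) (\<lambda>xs. Suc (hd xs))"
    unfolding computable_def
    by (rule exI[of _ Succ]) (auto split: list.split)
  from computable_compose[OF this, of k] Suc show ?case by simp
qed

lemma computable_nth: "i < k \<Longrightarrow> computable k (\<lambda>xs. xs ! i)"
  unfolding computable_def by (rule exI[of _ "Proj i"]) simp

lemma computable_hd: "0 < k \<Longrightarrow> computable k hd"
  by (rule computable_cong[OF _ computable_nth[of 0 k]]) (auto simp: hd_conv_nth)

lemma computable_tl:
  assumes "computable k g"
  shows "computable (Suc k) (\<lambda>xs. g (tl xs))"
proof -
  let ?fs = "map (\<lambda>i xs. xs ! i) [1..<Suc k]"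
  have "computable (Suc k) (\<lambda>xs. g (map (\<lambda>f. f xs) ?fs))"
    by (rule computable_compose) (use assms in \<open>auto intro: computable_nth simp del: upt_Suc\<close>)
  moreover have "map (\<lambda>f. f xs) ?fs = tl xs" if "length xs = Suc k" for xs :: "nat list"
    using that by (intro nth_equalityI) (auto simp: nth_tl simp del: upt_Suc)
  ultimately show ?thesis by (elim computable_cong[rotated]) (simp only:)
qed

lemma computable_nth_tl: "Suc i < k \<Longrightarrow> computable k (\<lambda>xs. tl xs ! i)"
  using computable_tl[OF computable_nth[of i "k - 1"]] by simp

lemma computable_hd_tl: "Suc 0 < k \<Longrightarrow> computable k (\<lambda>xs. hd (tl xs))"
  using computable_tl[OF computable_hd[of "k - 1"]] by simp

lemma computable_nth_tl_tl: "Suc (Suc i) < k \<Longrightarrow> computable k (\<lambda>xs. tl (tl xs) ! i)"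
  using computable_tl[OF computable_nth_tl[of i "k - 1"]] by simp

lemma computable_hd_tl_tl: "Suc (Suc 0) < k \<Longrightarrow> computable k (\<lambda>xs. hd (tl (tl xs)))"
  using computable_tl[OF computable_hd_tl[of "k - 1"]] by simp

lemma computable_app1:
  assumes "computable 1 g" "computable k a"
  shows "computable k (\<lambda>xs. g [a xs])"
  using computable_compose[of "[a]" g k] assms by simp

lemma computable_app2:
  assumes "computable 2 g" "computable k a" "computable k b"
  shows "computable k (\<lambda>xs. g [a xs, b xs])"
  using computable_compose[of "[a, b]" g k] assms by (auto simp: numeral_2_eq_2)

lemma computable_app3:
  assumes "computable 3 g" "computable k a" "computable k b" "computable k c"
  shows "computable k (\<lambda>xs. g [a xs, b xs, c xs])"
  using computable_compose[of "[a, b, c]" g k] assms by (auto simp: numeral_3_eq_3)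

lemma computable_Cons:
  assumes "computable (Suc k) g" "computable k a"
  shows "computable k (\<lambda>xs. g (a xs # xs))"
proof -
  let ?fs = "a # map (\<lambda>i xs. xs ! i) [0..<k]"
  have "computable k (\<lambda>xs. g (map (\<lambda>f. f xs) ?fs))"
    by (rule computable_compose) (use assms in \<open>auto intro: computable_nth\<close>)
  moreover have "map (\<lambda>f. f xs) ?fs = a xs # xs" if "length xs = k" for xs :: "nat list"
    using that by (auto simp: comp_def map_nth)
  ultimately show ?thesis by (elim computable_cong[rotated]) (simp only:)
qed

lemma computable_Suc: "computable k f \<Longrightarrow> computable k (\<lambda>xs. Suc (f xs))"
proof -
  have "computable 1 (\<lambda>xs. Suc (hd xs))"
    unfolding computable_def by (rule exI[of _ Succ]) (auto split: list.split)
  from computable_app1[OF this] show "computable k f \<Longrightarrow> computable k (\<lambda>xs. Suc (f xs))" by simp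
qed

text \<open>\<open>PrimRec\<close> passes the counter and the previous value in front of the
  parameters. The premise on \<open>G\<close> reads them off by \<open>hd\<close> and
  \<open>tl\<close>, a convention that the later bounded operations share, so that the parameters
  remain available inside the recursion.\<close>

lemma computable_rec_nat:
  assumes "computable k n" "computable k a"
    "computable (Suc (Suc k)) (\<lambda>ys. G (hd ys) (hd (tl ys)) (tl (tl ys)))"
  shows "computable k (\<lambda>xs. rec_nat (a xs) (\<lambda>m r. G m r xs) (n xs))"
proof -
  obtain ra where ra: "\<And>xs. length xs = k \<Longrightarrow> eval ra xs = Some (a xs)"
    using assms(2) unfolding computable_def by blast
  obtain rg where rg: "\<And>ys. length ys = Suc (Suc k) \<Longrightarrow>
      eval rg ys = Some (G (hd ys) (hd (tl ys)) (tl (tl ys)))"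
    using assms(3) unfolding computable_def by blast
  have *: "eval (PrimRec ra rg) (n # ys) = Some (rec_nat (a ys) (\<lambda>m r. G m r ys) n)"
    if "length ys = k" for n ys
    using that by (induction n) (auto simp: ra rg)
  have "computable (Suc k) (\<lambda>zs. rec_nat (a (tl zs)) (\<lambda>m r. G m r (tl zs)) (hd zs))"
    unfolding computable_def
    by (rule exI[of _ "PrimRec ra rg"]) (metis * length_Suc_conv list.sel(1,3))
  from computable_Cons[OF this assms(1)] show ?thesis by simp
qed

lemma computable_add:
  assumes "computable k f" "computable k g"
  shows "computable k (\<lambda>xs. f xs + g xs)"
proof -
  have "computable k (\<lambda>xs. rec_nat (f xs) (\<lambda>m r. Suc r) (g xs))"
    by (intro computable_rec_nat assms computable_Suc computable_hd_tl) simp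
  moreover have "rec_nat a (\<lambda>m r. Suc r) b = a + b" for a b by (induction b) auto
  ultimately show ?thesis by simp
qed

lemma computable_tl_tl:
  "computable k g \<Longrightarrow> computable (Suc (Suc k)) (\<lambda>xs. g (tl (tl xs)))"
  by (rule computable_tl[where g = "\<lambda>xs. g (tl xs)"]) (rule computable_tl)

lemma computable_mult:
  assumes "computable k f" "computable k g"
  shows "computable k (\<lambda>xs. f xs * g xs)"
proof -
  have "computable k (\<lambda>xs. rec_nat 0 (\<lambda>m r. r + f xs) (g xs))"
    by (intro computable_rec_nat assms computable_add computable_hd_tl computable_const
        computable_tl_tl) simp
  moreover have "rec_nat 0 (\<lambda>m r. r + a) b = a * b" for a b :: nat by (induction b) auto
  ultimately show ?thesis by simp
qed

lemma computable_power:
  assumes "computable k f" "computable k g"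
  shows "computable k (\<lambda>xs. f xs ^ g xs)"
proof -
  have "computable k (\<lambda>xs. rec_nat 1 (\<lambda>m r. r * f xs) (g xs))"
    by (intro computable_rec_nat assms computable_mult computable_hd_tl computable_const
        computable_tl_tl) simp
  moreover have "rec_nat 1 (\<lambda>m r. r * a) b = a ^ b" for a b :: nat by (induction b) auto
  ultimately show ?thesis by simp
qed

lemma computable_pred:
  assumes "computable k f"
  shows "computable k (\<lambda>xs. f xs - 1)"
proof -
  have "computable k (\<lambda>xs. rec_nat 0 (\<lambda>m r. m) (f xs))"
    by (intro computable_rec_nat assms computable_hd computable_const) simp
  moreover have "rec_nat 0 (\<lambda>m r. m) a = a - 1" for a :: nat by (cases a) auto
  ultimately show ?thesis by simp
qed

lemma computable_diff:
  assumes "computable k f" "computable k g"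
  shows "computable k (\<lambda>xs. f xs - g xs)"
proof -
  have "computable k (\<lambda>xs. rec_nat (f xs) (\<lambda>m r. r - 1) (g xs))"
    by (intro computable_rec_nat assms computable_pred computable_hd_tl) simp
  moreover have "rec_nat a (\<lambda>m r. r - 1) b = a - b" for a b :: nat by (induction b) auto
  ultimately show ?thesis by simp
qed

text \<open>Inserts an ignored second argument: the step of a recursion also receives the
  accumulator, whereas a summand or factor \<open>F\<close> depends on the counter and the
  parameters alone.\<close>

lemma computable_skip:
  assumes "computable (Suc k) (\<lambda>ys. F (hd ys) (tl ys))"
  shows "computable (Suc (Suc k)) (\<lambda>ys. F (hd ys) (tl (tl ys)))"
proof -
  let ?fs = "hd # map (\<lambda>i xs. xs ! Suc (Suc i)) [0..<k]"
  have "computable (Suc (Suc k)) (\<lambda>ys. (\<lambda>zs. F (hd zs) (tl zs)) (map (\<lambda>f. f ys) ?fs))"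
    by (rule computable_compose) (use assms in \<open>auto intro: computable_nth computable_hd\<close>)
  moreover have "map (\<lambda>f. f ys) ?fs = hd ys # tl (tl ys)" if "length ys = Suc (Suc k)"
    for ys :: "nat list"
    using that by (auto intro!: nth_equalityI simp: nth_tl)
  ultimately show ?thesis by (elim computable_cong[rotated]) (simp only: list.sel)
qed

lemma computable_sum:
  assumes "computable k n" "computable (Suc k) (\<lambda>ys. F (hd ys) (tl ys))"
  shows "computable k (\<lambda>xs. \<Sum>i<n xs. F i xs)"
proof -
  have "computable k (\<lambda>xs. rec_nat 0 (\<lambda>m r. r + F m xs) (n xs))"
    by (intro computable_rec_nat assms(1) computable_add computable_hd_tl computable_const
        computable_skip assms(2)) simp
  moreover have "rec_nat 0 (\<lambda>m r. r + h m) b = (\<Sum>i<b. h i)" for h :: "nat \<Rightarrow> nat" and b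
    by (induction b) auto
  ultimately show ?thesis by simp
qed

lemma computable_prod:
  assumes "computable k n" "computable (Suc k) (\<lambda>ys. F (hd ys) (tl ys))"
  shows "computable k (\<lambda>xs. \<Prod>i<n xs. F i xs)"
proof -
  have "computable k (\<lambda>xs. rec_nat 1 (\<lambda>m r. r * F m xs) (n xs))"
    by (intro computable_rec_nat assms(1) computable_mult computable_hd_tl computable_const
        computable_skip assms(2)) simp
  moreover have "rec_nat 1 (\<lambda>m r. r * h m) b = (\<Prod>i<b. h i)" for h :: "nat \<Rightarrow> nat" and b
    by (induction b) auto
  ultimately show ?thesis by simp
qed

section \<open>Decidable predicates and unbounded search\<close>

definition decidable :: "nat \<Rightarrow> (nat list \<Rightarrow> bool) \<Rightarrow> bool" where
  "decidable k P \<longleftrightarrow> computable k (\<lambda>xs. of_bool (P xs))"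

lemma decidable_cong:
  assumes "\<And>xs. length xs = k \<Longrightarrow> P xs = Q xs" "decidable k P"
  shows "decidable k Q"
  using assms unfolding decidable_def by (elim computable_cong[rotated]) simp

lemma decidable_not: "decidable k P \<Longrightarrow> decidable k (\<lambda>xs. \<not> P xs)"
  unfolding decidable_def
  by (rule computable_cong[OF _ computable_diff[OF computable_const[of _ 1]]]) auto

lemma decidable_conj: "decidable k P \<Longrightarrow> decidable k Q \<Longrightarrow> decidable k (\<lambda>xs. P xs \<and> Q xs)"
  unfolding decidable_def of_bool_conj by (rule computable_mult)

lemma decidable_disj: "decidable k P \<Longrightarrow> decidable k Q \<Longrightarrow> decidable k (\<lambda>xs. P xs \<or> Q xs)"
  by (rule decidable_cong[OF _ decidable_not[OF decidable_conj[OF decidable_not[of k P]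
          decidable_not[of k Q]]]]) auto

lemma decidable_imp: "decidable k P \<Longrightarrow> decidable k Q \<Longrightarrow> decidable k (\<lambda>xs. P xs \<longrightarrow> Q xs)"
  unfolding imp_conv_disj by (intro decidable_disj decidable_not)

lemma decidable_le:
  assumes "computable k f" "computable k g"
  shows "decidable k (\<lambda>xs. f xs \<le> g xs)"
  unfolding decidable_def
  by (rule computable_cong[OF _ computable_diff[OF computable_const[of _ 1]
        computable_diff[OF assms]]]) auto

lemma decidable_less:
  assumes "computable k f" "computable k g"
  shows "decidable k (\<lambda>xs. f xs < g xs)"
  using decidable_not[OF decidable_le[OF assms(2,1)]] by (simp add: not_le)

lemma decidable_eq:
  assumes "computable k f" "computable k g"
  shows "decidable k (\<lambda>xs. f xs = g xs)"
  by (rule decidable_cong[OF _ decidable_conj[OF decidable_le[OF assms] decidable_le[OF assms(2,1)]]])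
    auto

lemma decidable_iff: "decidable k P \<Longrightarrow> decidable k Q \<Longrightarrow> decidable k (\<lambda>xs. P xs \<longleftrightarrow> Q xs)"
  unfolding iff_conv_conj_imp by (intro decidable_conj decidable_imp)

lemma decidable_const: "decidable k (\<lambda>_. b)"
  unfolding decidable_def by (rule computable_const)

lemma decidable_all:
  assumes "computable k n" "decidable (Suc k) (\<lambda>ys. P (hd ys) (tl ys))"
  shows "decidable k (\<lambda>xs. \<forall>i<n xs. P i xs)"
  unfolding decidable_def
proof (rule computable_cong[OF _ computable_prod[where F = "\<lambda>i xs. of_bool (P i xs)"]])
  show "(\<Prod>i<n xs. of_bool (P i xs)) = (of_bool (\<forall>i<n xs. P i xs) :: nat)" for xs
    by (cases "\<forall>i<n xs. P i xs") auto
qed (use assms in \<open>auto simp: decidable_def\<close>)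

lemma decidable_ex:
  assumes "computable k n" "decidable (Suc k) (\<lambda>ys. P (hd ys) (tl ys))"
  shows "decidable k (\<lambda>xs. \<exists>i<n xs. P i xs)"
  using decidable_not[OF decidable_all[OF assms(1) decidable_not[OF assms(2)]]] by simp

lemma computable_if:
  assumes "decidable k P" "computable k f" "computable k g"
  shows "computable k (\<lambda>xs. if P xs then f xs else g xs)"
proof -
  have "computable k (\<lambda>xs. of_bool (P xs) * f xs + of_bool (\<not> P xs) * g xs)"
    using assms(1) decidable_not[OF assms(1)] unfolding decidable_def
    by (intro computable_add computable_mult assms)
  then show ?thesis by (rule computable_cong[rotated]) auto
qed

text \<open>\<open>Mu\<close> looks for a zero and requires convergence at all smaller arguments. A
  total test with value 0 for truth meets that requirement, so divergence means exactly that no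
  witness exists.\<close>

lemma eval_Mu_decidable:
  assumes "\<And>n. eval r (n # xs) = Some (of_bool (\<not> P n))"
  shows "eval (Mu r) xs = (if \<exists>n. P n then Some (LEAST n. P n) else None)"
proof -
  have "\<exists>n. P n \<and> (\<forall>m<n. \<not> P m)" if "\<exists>n. P n"
    using exists_least_iff[of P] that by blast
  then have "(\<exists>n. eval r (n # xs) = Some 0 \<and> (\<forall>m<n. \<exists>y. eval r (m # xs) = Some (Suc y)))
      \<longleftrightarrow> (\<exists>n. P n)"
    using assms by (auto simp: of_bool_def)
  then show ?thesis using assms by simp
qed

lemma computable_Least:
  assumes "decidable (Suc k) (\<lambda>ys. P (hd ys) (tl ys))" "\<And>xs. length xs = k \<Longrightarrow> \<exists>n. P n xs"
  shows "computable k (\<lambda>xs. LEAST n. P n xs)"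
proof -
  obtain r where r: "\<And>ys. length ys = Suc k \<Longrightarrow> eval r ys = Some (of_bool (\<not> P (hd ys) (tl ys)))"
    using decidable_not[OF assms(1)] unfolding decidable_def computable_def by blast
  show ?thesis
    unfolding computable_def
  proof (intro exI[of _ "Mu r"] allI impI)
    fix xs :: "nat list" assume "length xs = k"
    then show "eval (Mu r) xs = Some (LEAST n. P n xs)"
      using eval_Mu_decidable[of r xs "\<lambda>n. P n xs"] r assms(2) by simp
  qed
qed

text \<open>A total test, followed by total postprocessing of the least stage that passes it; both
  machines constructed below have this shape.\<close>

lemma partial_search:
  assumes "decidable 2 (\<lambda>ys. S (hd ys) (hd (tl ys)))" "computable 2 h"
  obtains r where "\<And>x. eval r [x] = (if \<exists>s. S s x then Some (h [LEAST s. S s x, x]) else None)"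
proof -
  obtain r where r: "\<And>ys. length ys = 2 \<Longrightarrow> eval r ys = Some (of_bool (\<not> S (hd ys) (hd (tl ys))))"
    using decidable_not[OF assms(1)] unfolding decidable_def computable_def by blast
  obtain rh where rh: "\<And>ys. length ys = 2 \<Longrightarrow> eval rh ys = Some (h ys)"
    using assms(2) unfolding computable_def by blast
  have "eval (Comp rh [Mu r, Proj 0]) [x] =
      (if \<exists>s. S s x then Some (h [LEAST s. S s x, x]) else None)" for x
    using eval_Mu_decidable[of r "[x]" "\<lambda>s. S s x"] by (auto simp: r rh simp del: eval.simps(6))
  then show ?thesis by (rule that)
qed

lemma computable_div:
  assumes "computable k f" "computable k g"
  shows "computable k (\<lambda>xs. f xs div g xs)"
proof -
  \<comment> \<open>The disjunct for divisor 0 lets the search stop at 0, the value of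
    \<open>div\<close> in that case.\<close>
  have "computable k (\<lambda>xs. LEAST n. g xs = 0 \<and> n = 0 \<or> f xs < Suc n * g xs)"
  proof (rule computable_Least)
    show "\<exists>n. g xs = 0 \<and> n = 0 \<or> f xs < Suc n * g xs" for xs
      by (metis dividend_less_times_div mult.commute mult_Suc_right not_gr_zero)
  qed (intro decidable_disj decidable_conj decidable_eq decidable_less computable_mult
      computable_Suc computable_hd computable_const computable_tl assms; simp)
  moreover have "(LEAST n. b = 0 \<and> n = 0 \<or> a < Suc n * b) = a div b" for a b :: nat
  proof (rule Least_equality)
    show "b = 0 \<and> a div b = 0 \<or> a < Suc (a div b) * b"
      by (metis div_by_0 dividend_less_times_div mult.commute mult_Suc_right not_gr_zero)
    show "a div b \<le> y" if "b = 0 \<and> y = 0 \<or> a < Suc y * b" for y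
      using that by (metis div_by_0 le_refl less_Suc_eq_le less_mult_imp_div_less)
  qed
  ultimately show ?thesis by simp
qed

lemma computable_mod:
  assumes "computable k f" "computable k g"
  shows "computable k (\<lambda>xs. f xs mod g xs)"
  by (rule computable_cong[OF _ computable_diff[OF assms(1)
        computable_mult[OF assms(2) computable_div[OF assms]]]])
    (simp add: minus_mult_div_eq_mod)

lemmas computable_intros =
  computable_nth computable_hd computable_nth_tl computable_hd_tl computable_nth_tl_tl
  computable_hd_tl_tl computable_const computable_Suc computable_add computable_mult
  computable_power computable_diff computable_div computable_mod computable_sum computable_prod
  computable_if decidable_not decidable_conj decidable_disj decidable_imp decidable_iff
  decidable_le decidable_less decidable_eq decidable_const decidable_all decidable_ex

lemma decidable_app2:
  assumes "decidable 2 P" "computable k a" "computable k b"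
  shows "decidable k (\<lambda>xs. P [a xs, b xs])"
  using computable_app2[OF assms(1)[unfolded decidable_def] assms(2,3)] by (simp add: decidable_def)

section \<open>Step-bounded evaluation\<close>

text \<open>The value \<open>Suc y\<close> signals convergence to \<open>y\<close> within \<open>t\<close> steps, where \<open>t\<close> is the first argument.\<close>

definition step_eval :: "recf \<Rightarrow> nat \<Rightarrow> (nat list \<Rightarrow> nat) \<Rightarrow> bool" where
  "step_eval r k h \<longleftrightarrow> computable (Suc k) h \<and>
     (\<forall>xs. length xs = k \<longrightarrow>
        (\<forall>t t' y. h (t # xs) = Suc y \<longrightarrow> t \<le> t' \<longrightarrow> h (t' # xs) = Suc y) \<and>
        (\<forall>y. eval r xs = Some y \<longleftrightarrow> (\<exists>t. h (t # xs) = Suc y)))"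

lemma step_evalI:
  assumes "computable (Suc k) h"
    "\<And>xs t t' y. length xs = k \<Longrightarrow> h (t # xs) = Suc y \<Longrightarrow> t \<le> t' \<Longrightarrow> h (t' # xs) = Suc y"
    "\<And>xs t y. length xs = k \<Longrightarrow> h (t # xs) = Suc y \<Longrightarrow> eval r xs = Some y"
    "\<And>xs y. length xs = k \<Longrightarrow> eval r xs = Some y \<Longrightarrow> \<exists>t. h (t # xs) = Suc y"
  shows "step_eval r k h"
  unfolding step_eval_def
proof (intro conjI allI impI iffI)
  show "computable (Suc k) h" by (rule assms(1))
qed (use assms(2-4) in blast)+

lemma step_evalD:
  assumes "step_eval r k h" "length xs = k"
  shows "h (t # xs) = Suc y \<Longrightarrow> t \<le> t' \<Longrightarrow> h (t' # xs) = Suc y"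
    and "h (t # xs) = Suc y \<Longrightarrow> eval r xs = Some y"
    and "eval r xs = Some y \<Longrightarrow> \<exists>t. h (t # xs) = Suc y"
  using assms unfolding step_eval_def by blast+

text \<open>The maximum of finitely many individual bounds works by monotonicity. It merges the time
  bounds of the subcomputations into one.\<close>

lemma eventually_uniform:
  fixes P :: "'a \<Rightarrow> nat \<Rightarrow> bool"
  assumes "finite A" "\<And>m. m \<in> A \<Longrightarrow> \<exists>t. P m t" "\<And>m t t'. m \<in> A \<Longrightarrow> P m t \<Longrightarrow> t \<le> t' \<Longrightarrow> P m t'"
  shows "\<exists>T\<ge>T0. \<forall>m\<in>A. P m T"
proof -
  obtain \<tau> where \<tau>: "\<And>m. m \<in> A \<Longrightarrow> P m (\<tau> m)" using assms(2) by metis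
  have "P m (max T0 (Max (\<tau> ` A)))" if "m \<in> A" for m
    by (rule assms(3)[OF that \<tau>[OF that]]) (use assms(1) that in \<open>auto intro: max.coboundedI2\<close>)
  then show ?thesis by (intro exI[of _ "max T0 (Max (\<tau> ` A))"]) auto
qed

text \<open>Used where the number of trailing parameters is arbitrary: only the leading
  \<open>d\<close> arguments are recomputed and the rest is passed on.\<close>

lemma computable_compose_drop:
  assumes "computable (length fs + k) g" "\<And>f. f \<in> set fs \<Longrightarrow> computable (d + k) f"
  shows "computable (d + k) (\<lambda>xs. g (map (\<lambda>f. f xs) fs @ drop d xs))"
proof -
  let ?fs = "fs @ map (\<lambda>i xs. xs ! (d + i)) [0..<k]"
  have "computable (d + k) (\<lambda>xs. g (map (\<lambda>f. f xs) ?fs))"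
    by (rule computable_compose) (use assms in \<open>auto intro: computable_nth\<close>)
  moreover have "map (\<lambda>f. f xs) ?fs = map (\<lambda>f. f xs) fs @ drop d xs" if "length xs = d + k"
    for xs :: "nat list"
    using that by (auto intro!: nth_equalityI simp: nth_append)
  ultimately show ?thesis by (elim computable_cong[rotated]) (simp only:)
qed

lemma decidable_Ball_list:
  "(\<And>g. g \<in> set gs \<Longrightarrow> decidable k (P g)) \<Longrightarrow> decidable k (\<lambda>xs. \<forall>g\<in>set gs. P g xs)"
  by (induction gs) (auto intro: decidable_const decidable_conj)

lemma step_eval_None: "(\<And>xs. length xs = k \<Longrightarrow> eval r xs = None) \<Longrightarrow> step_eval r k (\<lambda>_. 0)"
  by (rule step_evalI) (auto intro: computable_const)

text \<open>One time bound is shared by the inner computations and the outer one; a single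
  unfinished inner computation makes the result 0. Monotonicity in the bound turns the separate
  convergence times into a common one.\<close>

lemma step_eval_Comp:
  assumes f: "step_eval f (length gs) hf" and H: "\<And>g. g \<in> set gs \<Longrightarrow> step_eval g k (H g)"
  shows "step_eval (Comp f gs) k (\<lambda>ts. if \<forall>g\<in>set gs. 0 < H g ts
           then hf (hd ts # map (\<lambda>g. H g ts - 1) gs) else 0)"
    (is "step_eval _ k ?h")
proof (rule step_evalI)
  have H': "computable (Suc k) (H g)" if "g \<in> set gs" for g
    using H[OF that] unfolding step_eval_def by blast
  have "computable (Suc k) (\<lambda>ts. hf (map (\<lambda>f. f ts) (hd # map (\<lambda>g ts. H g ts - 1) gs)))"
    by (rule computable_compose)
      (use f H' in \<open>auto simp: step_eval_def intro: computable_pred[simplified] computable_hd\<close>)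
  then show "computable (Suc k) ?h"
    by (intro computable_if computable_const decidable_Ball_list decidable_less H') (simp_all add: comp_def)
next
  fix xs :: "nat list" and t t' y assume xs: "length xs = k" and h: "?h (t # xs) = Suc y" and t: "t \<le> t'"
  then have pos: "\<forall>g\<in>set gs. 0 < H g (t # xs)" and v: "hf (t # map (\<lambda>g. H g (t # xs) - 1) gs) = Suc y"
    by (auto split: if_splits)
  have eq: "H g (t' # xs) = H g (t # xs)" if "g \<in> set gs" for g
    using step_evalD(1)[OF H[OF that] xs, of t _ t'] pos that t by (metis Suc_pred)
  show "?h (t' # xs) = Suc y"
    using step_evalD(1)[OF f _ v t] pos eq by (simp cong: map_cong)
next
  fix xs :: "nat list" and t y assume xs: "length xs = k" and h: "?h (t # xs) = Suc y"
  then have pos: "\<forall>g\<in>set gs. 0 < H g (t # xs)" and v: "hf (t # map (\<lambda>g. H g (t # xs) - 1) gs) = Suc y"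
    by (auto split: if_splits)
  have "eval g xs = Some (H g (t # xs) - 1)" if "g \<in> set gs" for g
    using step_evalD(2)[OF H[OF that] xs, of t "H g (t # xs) - 1"] pos that by simp
  then have "those (map (\<lambda>g. eval g xs) gs) = Some (map (\<lambda>g. H g (t # xs) - 1) gs)"
    by (rule those_eq_Some)
  then show "eval (Comp f gs) xs = Some y"
    using step_evalD(2)[OF f _ v] by simp
next
  fix xs :: "nat list" and y assume xs: "length xs = k" and e: "eval (Comp f gs) xs = Some y"
  then obtain vs where vs: "those (map (\<lambda>g. eval g xs) gs) = Some vs" and fv: "eval f vs = Some y"
    by (auto simp: bind_eq_Some_conv)
  from vs have v: "list_all2 (\<lambda>g v. eval g xs = Some v) gs vs"
  proof (induction gs arbitrary: vs)
    case (Cons g gs)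
    then show ?case by (auto split: option.splits)
  qed simp
  have len: "length vs = length gs" using list_all2_lengthD[OF v] by simp
  have ev: "eval (gs ! i) xs = Some (vs ! i)" if "i < length gs" for i
    using list_all2_nthD[OF v that] .
  obtain t0 where t0: "hf (t0 # vs) = Suc y" using step_evalD(3)[OF f len fv] by blast
  have "\<exists>T\<ge>t0. \<forall>i\<in>{..<length gs}. H (gs ! i) (T # xs) = Suc (vs ! i)"
  proof (rule eventually_uniform)
    fix i t t' assume "i \<in> {..<length gs}"
    then have i: "i < length gs" and Hi: "step_eval (gs ! i) k (H (gs ! i))" using H by auto
    show "\<exists>t. H (gs ! i) (t # xs) = Suc (vs ! i)" by (rule step_evalD(3)[OF Hi xs ev[OF i]])
    show "H (gs ! i) (t # xs) = Suc (vs ! i) \<Longrightarrow> t \<le> t' \<Longrightarrow> H (gs ! i) (t' # xs) = Suc (vs ! i)"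
      by (rule step_evalD(1)[OF Hi xs])
  qed simp
  then obtain T where T: "t0 \<le> T" "\<And>i. i < length gs \<Longrightarrow> H (gs ! i) (T # xs) = Suc (vs ! i)"
    by auto
  have "map (\<lambda>g. H g (T # xs) - 1) gs = vs" using T(2) len by (auto intro: nth_equalityI)
  moreover have "\<forall>g\<in>set gs. 0 < H g (T # xs)" using T(2) by (auto simp: in_set_conv_nth)
  ultimately show "\<exists>t. ?h (t # xs) = Suc y"
    using step_evalD(1)[OF f len t0 T(1)] by (intro exI[of _ T]) simp
qed

text \<open>The value 0 is absorbing: once an iterate has not converged within the bound, the later
  ones are 0 too. The recursion argument stands at position 1, after the bound.\<close>

lemma step_eval_PrimRec:
  assumes f: "step_eval f k hf" and g: "step_eval g (Suc (Suc k)) hg"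
  shows "step_eval (PrimRec f g) (Suc k) (\<lambda>ts. rec_nat (hf (hd ts # drop 2 ts))
           (\<lambda>m r. if r = 0 then 0 else hg (hd ts # m # (r - 1) # drop 2 ts)) (ts ! 1))"
    (is "step_eval _ _ ?h")
proof (rule step_evalI)
  define N where "N t ys n = rec_nat (hf (t # ys))
      (\<lambda>m r. if r = 0 then 0 else hg (t # m # (r - 1) # ys)) n" for t ys n
  have hN: "?h (t # n # ys) = N t ys n" for t ys n by (simp add: N_def cong: if_cong)
  have n0: "N t ys 0 = hf (t # ys)" for t ys by (simp add: N_def)
  have nS: "N t ys (Suc m) = (if N t ys m = 0 then 0 else hg (t # m # (N t ys m - 1) # ys))"
    for t ys m by (simp add: N_def cong: if_cong)
  have pr: "eval (PrimRec f g) (Suc m # ys) =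
      Option.bind (eval (PrimRec f g) (m # ys)) (\<lambda>y. eval g (m # y # ys))" for m ys by simp
  show "computable (Suc (Suc k)) ?h"
  proof (intro computable_rec_nat computable_nth)
    show "computable (Suc (Suc k)) (\<lambda>ts. hf (hd ts # drop 2 ts))"
      using computable_compose_drop[of "[hd]" k hf 2] f
      by (auto simp: step_eval_def intro: computable_hd)
    have "computable (4 + k) (\<lambda>ws. hg (map (\<lambda>f. f ws)
        [\<lambda>ws. hd (tl (tl ws)), hd, \<lambda>ws. hd (tl ws) - 1] @ drop 4 ws))"
      using g by (intro computable_compose_drop)
        (auto simp: step_eval_def numeral_3_eq_3 intro!: computable_hd computable_hd_tl_tl
            computable_pred[simplified] computable_hd_tl)
    then have "computable (Suc (Suc (Suc (Suc k)))) (\<lambda>ws. hg (hd (tl (tl ws)) # hd ws # (hd (tl ws) - 1) # drop 2 (tl (tl ws))))"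
      by (simp add: drop_Suc numeral_eq_Suc)
    then show "computable (Suc (Suc (Suc (Suc k)))) (\<lambda>ws. if hd (tl ws) = 0 then 0
        else hg (hd (tl (tl ws)) # hd ws # (hd (tl ws) - 1) # drop 2 (tl (tl ws))))"
      by (intro computable_if computable_const decidable_eq computable_hd_tl) simp_all
  qed simp
  show "?h (t' # xs) = Suc y" if xs: "length xs = Suc k" and h: "?h (t # xs) = Suc y" and t: "t \<le> t'"
    for xs t t' y
  proof -
    obtain n ys where [simp]: "xs = n # ys" and ys: "length ys = k" using xs by (cases xs) auto
    have "N t ys n = Suc y \<Longrightarrow> N t' ys n = Suc y"
    proof (induction n arbitrary: y)
      case 0
      then show ?case using step_evalD(1)[OF f ys _ t] by (simp add: n0)
    next
      case (Suc m)
      then obtain z where z: "N t ys m = Suc z" unfolding nS by (auto simp: gr0_conv_Suc split: if_splits)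
      then have "N t' ys m = Suc z" using Suc.IH by blast
      moreover have "hg (t # m # z # ys) = Suc y" using Suc.prems z unfolding nS by simp
      ultimately show ?case using step_evalD(1)[OF g _ _ t, of "m # z # ys" y] ys unfolding nS by simp
    qed
    then show ?thesis using h unfolding \<open>xs = n # ys\<close> hN by blast
  qed
  show "eval (PrimRec f g) xs = Some y" if xs: "length xs = Suc k" and h: "?h (t # xs) = Suc y"
    for xs t y
  proof -
    obtain n ys where [simp]: "xs = n # ys" and ys: "length ys = k" using xs by (cases xs) auto
    have "N t ys n = Suc y \<Longrightarrow> eval (PrimRec f g) (n # ys) = Some y"
    proof (induction n arbitrary: y)
      case 0
      then show ?case using step_evalD(2)[OF f ys] by (simp add: n0)
    next
      case (Suc m)
      then obtain z where z: "N t ys m = Suc z" unfolding nS by (auto simp: gr0_conv_Suc split: if_splits)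
      then have e: "eval (PrimRec f g) (m # ys) = Some z" using Suc.IH by blast
      have "hg (t # m # z # ys) = Suc y" using Suc.prems z unfolding nS by simp
      then show ?case using step_evalD(2)[OF g, of "m # z # ys"] ys unfolding pr e by simp
    qed
    then show ?thesis using h unfolding \<open>xs = n # ys\<close> hN by blast
  qed
  show "\<exists>t. ?h (t # xs) = Suc y" if xs: "length xs = Suc k" and h: "eval (PrimRec f g) xs = Some y"
    for xs y
  proof -
    obtain n ys where xs': "xs = n # ys" and ys: "length ys = k" using xs by (cases xs) auto
    \<comment> \<open>Convergence is claimed for all bounds from some point on, so that the bound
      for the previous iterate and the one for the current step can be merged by
      \<open>max\<close>.\<close>
    have "\<exists>T. \<forall>t\<ge>T. N t ys n = Suc y" if "eval (PrimRec f g) (n # ys) = Some y"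
      using that
    proof (induction n arbitrary: y)
      case 0
      then obtain T where "hf (T # ys) = Suc y" using step_evalD(3)[OF f ys] by auto
      then show ?case using step_evalD(1)[OF f ys] unfolding n0 by blast
    next
      case (Suc m)
      then obtain z where z: "eval (PrimRec f g) (m # ys) = Some z" and gz: "eval g (m # z # ys) = Some y"
        unfolding pr by (auto simp: bind_eq_Some_conv simp del: eval.simps)
      obtain T where T: "\<And>t. t \<ge> T \<Longrightarrow> N t ys m = Suc z" using Suc.IH[OF z] by blast
      have len: "length (m # z # ys) = Suc (Suc k)" using ys by simp
      obtain T' where T': "hg (T' # m # z # ys) = Suc y" using step_evalD(3)[OF g len gz] by blast
      have "N t ys (Suc m) = Suc y" if "t \<ge> max T T'" for t
        using T[of t] step_evalD(1)[OF g len T'] that unfolding nS by simp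
      then show ?case by blast
    qed
    then show ?thesis using h unfolding xs' hN by blast
  qed
qed

text \<open>\<open>c\<close> is the first candidate at which the bounded search stops: the bound is
  reached, or the value is 0 (not yet converged) or 1 (converged to zero). Larger values certify
  nonzero results and let the search pass. Only a stop with value 1 yields an answer.\<close>

lemma step_eval_Mu:
  assumes f: "step_eval f (Suc k) hf"
  defines "c \<equiv> \<lambda>ts. LEAST n. hd ts \<le> n \<or> hf (hd ts # n # tl ts) < 2"
  shows "step_eval (Mu f) k (\<lambda>ts. if hf (hd ts # c ts # tl ts) = 1 then Suc (c ts) else 0)"
    (is "step_eval _ _ ?h")
proof (rule step_evalI)
  have hf: "computable (Suc (Suc k)) hf" using f unfolding step_eval_def by blast
  have 1: "computable (Suc (Suc k)) (\<lambda>ws. hf (hd (tl ws) # hd ws # tl (tl ws)))"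
    using computable_compose_drop[of "[\<lambda>ws. hd (tl ws), hd]" k hf 2] hf
    by (auto intro: computable_hd computable_hd_tl simp: drop_Suc numeral_2_eq_2)
  have c: "computable (Suc k) c"
    unfolding c_def
    by (rule computable_Least)
      (intro decidable_disj decidable_le decidable_less computable_hd_tl computable_hd 1
        computable_const, auto)
  have "computable (Suc k) (\<lambda>ts. hf (hd ts # c ts # tl ts))"
    using computable_compose_drop[of "[hd, c]" k hf 1] hf c
    by (auto intro: computable_hd simp: drop_Suc)
  then show "computable (Suc k) ?h"
    by (intro computable_if decidable_eq computable_const computable_Suc c)
  have spec: "hf (t # y # xs) = 1 \<and> (\<forall>m<y. m < t \<and> 2 \<le> hf (t # m # xs))"
    if "?h (t # xs) = Suc y" for t xs y
  proof -
    have "c (t # xs) = y" "hf (t # y # xs) = 1" using that by (auto split: if_splits)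
    moreover have "m < t \<and> 2 \<le> hf (t # m # xs)" if "m < c (t # xs)" for m
      using not_less_Least[OF that[unfolded c_def]] by auto
    ultimately show ?thesis by blast
  qed
  have char: "?h (t # xs) = Suc y"
    if "hf (t # y # xs) = 1" "\<And>m. m < y \<Longrightarrow> m < t \<and> 2 \<le> hf (t # m # xs)" for t xs y
  proof -
    have "c (t # xs) = y"
      unfolding c_def
    proof (rule Least_equality)
      show "y \<le> n" if "hd (t # xs) \<le> n \<or> hf (hd (t # xs) # n # tl (t # xs)) < 2" for n
        using that \<open>\<And>m. m < y \<Longrightarrow> m < t \<and> 2 \<le> hf (t # m # xs)\<close>[of n] by (cases "n < y") auto
    qed (use that in simp)
    then show ?thesis using that(1) by simp
  qed
  show "?h (t' # xs) = Suc y" if xs: "length xs = k" and h: "?h (t # xs) = Suc y" and t: "t \<le> t'"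
    for xs t t' y
  proof (rule char)
    show "hf (t' # y # xs) = 1"
      using step_evalD(1)[OF f _ _ t, of "y # xs" 0] spec[OF h] xs by simp
    show "m < t' \<and> 2 \<le> hf (t' # m # xs)" if "m < y" for m
    proof -
      have m: "m < t" "2 \<le> hf (t # m # xs)" using spec[OF h] that by auto
      then have "hf (t # m # xs) = Suc (hf (t # m # xs) - 1)" by simp
      then have "hf (t' # m # xs) = hf (t # m # xs)"
        using step_evalD(1)[OF f _ _ t, of "m # xs"] xs by simp
      then show ?thesis using m t by simp
    qed
  qed
  show "eval (Mu f) xs = Some y" if xs: "length xs = k" and h: "?h (t # xs) = Suc y" for xs t y
  proof -
    have 0: "eval f (y # xs) = Some 0"
      using step_evalD(2)[OF f, of "y # xs" t 0] spec[OF h] xs by simp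
    have S: "\<exists>z. eval f (m # xs) = Some (Suc z)" if "m < y" for m
    proof -
      have "2 \<le> hf (t # m # xs)" using spec[OF h] that by auto
      then have "hf (t # m # xs) = Suc (Suc (hf (t # m # xs) - 2))" by simp
      then show ?thesis using step_evalD(2)[OF f, of "m # xs" t] xs by auto
    qed
    have "(LEAST n. eval f (n # xs) = Some 0) = y"
      by (rule Least_equality[of "\<lambda>n. eval f (n # xs) = Some 0", OF 0])
        (metis S leI nat.distinct(1) option.inject)
    moreover have "\<exists>n. eval f (n # xs) = Some 0 \<and> (\<forall>m<n. \<exists>y. eval f (m # xs) = Some (Suc y))"
      using 0 S by blast
    ultimately show ?thesis by simp
  qed
  show "\<exists>t. ?h (t # xs) = Suc y" if xs: "length xs = k" and e: "eval (Mu f) xs = Some y" for xs y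
  proof -
    obtain n where n: "eval f (n # xs) = Some 0" "\<forall>m<n. \<exists>y. eval f (m # xs) = Some (Suc y)"
      using e by (auto split: if_splits)
    have "(LEAST n. eval f (n # xs) = Some 0) = n"
      by (rule Least_equality[of "\<lambda>n. eval f (n # xs) = Some 0", OF n(1)])
        (metis n(2) leI nat.distinct(1) option.inject)
    then have y: "y = n" using e by (auto split: if_splits)
    obtain z where z: "\<And>m. m < n \<Longrightarrow> eval f (m # xs) = Some (Suc (z m))" using n(2) by metis
    \<comment> \<open>\<open>z'\<close> also covers \<open>n\<close> itself, with result 0, so that
      one time bound serves the nonzero results and the final zero together.\<close>
    define z' where "z' = (\<lambda>m. if m < n then Suc (z m) else 0)"
    have z': "eval f (m # xs) = Some (z' m)" if "m \<le> n" for m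
      using that z n(1) by (cases "m = n") (auto simp: z'_def)
    have "\<exists>T\<ge>Suc n. \<forall>m\<in>{..n}. hf (T # m # xs) = Suc (z' m)"
    proof (rule eventually_uniform)
      fix m t t' assume "m \<in> {..n}"
      then have m: "m \<le> n" and len: "length (m # xs) = Suc k" using xs by auto
      show "\<exists>t. hf (t # m # xs) = Suc (z' m)" by (rule step_evalD(3)[OF f len z'[OF m]])
      show "hf (t # m # xs) = Suc (z' m) \<Longrightarrow> t \<le> t' \<Longrightarrow> hf (t' # m # xs) = Suc (z' m)"
        by (rule step_evalD(1)[OF f len])
    qed simp
    then obtain T where T: "T > n" "\<And>m. m \<le> n \<Longrightarrow> hf (T # m # xs) = Suc (z' m)"
      by (meson Suc_le_eq atMost_iff)
    have "?h (T # xs) = Suc n"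
      by (rule char) (use T in \<open>auto simp: z'_def\<close>)
    then show ?thesis using y by blast
  qed
qed

text \<open>Its use is to enumerate the graph of a given prefix-free machine in computable
  stages.\<close>

lemma step_eval_exists: "\<exists>h. step_eval r k h"
proof (induction r arbitrary: k)
  case Zero
  show ?case by (rule exI[of _ "\<lambda>_. 1"], rule step_evalI) (auto intro: computable_const)
next
  case Succ
  show ?case
  proof (cases k)
    case 0
    then show ?thesis using step_eval_None[of k Succ] by auto
  next
    case (Suc k')
    then show ?thesis
      by (intro exI[of _ "\<lambda>ts. Suc (Suc (hd (tl ts)))"] step_evalI)
        (auto intro!: computable_Suc computable_hd_tl simp: length_Suc_conv)
  qed
next
  case (Proj i)
  show ?case
  proof (cases "i < k")
    case True
    then show ?thesis
      by (intro exI[of _ "\<lambda>ts. Suc (tl ts ! i)"] step_evalI)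
        (auto intro!: computable_Suc computable_nth_tl)
  next
    case False
    then show ?thesis using step_eval_None[of k "Proj i"] by auto
  qed
next
  case (Comp f gs)
  obtain hf where "step_eval f (length gs) hf" using Comp.IH(1) by blast
  moreover obtain H where "\<And>g. g \<in> set gs \<Longrightarrow> step_eval g k (H g)" using Comp.IH(2)[where k = k] by metis
  ultimately show ?case by (blast intro: step_eval_Comp)
next
  case (PrimRec f g)
  show ?case
  proof (cases k)
    case 0
    then show ?thesis using step_eval_None[of k "PrimRec f g"] by auto
  next
    case (Suc k')
    then show ?thesis using PrimRec.IH by (blast intro: step_eval_PrimRec)
  qed
next
  case (Mu f)
  then show ?case by (blast intro: step_eval_Mu)
qed

section \<open>Computable rational functions\<close>

lemma computable_rat_cong:
  assumes "\<And>xs. length xs = k \<Longrightarrow> f xs = g xs" "computable_rat k f"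
  shows "computable_rat k g"
  using assms unfolding computable_rat_def by metis

lemma computable_ratI:
  assumes "computable k a" "computable k b" "computable k c"
    "\<And>xs. length xs = k \<Longrightarrow> q xs = (of_nat (a xs) - of_nat (b xs)) / of_nat (Suc (c xs))"
  shows "computable_rat k q"
  using assms unfolding computable_rat_def by blast

lemma computable_ratE:
  assumes "computable_rat k q"
  obtains a b c where "computable k a" "computable k b" "computable k c"
    "\<And>xs. length xs = k \<Longrightarrow> q xs = (of_nat (a xs) - of_nat (b xs)) / of_nat (Suc (c xs))"
  using assms unfolding computable_rat_def by blast

lemma computable_rat_of_nat: "computable k f \<Longrightarrow> computable_rat k (\<lambda>xs. of_nat (f xs))"
  by (rule computable_ratI[of k f "\<lambda>_. 0" "\<lambda>_. 0"]) (auto intro: computable_const)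

lemma computable_rat_const: "computable_rat k (\<lambda>_. c)"
proof -
  obtain m n where mn: "quotient_of c = (m, n)" by fastforce
  have n: "n > 0" and c: "c = of_int m / of_int n"
    using quotient_of_denom_pos[OF mn] quotient_of_div[OF mn] by auto
  show ?thesis
  proof (rule computable_ratI[OF computable_const computable_const computable_const])
    have "of_int m = (of_nat (nat m) - of_nat (nat (- m)) :: rat)"
      by (cases "m \<ge> 0") (auto simp: of_nat_nat)
    moreover have "of_int n = (of_nat (Suc (nat (n - 1))) :: rat)"
      using n by (simp add: of_nat_nat)
    ultimately show "c = (of_nat (nat m) - of_nat (nat (- m))) / of_nat (Suc (nat (n - 1)))"
      by (simp only: c)
  qed
qed

lemma computable_rat_add:
  assumes "computable_rat k p" "computable_rat k q"
  shows "computable_rat k (\<lambda>xs. p xs + q xs)"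
proof -
  from computable_ratE[OF assms(1)] obtain a b c where
    p: "computable k a" "computable k b" "computable k c"
    "\<And>xs. length xs = k \<Longrightarrow> p xs = (of_nat (a xs) - of_nat (b xs)) / of_nat (Suc (c xs))" by metis
  from computable_ratE[OF assms(2)] obtain a' b' c' where
    q: "computable k a'" "computable k b'" "computable k c'"
    "\<And>xs. length xs = k \<Longrightarrow> q xs = (of_nat (a' xs) - of_nat (b' xs)) / of_nat (Suc (c' xs))" by metis
  show ?thesis
  proof (rule computable_ratI)
    show "computable k (\<lambda>xs. a xs * Suc (c' xs) + a' xs * Suc (c xs))"
      "computable k (\<lambda>xs. b xs * Suc (c' xs) + b' xs * Suc (c xs))"
      "computable k (\<lambda>xs. c xs * Suc (c' xs) + c' xs)"
      by (intro computable_add computable_mult computable_Suc p q)+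
    fix xs :: "nat list" assume l: "length xs = k"
    have *: "of_nat (Suc (c xs * Suc (c' xs) + c' xs)) = (of_nat (Suc (c xs)) * of_nat (Suc (c' xs)) :: rat)"
      by (simp add: algebra_simps)
    show "p xs + q xs = (of_nat (a xs * Suc (c' xs) + a' xs * Suc (c xs)) -
        of_nat (b xs * Suc (c' xs) + b' xs * Suc (c xs))) / of_nat (Suc (c xs * Suc (c' xs) + c' xs))"
      unfolding p(4)[OF l] q(4)[OF l] * of_nat_add of_nat_mult
      by (simp add: add_frac_eq algebra_simps del: of_nat_Suc)
  qed
qed

lemma computable_rat_mult:
  assumes "computable_rat k p" "computable_rat k q"
  shows "computable_rat k (\<lambda>xs. p xs * q xs)"
proof -
  from computable_ratE[OF assms(1)] obtain a b c where
    p: "computable k a" "computable k b" "computable k c"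
    "\<And>xs. length xs = k \<Longrightarrow> p xs = (of_nat (a xs) - of_nat (b xs)) / of_nat (Suc (c xs))" by metis
  from computable_ratE[OF assms(2)] obtain a' b' c' where
    q: "computable k a'" "computable k b'" "computable k c'"
    "\<And>xs. length xs = k \<Longrightarrow> q xs = (of_nat (a' xs) - of_nat (b' xs)) / of_nat (Suc (c' xs))" by metis
  show ?thesis
  proof (rule computable_ratI)
    show "computable k (\<lambda>xs. a xs * a' xs + b xs * b' xs)"
      "computable k (\<lambda>xs. a xs * b' xs + b xs * a' xs)"
      "computable k (\<lambda>xs. c xs * Suc (c' xs) + c' xs)"
      by (intro computable_add computable_mult computable_Suc p q)+
    fix xs :: "nat list" assume l: "length xs = k"
    have *: "of_nat (Suc (c xs * Suc (c' xs) + c' xs)) = (of_nat (Suc (c xs)) * of_nat (Suc (c' xs)) :: rat)"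
      by (simp add: algebra_simps)
    show "p xs * q xs = (of_nat (a xs * a' xs + b xs * b' xs) - of_nat (a xs * b' xs + b xs * a' xs)) /
        of_nat (Suc (c xs * Suc (c' xs) + c' xs))"
      unfolding p(4)[OF l] q(4)[OF l] *
      by (simp add: algebra_simps del: of_nat_Suc)
  qed
qed

lemma computable_rat_uminus:
  assumes "computable_rat k q" shows "computable_rat k (\<lambda>xs. - q xs)"
  using computable_rat_mult[OF computable_rat_const[of k "-1"] assms] by simp

lemma computable_rat_diff:
  assumes "computable_rat k p" "computable_rat k q"
  shows "computable_rat k (\<lambda>xs. p xs - q xs)"
  using computable_rat_add[OF assms(1) computable_rat_uminus[OF assms(2)]] by simp

lemma computable_rat_if:
  assumes "decidable k P" "computable_rat k p" "computable_rat k q"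
  shows "computable_rat k (\<lambda>xs. if P xs then p xs else q xs)"
proof -
  have "computable_rat k (\<lambda>xs. of_nat (of_bool (P xs)) * p xs + of_nat (of_bool (\<not> P xs)) * q xs)"
    using assms(1) decidable_not[OF assms(1)] unfolding decidable_def
    by (intro computable_rat_add computable_rat_mult computable_rat_of_nat assms(2,3))
  then show ?thesis by (rule computable_rat_cong[rotated]) auto
qed

lemma computable_rat_half_power:
  assumes "computable k f"
  shows "computable_rat k (\<lambda>xs. (1 / 2) ^ f xs)"
proof (rule computable_ratI)
  show "computable k (\<lambda>_. 1)" "computable k (\<lambda>_. 0)" "computable k (\<lambda>xs. 2 ^ f xs - 1)"
    by (intro computable_intros assms)+
  have "of_nat (Suc (2 ^ n - 1)) = (2 ^ n :: rat)" for n
    by (simp add: of_nat_diff)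
  then show "(1 / 2) ^ f xs = (of_nat 1 - of_nat 0) / (of_nat (Suc (2 ^ f xs - 1)) :: rat)" for xs
    by (simp add: power_one_over field_simps)
qed

lemma computable_Cons_tl:
  assumes "computable (Suc k) f" shows "computable (Suc k) (\<lambda>ys. f (hd ys # tl ys))"
  by (rule computable_cong[OF _ assms]) (metis list.collapse list.size(3) nat.distinct(1))

text \<open>Over the common denominator \<open>D\<close>, the product of all denominators, the
  numerators are bounded sums of naturals. Positive and negative parts are summed separately, since
  subtraction of naturals is truncated.\<close>

lemma computable_rat_sum:
  assumes "computable k n" "computable_rat (Suc k) (\<lambda>ys. F (hd ys) (tl ys))"
  shows "computable_rat k (\<lambda>xs. \<Sum>i<n xs. F i xs)"
proof -
  from computable_ratE[OF assms(2)] obtain a b c where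
    F: "computable (Suc k) a" "computable (Suc k) b" "computable (Suc k) c"
    "\<And>ys. length ys = Suc k \<Longrightarrow> F (hd ys) (tl ys) = (of_nat (a ys) - of_nat (b ys)) / of_nat (Suc (c ys))"
    by metis
  define D where "D = (\<lambda>xs. \<Prod>i<n xs. Suc (c (i # xs)))"
  have D: "computable k D"
    unfolding D_def by (intro computable_intros computable_Cons_tl assms F)
  have num: "computable k (\<lambda>xs. \<Sum>i<n xs. h (i # xs) * (D xs div Suc (c (i # xs))))"
    if "computable (Suc k) h" for h
    by (intro computable_intros computable_Cons_tl assms F computable_tl[OF D] that)
  have eq: "(\<Sum>i<n xs. of_nat (h (i # xs)) / of_nat (Suc (c (i # xs)))) =
      of_nat (\<Sum>i<n xs. h (i # xs) * (D xs div Suc (c (i # xs)))) / (of_nat (D xs) :: rat)" for h xs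
    unfolding of_nat_sum sum_divide_distrib
  proof (rule sum.cong)
    fix i assume "i \<in> {..<n xs}"
    then have dvd: "Suc (c (i # xs)) dvd D xs" unfolding D_def by (intro dvd_prodI) auto
    have "D xs > 0" unfolding D_def by (rule prod_pos) simp
    then show "of_nat (h (i # xs)) / of_nat (Suc (c (i # xs))) =
        of_nat (h (i # xs) * (D xs div Suc (c (i # xs)))) / (of_nat (D xs) :: rat)"
      using dvd by (simp add: of_nat_div field_simps del: of_nat_Suc)
        (metis dvd_div_mult_self of_nat_mult mult.commute)
  qed simp
  show ?thesis
  proof (rule computable_ratI[OF num[OF F(1)] num[OF F(2)] computable_diff[OF D computable_const[of _ 1]]])
    fix xs :: "nat list" assume l: "length xs = k"
    have "D xs > 0" unfolding D_def by (rule prod_pos) simp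
    then have *: "Suc (D xs - 1) = D xs" by simp
    have "(\<Sum>i<n xs. F i xs) =
        (\<Sum>i<n xs. of_nat (a (i # xs)) / of_nat (Suc (c (i # xs)))) -
        (\<Sum>i<n xs. of_nat (b (i # xs)) / of_nat (Suc (c (i # xs))))"
      unfolding sum_subtractf[symmetric] diff_divide_distrib[symmetric]
      using F(4)[of "_ # xs"] l by (intro sum.cong) (simp_all del: of_nat_Suc)
    then show "(\<Sum>i<n xs. F i xs) =
        (of_nat (\<Sum>i<n xs. a (i # xs) * (D xs div Suc (c (i # xs)))) -
         of_nat (\<Sum>i<n xs. b (i # xs) * (D xs div Suc (c (i # xs))))) / of_nat (Suc (D xs - 1))"
      unfolding eq * diff_divide_distrib .
  qed
qed

lemma computable_rat_app2:
  assumes "computable_rat 2 q" "computable k a" "computable k b"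
  shows "computable_rat k (\<lambda>xs. q [a xs, b xs])"
proof -
  from computable_ratE[OF assms(1)] obtain A B C where
    q: "computable 2 A" "computable 2 B" "computable 2 C"
    "\<And>xs. length xs = 2 \<Longrightarrow> q xs = (of_nat (A xs) - of_nat (B xs)) / of_nat (Suc (C xs))" by metis
  show ?thesis
    by (rule computable_ratI[OF computable_app2[OF q(1) assms(2,3)]
          computable_app2[OF q(2) assms(2,3)] computable_app2[OF q(3) assms(2,3)]]) (simp add: q(4))
qed

lemma computable_rat_app3:
  assumes "computable_rat 3 q" "computable k a" "computable k b" "computable k c"
  shows "computable_rat k (\<lambda>xs. q [a xs, b xs, c xs])"
proof -
  from computable_ratE[OF assms(1)] obtain A B C where
    q: "computable 3 A" "computable 3 B" "computable 3 C"
    "\<And>xs. length xs = 3 \<Longrightarrow> q xs = (of_nat (A xs) - of_nat (B xs)) / of_nat (Suc (C xs))" by metis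
  show ?thesis
    by (rule computable_ratI[OF computable_app3[OF q(1) assms(2-4)]
          computable_app3[OF q(2) assms(2-4)] computable_app3[OF q(3) assms(2-4)]]) (simp add: q(4))
qed

lemma decidable_rat_le:
  assumes "computable_rat k p" "computable_rat k q"
  shows "decidable k (\<lambda>xs. p xs \<le> q xs)"
proof -
  from computable_ratE[OF computable_rat_diff[OF assms(2,1)]] obtain a b c where
    p: "computable k a" "computable k b" "computable k c"
    "\<And>xs. length xs = k \<Longrightarrow> q xs - p xs = (of_nat (a xs) - of_nat (b xs)) / of_nat (Suc (c xs))" by metis
  show ?thesis
  proof (rule decidable_cong[OF _ decidable_le[OF p(2,1)]])
    fix xs :: "nat list" assume l: "length xs = k"
    have "p xs \<le> q xs \<longleftrightarrow> 0 \<le> q xs - p xs" by simp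
    also have "\<dots> \<longleftrightarrow> (of_nat (b xs) :: rat) \<le> of_nat (a xs)"
      unfolding p(4)[OF l] by (simp add: zero_le_divide_iff del: of_nat_Suc)
    finally show "b xs \<le> a xs \<longleftrightarrow> p xs \<le> q xs" by simp
  qed
qed

lemma decidable_rat_less:
  assumes "computable_rat k p" "computable_rat k q"
  shows "decidable k (\<lambda>xs. p xs < q xs)"
  using decidable_not[OF decidable_rat_le[OF assms(2,1)]] by (simp add: not_le)

lemmas computable_rat_intros =
  computable_rat_of_nat computable_rat_const computable_rat_add computable_rat_mult
  computable_rat_uminus computable_rat_diff computable_rat_if computable_rat_half_power
  computable_rat_sum decidable_rat_le decidable_rat_less

section \<open>Arithmetic of string codes\<close>

text \<open>The binary expansion of \<open>str_code \<sigma> + 1\<close> is a leading one above the bits of \<open>\<sigma>\<close>, whose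
  first bit is the least significant one.\<close>

lemma str_code_append: "str_code (\<sigma> @ \<tau>) = str_code \<sigma> + 2 ^ length \<sigma> * str_code \<tau>"
  by (induction \<sigma>) auto

lemma str_code_bounds: "2 ^ length \<sigma> \<le> Suc (str_code \<sigma>)" "Suc (str_code \<sigma>) < 2 ^ Suc (length \<sigma>)"
  by (induction \<sigma>) auto

definition code_length :: "nat \<Rightarrow> nat" where
  "code_length x = (LEAST n. Suc x < 2 ^ Suc n)"

definition code_take :: "nat \<Rightarrow> nat \<Rightarrow> nat" where
  "code_take l x = 2 ^ l - 1 + Suc x mod 2 ^ l"

definition code_nth :: "nat \<Rightarrow> nat \<Rightarrow> bool" where
  "code_nth x l \<longleftrightarrow> Suc x div 2 ^ l mod 2 = 1"

text \<open>The factor 2 or 1 is the code of the appended one-bit string.\<close>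

definition code_snoc :: "nat \<Rightarrow> bool \<Rightarrow> nat" where
  "code_snoc x b = x + 2 ^ code_length x * (if b then 2 else 1)"

lemma code_length_str_code [simp]: "code_length (str_code \<sigma>) = length \<sigma>"
  unfolding code_length_def
proof (rule Least_equality)
  show "length \<sigma> \<le> n" if "Suc (str_code \<sigma>) < 2 ^ Suc n" for n
  proof -
    have "(2::nat) ^ length \<sigma> < 2 ^ Suc n" using str_code_bounds(1)[of \<sigma>] that by linarith
    then have "length \<sigma> < Suc n" by (rule power_less_imp_less_exp[rotated]) simp
    then show ?thesis by simp
  qed
qed (rule str_code_bounds)

lemma code_snoc_str_code [simp]: "code_snoc (str_code \<sigma>) b = str_code (\<sigma> @ [b])"
  by (simp add: code_snoc_def str_code_append)

lemma code_take_str_code [simp]: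
  assumes "l \<le> length \<sigma>"
  shows "code_take l (str_code \<sigma>) = str_code (take l \<sigma>)"
proof -
  let ?t = "str_code (take l \<sigma>)"
  have b: "2 ^ l \<le> Suc ?t" "Suc ?t < 2 ^ Suc l"
    using str_code_bounds[of "take l \<sigma>"] assms by (simp_all add: min_absorb2)
  have "str_code \<sigma> = ?t + 2 ^ l * str_code (drop l \<sigma>)"
    using str_code_append[of "take l \<sigma>" "drop l \<sigma>"] assms by (simp add: min_absorb2)
  then have "Suc (str_code \<sigma>) mod 2 ^ l = Suc ?t mod 2 ^ l"
    by (metis add_Suc mod_mult_self2)
  also have "\<dots> = Suc ?t - 2 ^ l"
    using b by (subst le_mod_geq) auto
  finally show ?thesis unfolding code_take_def using b by simp
qed

lemma code_nth_str_code [simp]: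
  assumes "l < length \<sigma>"
  shows "code_nth (str_code \<sigma>) l = \<sigma> ! l"
proof -
  let ?t = "str_code (take l \<sigma>)" and ?d = "str_code (drop l \<sigma>)"
  have b: "2 ^ l \<le> Suc ?t" "Suc ?t < 2 ^ Suc l"
    using str_code_bounds[of "take l \<sigma>"] assms by (simp_all add: min_absorb2)
  have "str_code \<sigma> = ?t + 2 ^ l * ?d"
    using str_code_append[of "take l \<sigma>" "drop l \<sigma>"] assms by (simp add: min_absorb2)
  then have "Suc (str_code \<sigma>) = (Suc ?t - 2 ^ l) + 2 ^ l * Suc ?d" using b by simp
  moreover have "(Suc ?t - 2 ^ l) div 2 ^ l = 0" using b by simp
  ultimately have "Suc (str_code \<sigma>) div 2 ^ l = Suc ?d"
    using div_mult_self2[of "2 ^ l" "Suc ?t - 2 ^ l" "Suc ?d"] by simp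
  moreover have "?d = 2 * str_code (drop (Suc l) \<sigma>) + (if \<sigma> ! l then 2 else 1)"
    using Cons_nth_drop_Suc[OF assms, symmetric] by simp
  ultimately show ?thesis unfolding code_nth_def by (cases "\<sigma> ! l") simp_all
qed

lemma computable_code_length:
  assumes "computable k f" shows "computable k (\<lambda>xs. code_length (f xs))"
  unfolding code_length_def
proof (rule computable_Least)
  show "\<exists>n. Suc (f xs) < 2 ^ Suc n" for xs
    by (rule exI[of _ "f xs"]) (rule less_exp)
qed (intro computable_intros computable_tl assms, simp)

lemma computable_code_take:
  assumes "computable k l" "computable k f" shows "computable k (\<lambda>xs. code_take (l xs) (f xs))"
  unfolding code_take_def by (intro computable_intros assms)

lemma decidable_code_nth:
  assumes "computable k f" "computable k l" shows "decidable k (\<lambda>xs. code_nth (f xs) (l xs))"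
  unfolding code_nth_def by (intro computable_intros assms)

lemma computable_code_snoc:
  assumes "computable k f" "decidable k b" shows "computable k (\<lambda>xs. code_snoc (f xs) (b xs))"
  unfolding code_snoc_def by (intro computable_intros computable_code_length assms)

lemmas code_intros =
  computable_code_length computable_code_take decidable_code_nth computable_code_snoc

section \<open>Strongly left-c.e. martingales\<close>

text \<open>Every natural is the code of a string, so convergence on codes is convergence
  everywhere, and the prediction becomes a total decidable predicate.\<close>

lemma computable_predictionE:
  assumes "computable_prediction f"
  obtains P where "decidable 1 P" "\<And>\<sigma>. P [str_code \<sigma>] \<longleftrightarrow> f \<sigma>"
proof -
  obtain r where r: "\<And>\<sigma>. eval r [str_code \<sigma>] = Some (of_bool (f \<sigma>))"
    using assms unfolding computable_prediction_def by blast
  have inv: "str_code (inv str_code x) = x" for x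
    using bij_str_code by (simp add: bij_is_surj surj_f_inv_f)
  have "decidable 1 (\<lambda>xs. f (inv str_code (hd xs)))"
    unfolding decidable_def computable_def
    using r[of "inv str_code _"] by (intro exI[of _ r]) (auto simp: inv length_Suc_conv)
  then show ?thesis
    by (rule that) (simp add: bij_is_inj[OF bij_str_code])
qed

lemma decidable_app1:
  assumes "decidable 1 P" "computable k a"
  shows "decidable k (\<lambda>xs. P [a xs])"
  using computable_app1[OF assms(1)[unfolded decidable_def] assms(2)] by (simp add: decidable_def)

lemma tendsto_half_power: "(\<lambda>s. c * (1 / 2) ^ s :: real) \<longlonglongrightarrow> 0"
  using tendsto_mult_left[OF LIMSEQ_realpow_zero[of "1/2"], of c] by simp

text \<open>Between the stages \<open>s\<close> and \<open>s + 1\<close>, a correction term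
  \<open>c * (1 / 2) ^ s\<close> shrinks by \<open>c / 2 * (1 / 2) ^ s\<close>. Subtracting it with
  \<open>c = 2\<close> therefore absorbs a possible decrease by \<open>(1 / 2) ^ s\<close>, and
  \<open>c = 3\<close> makes the approximations of the wagers strictly monotone, with the sign
  chosen by \<open>f\<close>.\<close>

lemma strongly_left_ceI:
  fixes A :: "nat list \<Rightarrow> rat"
  defines "a \<equiv> \<lambda>\<sigma> s. real_of_rat (A [str_code \<sigma>, s])"
  assumes A: "computable_rat 2 A" and lim: "\<And>\<sigma>. a \<sigma> \<longlonglongrightarrow> M \<sigma>"
    and inc: "\<And>\<sigma> s. a \<sigma> s - (1 / 2) ^ s \<le> a \<sigma> (Suc s)"
    and f: "computable_prediction f"
    and up: "\<And>\<sigma> s. f \<sigma> \<Longrightarrow> a (\<sigma> @ [True]) s - a \<sigma> s - (1 / 2) ^ s \<le> a (\<sigma> @ [True]) (Suc s) - a \<sigma> (Suc s)"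
    and down: "\<And>\<sigma> s. \<not> f \<sigma> \<Longrightarrow>
      a (\<sigma> @ [True]) (Suc s) - a \<sigma> (Suc s) \<le> a (\<sigma> @ [True]) s - a \<sigma> s + (1 / 2) ^ s"
  shows "strongly_left_ce M"
  unfolding strongly_left_ce_def
proof
  show "left_ce M"
    unfolding left_ce_def
  proof (intro exI conjI allI)
    show "computable_rat 2 (\<lambda>xs. A [xs ! 0, xs ! 1] - 2 * (1 / 2) ^ (xs ! 1))"
      by (intro computable_rat_intros computable_intros computable_rat_app2 A) simp_all
    fix \<sigma>
    show "incseq (\<lambda>s. A [[str_code \<sigma>, s] ! 0, [str_code \<sigma>, s] ! 1] - 2 * (1 / 2) ^ ([str_code \<sigma>, s] ! 1))"
    proof (rule incseq_SucI)
      fix s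
      have "a \<sigma> s - 2 * (1 / 2) ^ s \<le> a \<sigma> (Suc s) - 2 * (1 / 2) ^ Suc s"
        using inc[of \<sigma> s] by simp
      then have "real_of_rat (A [str_code \<sigma>, s] - 2 * (1 / 2) ^ s) \<le>
          real_of_rat (A [str_code \<sigma>, Suc s] - 2 * (1 / 2) ^ Suc s)"
        unfolding a_def of_rat_diff of_rat_mult of_rat_power of_rat_divide by simp
      then show "A [[str_code \<sigma>, s] ! 0, [str_code \<sigma>, s] ! 1] - 2 * (1 / 2) ^ ([str_code \<sigma>, s] ! 1) \<le>
         A [[str_code \<sigma>, Suc s] ! 0, [str_code \<sigma>, Suc s] ! 1] - 2 * (1 / 2) ^ ([str_code \<sigma>, Suc s] ! 1)"
        unfolding of_rat_less_eq by simp
    qed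
    show "(\<lambda>s. real_of_rat (A [[str_code \<sigma>, s] ! 0, [str_code \<sigma>, s] ! 1] - 2 * (1 / 2) ^ ([str_code \<sigma>, s] ! 1)))
        \<longlonglongrightarrow> M \<sigma>"
      using tendsto_diff[OF lim[of \<sigma>] tendsto_half_power[of 2]]
      by (simp add: a_def of_rat_diff of_rat_mult of_rat_power of_rat_divide)
  qed
  obtain P where P: "decidable 1 P" "\<And>\<sigma>. P [str_code \<sigma>] \<longleftrightarrow> f \<sigma>"
    using computable_predictionE[OF f] by blast
  define w where "w = (\<lambda>xs. A [code_snoc (xs ! 0) True, xs ! 1] - A [xs ! 0, xs ! 1] +
      (if P [xs ! 0] then - 3 else 3) * (1 / 2) ^ (xs ! 1))"
  have w: "real_of_rat (w [str_code \<sigma>, s]) =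
      a (\<sigma> @ [True]) s - a \<sigma> s + (if f \<sigma> then - 3 else 3) * (1 / 2) ^ s" for \<sigma> s
    by (simp add: w_def a_def P(2) of_rat_add of_rat_diff of_rat_mult of_rat_power of_rat_divide of_rat_minus)
  show "\<exists>q. computable_rat 2 q \<and>
        (\<forall>\<sigma>. ((\<forall>s. q [str_code \<sigma>, s] < q [str_code \<sigma>, Suc s]) \<or>
              (\<forall>s. q [str_code \<sigma>, s] > q [str_code \<sigma>, Suc s])) \<and>
             (\<lambda>s. real_of_rat (q [str_code \<sigma>, s])) \<longlonglongrightarrow> wager M \<sigma>)"
  proof (intro exI[of _ w] conjI allI)
    show "computable_rat 2 w"
      unfolding w_def
      by (intro computable_rat_intros computable_intros code_intros decidable_app1 P(1)
          computable_rat_app2 A) simp_all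
    fix \<sigma>
    show "(\<forall>s. w [str_code \<sigma>, s] < w [str_code \<sigma>, Suc s]) \<or>
          (\<forall>s. w [str_code \<sigma>, s] > w [str_code \<sigma>, Suc s])"
    proof (cases "f \<sigma>")
      case True
      have "real_of_rat (w [str_code \<sigma>, s]) < real_of_rat (w [str_code \<sigma>, Suc s])" for s
        using up[OF True, of s] True zero_less_power[of "1 / 2 :: real" s] unfolding w power_Suc
        by (simp only: if_True) linarith
      then show ?thesis unfolding of_rat_less by blast
    next
      case False
      have "real_of_rat (w [str_code \<sigma>, s]) > real_of_rat (w [str_code \<sigma>, Suc s])" for s
        using down[OF False, of s] False zero_less_power[of "1 / 2 :: real" s] unfolding w power_Suc
        by (simp only: if_False) linarith
      then show ?thesis unfolding of_rat_less by blast
    qed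
    have "(\<lambda>s. a (\<sigma> @ [True]) s - a \<sigma> s + (if f \<sigma> then - 3 else 3) * (1 / 2) ^ s)
        \<longlonglongrightarrow> M (\<sigma> @ [True]) - M \<sigma> + 0"
      by (intro tendsto_add tendsto_diff lim tendsto_half_power)
    then show "(\<lambda>s. real_of_rat (w [str_code \<sigma>, s])) \<longlonglongrightarrow> wager M \<sigma>"
      unfolding w wager_def by simp
  qed
qed

section \<open>Martingales and their mixtures\<close>

lemma martingale_nonneg: "martingale M \<Longrightarrow> 0 \<le> M \<sigma>"
  unfolding martingale_def by blast

lemma martingale_snoc: "martingale M \<Longrightarrow> M (\<sigma> @ [False]) + M (\<sigma> @ [True]) = 2 * M \<sigma>"
  unfolding martingale_def by metis

lemma martingale_snoc_le: "martingale M \<Longrightarrow> M (\<sigma> @ [b]) \<le> 2 * M \<sigma>"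
  using martingale_snoc[of M \<sigma>] martingale_nonneg[of M "\<sigma> @ [\<not> b]"] by (cases b) auto

lemma martingale_le_power: "martingale M \<Longrightarrow> M \<sigma> \<le> 2 ^ length \<sigma> * M []"
proof (induction \<sigma> rule: rev_induct)
  case (snoc b \<sigma>)
  then show ?case using martingale_snoc_le[of M \<sigma> b] by simp
qed simp

lemma summable_mixture:
  assumes "\<And>i. martingale (N i)" "summable (\<lambda>i. N i [])"
  shows "summable (\<lambda>i. N i \<sigma>)"
  by (rule summable_comparison_test[OF _ summable_mult[OF assms(2), of "2 ^ length \<sigma>"]])
    (use martingale_le_power[OF assms(1)] martingale_nonneg[OF assms(1)] in auto)

lemma martingale_mixture:
  assumes "\<And>i. martingale (N i)" "mixture N M"
  shows "martingale M"
  unfolding martingale_def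
proof (intro allI conjI)
  fix \<sigma>
  have M: "M \<tau> = (\<Sum>i. N i \<tau>)" "summable (\<lambda>i. N i \<tau>)" for \<tau>
    using assms summable_mixture[of N] unfolding mixture_def by auto
  show "0 \<le> M \<sigma>" unfolding M by (intro suminf_nonneg M(2) martingale_nonneg assms(1))
  show "2 * M \<sigma> = M (\<sigma> @ [False]) + M (\<sigma> @ [True])"
    unfolding M suminf_add[OF M(2) M(2)] suminf_mult[OF M(2), symmetric]
    using martingale_snoc[OF assms(1)] by simp
qed

text \<open>Bounds the total error of \<open>s\<close> summands, each approximated to
  \<open>(1 / 2) ^ (2 * s + 4)\<close>. The factor 1/16 leaves room for the four values compared
  when a wager changes between two stages.\<close>

lemma nat_mult_half_power_le: "real s * (1 / 2) ^ (2 * s + 4) \<le> (1 / 2) ^ s / 16"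
proof -
  have "real s \<le> 2 ^ s" using less_exp[of s] by (metis less_imp_le of_nat_le_iff of_nat_numeral of_nat_power)
  then have "real s * (1 / 2) ^ s \<le> 2 ^ s * (1 / 2) ^ s" by (rule mult_right_mono) simp
  also have "2 ^ s * (1 / 2) ^ s = (1 :: real)" by (simp flip: power_mult_distrib)
  finally have "real s * (1 / 2) ^ s * ((1 / 2) ^ s / 16) \<le> 1 * ((1 / 2) ^ s / 16)"
    by (rule mult_right_mono) simp
  moreover have "(1 / 2) ^ (2 * s + 4) = (1 / 2) ^ s * ((1 / 2) ^ s / (16 :: real))"
  proof -
    have "(1 / 2) ^ 4 = (1 / 16 :: real)" by (simp add: power_divide)
    then show ?thesis unfolding mult_2 power_add by simp
  qed
  ultimately show ?thesis by (simp only: mult.assoc mult_1_left)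
qed

text \<open>From stage \<open>s\<close> to \<open>s + 1\<close> the partial sum gains the martingale
  \<open>N s\<close>, whose wager has the sign dictated by \<open>f\<close>. Every change in the
  other direction is an approximation error and stays below \<open>(1 / 2) ^ s\<close>.\<close>

lemma strongly_left_ce_mixture:
  assumes f: "computable_prediction f" and N: "computable_martingale_family N"
    and sided: "\<And>i. sided f (N i)" and mix: "mixture N M"
  shows "strongly_left_ce M"
proof -
  obtain q where q: "computable_rat 3 q"
    "\<And>i \<sigma> s. \<bar>real_of_rat (q [i, str_code \<sigma>, s]) - N i \<sigma>\<bar> \<le> (1 / 2) ^ s"
    and mart: "\<And>i. martingale (N i)"
    using N unfolding computable_martingale_family_def by blast
  define A where "A = (\<lambda>xs. \<Sum>i<xs ! 1. q [i, xs ! 0, 2 * xs ! 1 + 4])"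
  define S where "S = (\<lambda>\<sigma> s. \<Sum>i<s. N i \<sigma>)"
  have err: "\<bar>real_of_rat (A [str_code \<sigma>, s]) - S \<sigma> s\<bar> \<le> (1 / 2) ^ s / 16" for \<sigma> s
  proof -
    have "\<bar>real_of_rat (A [str_code \<sigma>, s]) - S \<sigma> s\<bar> =
        \<bar>\<Sum>i<s. real_of_rat (q [i, str_code \<sigma>, 2 * s + 4]) - N i \<sigma>\<bar>"
      by (simp add: A_def S_def of_rat_sum sum_subtractf)
    also have "\<dots> \<le> (\<Sum>i<s. (1 / 2) ^ (2 * s + 4))"
      by (rule order_trans[OF sum_abs sum_mono]) (rule q(2))
    also have "\<dots> = real s * (1 / 2) ^ (2 * s + 4)" by simp
    finally show ?thesis using nat_mult_half_power_le[of s] by linarith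
  qed
  have err': "\<bar>real_of_rat (A [str_code \<sigma>, Suc s]) - S \<sigma> s - N s \<sigma>\<bar> \<le> (1 / 2) ^ s / 32" for \<sigma> s
    using err[of \<sigma> "Suc s"] by (simp add: S_def diff_diff_eq)
  have S: "S \<sigma> \<longlonglongrightarrow> M \<sigma>" for \<sigma>
    using summable_LIMSEQ[OF summable_mixture[of N \<sigma>]] mart mix
    unfolding S_def mixture_def by simp
  show ?thesis
  proof (rule strongly_left_ceI[where A = A, OF _ _ _ f])
    show "computable_rat 2 A"
      unfolding A_def
      by (intro computable_rat_intros computable_rat_app3 q(1) computable_intros) simp_all
    show "(\<lambda>s. real_of_rat (A [str_code \<sigma>, s])) \<longlonglongrightarrow> M \<sigma>" for \<sigma>
    proof -
      have "(\<lambda>s. real_of_rat (A [str_code \<sigma>, s]) - S \<sigma> s) \<longlonglongrightarrow> 0"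
        by (rule tendsto_0_le[OF tendsto_half_power[of "1 / 16"], where K = 1]) (use err in simp)
      from tendsto_add[OF this S[of \<sigma>]] show ?thesis by simp
    qed
    fix \<sigma> s
    show "real_of_rat (A [str_code \<sigma>, s]) - (1 / 2) ^ s \<le> real_of_rat (A [str_code \<sigma>, Suc s])"
      using err[of \<sigma> s] err'[of \<sigma> s] martingale_nonneg[OF mart, of s \<sigma>]
        zero_less_power[of "1 / 2 :: real" s] by linarith
    show "real_of_rat (A [str_code (\<sigma> @ [True]), s]) - real_of_rat (A [str_code \<sigma>, s]) - (1 / 2) ^ s
        \<le> real_of_rat (A [str_code (\<sigma> @ [True]), Suc s]) - real_of_rat (A [str_code \<sigma>, Suc s])" if "f \<sigma>"
    proof -
      have "N s (\<sigma> @ [True]) \<ge> N s \<sigma>"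
        using sided[of s] that unfolding sided_def by (metis not_le)
      then show ?thesis
        using err[of \<sigma> s] err'[of \<sigma> s] err[of "\<sigma> @ [True]" s] err'[of "\<sigma> @ [True]" s]
          zero_less_power[of "1 / 2 :: real" s] by linarith
    qed
    show "real_of_rat (A [str_code (\<sigma> @ [True]), Suc s]) - real_of_rat (A [str_code \<sigma>, Suc s])
        \<le> real_of_rat (A [str_code (\<sigma> @ [True]), s]) - real_of_rat (A [str_code \<sigma>, s]) + (1 / 2) ^ s"
      if "\<not> f \<sigma>"
    proof -
      have "N s (\<sigma> @ [True]) \<le> N s \<sigma>"
        using sided[of s] that unfolding sided_def by (metis not_le)
      then show ?thesis
        using err[of \<sigma> s] err'[of \<sigma> s] err[of "\<sigma> @ [True]" s] err'[of "\<sigma> @ [True]" s]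
          zero_less_power[of "1 / 2 :: real" s] by linarith
    qed
  qed
qed

section \<open>Opponents that can be followed from below\<close>

text \<open>\<open>q\<close> approximates \<open>M\<close> from below, and \<open>R\<close> is a
  decidable test that accepts a string at a stage. The last two clauses are its completeness and
  soundness: sufficiently long strings on which the martingale \<open>B\<close> stays within a given
  bound are eventually accepted, and acceptance bounds the remaining growth at every prefix by
  \<open>2 ^ (a * (m + 2))\<close> times the remaining growth at the empty string, up to an error
  scaled by \<open>K\<close>. Sides are not mentioned, since those of different opponents
  differ.\<close>

definition tame :: "nat \<Rightarrow> (str \<Rightarrow> real) \<Rightarrow> bool" where
  "tame m M \<longleftrightarrow> martingale M \<and>
     (\<exists>q R B K. computable_rat 2 q \<and> decidable 2 R \<and> martingale B \<and> 0 \<le> K \<and>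
        (\<forall>\<sigma> s. real_of_rat (q [str_code \<sigma>, s]) \<le> M \<sigma>) \<and>
        (\<forall>\<sigma>. (\<lambda>s. real_of_rat (q [str_code \<sigma>, s])) \<longlonglongrightarrow> M \<sigma>) \<and>
        (\<forall>C. \<exists>a0. \<forall>a\<ge>a0. \<forall>\<tau>. length \<tau> = 2 * m * a \<longrightarrow> B \<tau> \<le> C \<longrightarrow>
           eventually (\<lambda>s. R [str_code \<tau>, s]) sequentially) \<and>
        (\<forall>a \<tau> s l. length \<tau> = 2 * m * a \<longrightarrow> R [str_code \<tau>, s] \<longrightarrow> l \<le> length \<tau> \<longrightarrow>
           M (take l \<tau>) - real_of_rat (q [str_code (take l \<tau>), s]) \<le>
           2 ^ (a * (m + 2)) * (M [] - real_of_rat (q [str_code [], s]) + K * (1 / 2) ^ (a * (m + 3)))))"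

lemma martingale_add: "martingale M \<Longrightarrow> martingale N \<Longrightarrow> martingale (\<lambda>\<sigma>. M \<sigma> + N \<sigma>)"
  unfolding martingale_def by (auto simp: algebra_simps)

lemma martingale_scale: "martingale M \<Longrightarrow> 0 \<le> c \<Longrightarrow> martingale (\<lambda>\<sigma>. c * M \<sigma>)"
  unfolding martingale_def by (auto simp: distrib_left[symmetric])

lemma tame_zero: "tame m (\<lambda>_. 0)"
proof -
  have "martingale (\<lambda>_. 0)" by (simp add: martingale_def)
  then show ?thesis
    unfolding tame_def
    by (intro conjI exI[of _ "\<lambda>_. 0 :: rat"] exI[of _ "\<lambda>_. True"] exI[of _ "\<lambda>_. 0 :: real"]
        exI[of _ "0 :: real"]) (auto intro: computable_rat_const decidable_const)
qed

text \<open>Tests are joined by conjunction and control martingales by addition: a bound on the sum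
  of \<open>B\<close> and \<open>B'\<close> bounds both, as neither is negative. The soundness
  inequalities add up because their factor depends on \<open>a\<close> and \<open>m\<close>
  only.\<close>

lemma tame_add:
  assumes "tame m M" "tame m M'"
  shows "tame m (\<lambda>\<sigma>. M \<sigma> + M' \<sigma>)"
proof -
  obtain q R B K where M: "martingale M" "computable_rat 2 q" "decidable 2 R" "martingale B" "0 \<le> K"
      "\<And>\<sigma> s. real_of_rat (q [str_code \<sigma>, s]) \<le> M \<sigma>"
      "\<And>\<sigma>. (\<lambda>s. real_of_rat (q [str_code \<sigma>, s])) \<longlonglongrightarrow> M \<sigma>"
      "\<And>C. \<exists>a0. \<forall>a\<ge>a0. \<forall>\<tau>. length \<tau> = 2 * m * a \<longrightarrow> B \<tau> \<le> C \<longrightarrow>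
           eventually (\<lambda>s. R [str_code \<tau>, s]) sequentially"
      "\<And>a \<tau> s l. length \<tau> = 2 * m * a \<Longrightarrow> R [str_code \<tau>, s] \<Longrightarrow> l \<le> length \<tau> \<Longrightarrow>
           M (take l \<tau>) - real_of_rat (q [str_code (take l \<tau>), s]) \<le>
           2 ^ (a * (m + 2)) * (M [] - real_of_rat (q [str_code [], s]) + K * (1 / 2) ^ (a * (m + 3)))"
    using assms(1) unfolding tame_def by blast
  obtain q' R' B' K' where M': "martingale M'" "computable_rat 2 q'" "decidable 2 R'" "martingale B'" "0 \<le> K'"
      "\<And>\<sigma> s. real_of_rat (q' [str_code \<sigma>, s]) \<le> M' \<sigma>"
      "\<And>\<sigma>. (\<lambda>s. real_of_rat (q' [str_code \<sigma>, s])) \<longlonglongrightarrow> M' \<sigma>"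
      "\<And>C. \<exists>a0. \<forall>a\<ge>a0. \<forall>\<tau>. length \<tau> = 2 * m * a \<longrightarrow> B' \<tau> \<le> C \<longrightarrow>
           eventually (\<lambda>s. R' [str_code \<tau>, s]) sequentially"
      "\<And>a \<tau> s l. length \<tau> = 2 * m * a \<Longrightarrow> R' [str_code \<tau>, s] \<Longrightarrow> l \<le> length \<tau> \<Longrightarrow>
           M' (take l \<tau>) - real_of_rat (q' [str_code (take l \<tau>), s]) \<le>
           2 ^ (a * (m + 2)) * (M' [] - real_of_rat (q' [str_code [], s]) + K' * (1 / 2) ^ (a * (m + 3)))"
    using assms(2) unfolding tame_def by blast
  show ?thesis
    unfolding tame_def
  proof (intro conjI exI[of _ "\<lambda>xs. q xs + q' xs"] exI[of _ "\<lambda>xs. R xs \<and> R' xs"]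
      exI[of _ "\<lambda>\<sigma>. B \<sigma> + B' \<sigma>"] exI[of _ "K + K'"] allI impI)
    show "martingale (\<lambda>\<sigma>. M \<sigma> + M' \<sigma>)" "martingale (\<lambda>\<sigma>. B \<sigma> + B' \<sigma>)"
      by (intro martingale_add M M')+
    show "computable_rat 2 (\<lambda>xs. q xs + q' xs)" "decidable 2 (\<lambda>xs. R xs \<and> R' xs)"
      by (intro computable_rat_add decidable_conj M M')+
    show "0 \<le> K + K'" using M(5) M'(5) by simp
    show "real_of_rat (q [str_code \<sigma>, s] + q' [str_code \<sigma>, s]) \<le> M \<sigma> + M' \<sigma>" for \<sigma> s
      unfolding of_rat_add by (intro add_mono M(6) M'(6))
    show "(\<lambda>s. real_of_rat (q [str_code \<sigma>, s] + q' [str_code \<sigma>, s])) \<longlonglongrightarrow> M \<sigma> + M' \<sigma>" for \<sigma>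
      unfolding of_rat_add by (intro tendsto_add M(7) M'(7))
    show "\<exists>a0. \<forall>a\<ge>a0. \<forall>\<tau>. length \<tau> = 2 * m * a \<longrightarrow> B \<tau> + B' \<tau> \<le> C \<longrightarrow>
        eventually (\<lambda>s. R [str_code \<tau>, s] \<and> R' [str_code \<tau>, s]) sequentially" for C
    proof -
      obtain a0 where a0: "\<forall>a\<ge>a0. \<forall>\<tau>. length \<tau> = 2 * m * a \<longrightarrow> B \<tau> \<le> C \<longrightarrow>
           eventually (\<lambda>s. R [str_code \<tau>, s]) sequentially" using M(8) by blast
      obtain a1 where a1: "\<forall>a\<ge>a1. \<forall>\<tau>. length \<tau> = 2 * m * a \<longrightarrow> B' \<tau> \<le> C \<longrightarrow>
           eventually (\<lambda>s. R' [str_code \<tau>, s]) sequentially" using M'(8) by blast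
      have "B \<tau> \<le> C" "B' \<tau> \<le> C" if "B \<tau> + B' \<tau> \<le> C" for \<tau>
        using that martingale_nonneg[OF M(4), of \<tau>] martingale_nonneg[OF M'(4), of \<tau>] by linarith+
      then show ?thesis
        using a0 a1 by (intro exI[of _ "max a0 a1"]) (auto intro: eventually_conj)
    qed
    fix a \<tau> s l assume *: "length \<tau> = 2 * m * a" "R [str_code \<tau>, s] \<and> R' [str_code \<tau>, s]" "l \<le> length \<tau>"
    show "M (take l \<tau>) + M' (take l \<tau>) - real_of_rat (q [str_code (take l \<tau>), s] + q' [str_code (take l \<tau>), s]) \<le>
        2 ^ (a * (m + 2)) * (M [] + M' [] - real_of_rat (q [str_code [], s] + q' [str_code [], s]) +
          (K + K') * (1 / 2) ^ (a * (m + 3)))"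
      using add_mono[OF M(9)[OF *(1) conjunct1[OF *(2)] *(3)] M'(9)[OF *(1) conjunct2[OF *(2)] *(3)]]
      unfolding of_rat_add by (simp add: algebra_simps)
  qed
qed

text \<open>A rational factor keeps the approximation computable; the test and the control
  martingale stay the same.\<close>

lemma tame_scale:
  assumes "tame m M" "0 \<le> c"
  shows "tame m (\<lambda>\<sigma>. real_of_rat c * M \<sigma>)"
proof -
  obtain q R B K where M: "martingale M" "computable_rat 2 q" "decidable 2 R" "martingale B" "0 \<le> K"
      "\<And>\<sigma> s. real_of_rat (q [str_code \<sigma>, s]) \<le> M \<sigma>"
      "\<And>\<sigma>. (\<lambda>s. real_of_rat (q [str_code \<sigma>, s])) \<longlonglongrightarrow> M \<sigma>"
      "\<And>C. \<exists>a0. \<forall>a\<ge>a0. \<forall>\<tau>. length \<tau> = 2 * m * a \<longrightarrow> B \<tau> \<le> C \<longrightarrow>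
           eventually (\<lambda>s. R [str_code \<tau>, s]) sequentially"
      "\<And>a \<tau> s l. length \<tau> = 2 * m * a \<Longrightarrow> R [str_code \<tau>, s] \<Longrightarrow> l \<le> length \<tau> \<Longrightarrow>
           M (take l \<tau>) - real_of_rat (q [str_code (take l \<tau>), s]) \<le>
           2 ^ (a * (m + 2)) * (M [] - real_of_rat (q [str_code [], s]) + K * (1 / 2) ^ (a * (m + 3)))"
    using assms(1) unfolding tame_def by blast
  have c: "0 \<le> real_of_rat c" using assms(2) by simp
  show ?thesis
    unfolding tame_def
  proof (intro conjI exI[of _ "\<lambda>xs. c * q xs"] exI[of _ R] exI[of _ B]
      exI[of _ "real_of_rat c * K"] allI impI)
    show "martingale (\<lambda>\<sigma>. real_of_rat c * M \<sigma>)" by (rule martingale_scale[OF M(1) c])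
    show "computable_rat 2 (\<lambda>xs. c * q xs)"
      by (intro computable_rat_mult computable_rat_const M)
    show "real_of_rat (c * q [str_code \<sigma>, s]) \<le> real_of_rat c * M \<sigma>" for \<sigma> s
      unfolding of_rat_mult by (intro mult_left_mono M(6) c)
    show "(\<lambda>s. real_of_rat (c * q [str_code \<sigma>, s])) \<longlonglongrightarrow> real_of_rat c * M \<sigma>" for \<sigma>
      unfolding of_rat_mult by (intro tendsto_mult_left M(7))
    fix a \<tau> s l assume *: "length \<tau> = 2 * m * a" "R [str_code \<tau>, s]" "l \<le> length \<tau>"
    show "real_of_rat c * M (take l \<tau>) - real_of_rat (c * q [str_code (take l \<tau>), s]) \<le>
        2 ^ (a * (m + 2)) * (real_of_rat c * M [] - real_of_rat (c * q [str_code [], s]) +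
          real_of_rat c * K * (1 / 2) ^ (a * (m + 3)))"
      using mult_left_mono[OF M(9)[OF *] c] unfolding of_rat_mult by (simp add: algebra_simps)
  qed (use M c in auto)
qed

section \<open>Strings that rarely follow a decidable side\<close>

definition hits :: "(str \<Rightarrow> bool) \<Rightarrow> str \<Rightarrow> nat \<Rightarrow> nat" where
  "hits u \<tau> l = (\<Sum>j<l. of_bool (\<tau> ! j = u (take j \<tau>)))"

definition biased :: "real \<Rightarrow> (str \<Rightarrow> bool) \<Rightarrow> str \<Rightarrow> real" where
  "biased e u \<tau> = (\<Prod>j<length \<tau>. if \<tau> ! j = u (take j \<tau>) then 1 + e else 1 - e)"

lemma martingale_biased:
  assumes "0 \<le> e" "e \<le> 1" shows "martingale (biased e u)"
proof -
  have "biased e u (\<sigma> @ [b]) = biased e u \<sigma> * (if b = u \<sigma> then 1 + e else 1 - e)" for \<sigma> b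
  proof -
    have "(\<Prod>j<length \<sigma>. if (\<sigma> @ [b]) ! j = u (take j (\<sigma> @ [b])) then 1 + e else 1 - e) = biased e u \<sigma>"
      unfolding biased_def by (rule prod.cong) (auto simp: nth_append)
    then show ?thesis unfolding biased_def by simp
  qed
  moreover have "0 \<le> biased e u \<sigma>" for \<sigma>
    unfolding biased_def using assms by (intro prod_nonneg) auto
  ultimately show ?thesis
    unfolding martingale_def by (auto simp: algebra_simps)
qed

lemma hits_le: "hits u \<tau> l \<le> l"
  unfolding hits_def using sum_bounded_above[of "{..<l}" "\<lambda>j. of_bool (\<tau> ! j = u (take j \<tau>))" "1::nat"] by simp

lemma biased_eq: "biased e u \<tau> = (1 + e) ^ hits u \<tau> (length \<tau>) * (1 - e) ^ (length \<tau> - hits u \<tau> (length \<tau>))"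
proof -
  have "(\<Prod>j<l. if \<tau> ! j = u (take j \<tau>) then 1 + e else 1 - e) =
      (1 + e) ^ hits u \<tau> l * (1 - e) ^ (l - hits u \<tau> l)" for l
  proof (induction l)
    case (Suc l)
    have "hits u \<tau> (Suc l) = hits u \<tau> l + of_bool (\<tau> ! l = u (take l \<tau>))" by (simp add: hits_def)
    then show ?case using Suc hits_le[of u \<tau> l] by (auto simp: Suc_diff_le)
  qed (simp add: hits_def)
  then show ?thesis unfolding biased_def .
qed

text \<open>With \<open>x = 1 / m\<close> this is
  \<open>(1 + x) ^ (m + 2) * (1 - x) ^ (m - 2)\<close>, the growth of the biased martingale over
  \<open>2 * m\<close> steps of which \<open>m + 2\<close> are hits. In the grouping used here,
  Bernoulli's inequality bounds the two factors below by \<open>1 + 4 * x\<close> and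
  \<open>1 - x\<close>, whose product exceeds 1 for \<open>x \<le> 1 / 2\<close>.\<close>

lemma growth_factor_gt_1:
  assumes "2 \<le> m"
  shows "1 < (1 + 1 / real m) ^ 4 * ((1 + 1 / real m) * (1 - 1 / real m)) ^ (m - 2)"
proof -
  define x where "x = 1 / real m"
  have x: "0 < x" "x \<le> 1 / 2" "real m * x = 1" using assms by (auto simp: x_def)
  have "1 + real (m - 2) * (- x\<^sup>2) \<le> (1 + (- x\<^sup>2)) ^ (m - 2)"
    by (rule Bernoulli_inequality) (use x in \<open>simp add: abs_square_le_1 power_le_one\<close>)
  moreover have "real (m - 2) * x\<^sup>2 \<le> x"
  proof -
    have "real (m - 2) * x * x \<le> real m * x * x" using x by (intro mult_right_mono) auto
    then show ?thesis using x by (simp add: power2_eq_square mult.assoc)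
  qed
  ultimately have 1: "1 - x \<le> ((1 + x) * (1 - x)) ^ (m - 2)"
    by (simp add: algebra_simps power2_eq_square)
  have 2: "1 + 4 * x \<le> (1 + x) ^ 4" using Bernoulli_inequality[of x 4] x by simp
  have "1 < (1 + 4 * x) * (1 - x)"
  proof -
    have "x * x \<le> 1 / 2 * x" using x by (intro mult_right_mono) auto
    then show ?thesis using x by (simp add: algebra_simps)
  qed
  also have "\<dots> \<le> (1 + x) ^ 4 * ((1 + x) * (1 - x)) ^ (m - 2)"
    by (intro mult_mono 1 2) (use x in auto)
  finally show ?thesis unfolding x_def .
qed

text \<open>More than \<open>a * (m + 2)\<close> hits would give the biased martingale a value of at
  least \<open>g ^ a\<close> for a constant \<open>g > 1\<close>, which exceeds \<open>C\<close>
  once \<open>a\<close> is large.\<close>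

lemma few_hits:
  assumes "2 \<le> m"
  shows "\<exists>a0. \<forall>a\<ge>a0. \<forall>\<tau>. length \<tau> = 2 * m * a \<longrightarrow> biased (1 / real m) u \<tau> \<le> C \<longrightarrow>
    hits u \<tau> (length \<tau>) \<le> a * (m + 2)"
proof -
  define x where "x = 1 / real m"
  define g where "g = (1 + x) ^ 4 * ((1 + x) * (1 - x)) ^ (m - 2)"
  have x: "0 < x" "x < 1" using assms by (auto simp: x_def)
  have "1 < g" unfolding g_def x_def by (rule growth_factor_gt_1[OF assms])
  then obtain a0 where a0: "C < g ^ a0" using real_arch_pow by blast
  show ?thesis
  proof (intro exI[of _ a0] allI impI)
    fix a \<tau> assume a: "a \<ge> a0" and len: "length \<tau> = 2 * m * a" and C: "biased (1 / real m) u \<tau> \<le> C"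
    define A where "A = hits u \<tau> (length \<tau>)"
    show "hits u \<tau> (length \<tau>) \<le> a * (m + 2)"
    proof (rule ccontr)
      assume "\<not> ?thesis"
      then have A: "a * (m + 2) \<le> A" unfolding A_def by simp
      obtain k where "m = k + 2" using assms by (metis le_Suc_ex add.commute)
      then have m: "2 * m * a = a * (m + 2) + a * (m - 2)" by (simp add: algebra_simps)
      have "g ^ a = (1 + x) ^ (a * (m + 2)) * (1 - x) ^ (a * (m - 2))"
      proof -
        have "g = (1 + x) ^ (m + 2) * (1 - x) ^ (m - 2)"
          unfolding g_def power_mult_distrib mult.assoc[symmetric] power_add[symmetric]
          using assms by simp
        then show ?thesis by (simp only: power_mult_distrib power_mult[symmetric] mult.commute[of a])
      qed
      also have "\<dots> \<le> (1 + x) ^ A * (1 - x) ^ (length \<tau> - A)"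
        using x A len m by (intro mult_mono power_increasing power_decreasing) auto
      also have "\<dots> = biased x u \<tau>" unfolding biased_eq A_def ..
      also have "\<dots> \<le> C" using C unfolding x_def .
      also have "\<dots> < g ^ a0" by (rule a0)
      also have "\<dots> \<le> g ^ a" using a \<open>1 < g\<close> by (intro power_increasing) auto
      finally show False by simp
    qed
  qed
qed

lemma computable_of_bool: "decidable k P \<Longrightarrow> computable k (\<lambda>xs. of_bool (P xs))"
  unfolding decidable_def .

text \<open>A tolerance of \<open>(1 / 2) ^ (2 * n)\<close> per step, summed over
  \<open>n = 2 * m * a\<close> steps, stays within the precision given at the root, since
  \<open>a * (m + 3) \<le> n\<close> for \<open>m \<ge> 3\<close>.\<close>

lemma half_power_error:
  assumes "3 \<le> m"
  shows "real (2 * m * a) * (1 / 2) ^ (2 * (2 * m * a)) \<le> (1 / 2) ^ (a * (m + 3))"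
proof -
  define n where "n = 2 * m * a"
  have "real n \<le> 2 ^ n" using less_exp[of n] by (metis less_imp_le of_nat_le_iff of_nat_numeral of_nat_power)
  then have "real n * (1 / 2) ^ n \<le> 2 ^ n * (1 / 2) ^ n" by (rule mult_right_mono) simp
  also have "2 ^ n * (1 / 2) ^ n = (1 :: real)" by (simp flip: power_mult_distrib)
  finally have "real n * (1 / 2) ^ n * (1 / 2) ^ n \<le> 1 * (1 / 2) ^ n" by (rule mult_right_mono) simp
  then have "real n * (1 / 2) ^ (2 * n) \<le> (1 / 2) ^ n" by (simp only: mult_2 power_add mult.assoc mult_1_left)
  also have "\<dots> \<le> (1 / 2) ^ (a * (m + 3))"
  proof (rule power_decreasing)
    have "a * (m + 3) \<le> a * (2 * m)" using assms by (intro mult_left_mono) auto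
    then show "a * (m + 3) \<le> n" unfolding n_def by (simp add: algebra_simps)
  qed auto
  finally show ?thesis unfolding n_def .
qed

text \<open>Since monotonicity is strict, comparing the first two terms decides the direction of the
  wager approximation, uniformly in the string. This comparison is the decidable side of the
  opponent.\<close>

lemma strongly_left_ceE:
  assumes "strongly_left_ce M"
  obtains q w where "computable_rat 2 q" "computable_rat 2 w"
    "\<And>\<sigma>. (\<lambda>s. real_of_rat (q [str_code \<sigma>, s])) \<longlonglongrightarrow> M \<sigma>"
    "\<And>\<sigma> s. real_of_rat (q [str_code \<sigma>, s]) \<le> M \<sigma>"
    "\<And>\<sigma>. (\<lambda>s. real_of_rat (w [str_code \<sigma>, s])) \<longlonglongrightarrow> wager M \<sigma>"
    "\<And>\<sigma> s. w [str_code \<sigma>, 0] < w [str_code \<sigma>, 1] \<Longrightarrow> real_of_rat (w [str_code \<sigma>, s]) \<le> wager M \<sigma>"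
    "\<And>\<sigma> s. \<not> w [str_code \<sigma>, 0] < w [str_code \<sigma>, 1] \<Longrightarrow> wager M \<sigma> \<le> real_of_rat (w [str_code \<sigma>, s])"
proof -
  obtain q where q: "computable_rat 2 q" "\<And>\<sigma>. incseq (\<lambda>s. q [str_code \<sigma>, s])"
      "\<And>\<sigma>. (\<lambda>s. real_of_rat (q [str_code \<sigma>, s])) \<longlonglongrightarrow> M \<sigma>"
    using assms unfolding strongly_left_ce_def left_ce_def by blast
  obtain w where w: "computable_rat 2 w"
      "\<And>\<sigma>. (\<forall>s. w [str_code \<sigma>, s] < w [str_code \<sigma>, Suc s]) \<or> (\<forall>s. w [str_code \<sigma>, s] > w [str_code \<sigma>, Suc s])"
      "\<And>\<sigma>. (\<lambda>s. real_of_rat (w [str_code \<sigma>, s])) \<longlonglongrightarrow> wager M \<sigma>"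
    using assms unfolding strongly_left_ce_def by blast
  show ?thesis
  proof (rule that[of q w])
    fix \<sigma> s
    have "incseq (\<lambda>s. real_of_rat (q [str_code \<sigma>, s]))"
      using q(2)[of \<sigma>] unfolding incseq_def of_rat_less_eq by blast
    then show "real_of_rat (q [str_code \<sigma>, s]) \<le> M \<sigma>"
      using q(3)[of \<sigma>] by (rule incseq_le)
    show "real_of_rat (w [str_code \<sigma>, s]) \<le> wager M \<sigma>" if "w [str_code \<sigma>, 0] < w [str_code \<sigma>, 1]"
    proof -
      have "\<forall>s. w [str_code \<sigma>, s] < w [str_code \<sigma>, Suc s]"
        using w(2)[of \<sigma>] that by (metis One_nat_def less_asym)
      then have "incseq (\<lambda>s. real_of_rat (w [str_code \<sigma>, s]))"
        by (intro incseq_SucI) (simp add: of_rat_less_eq less_imp_le)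
      then show ?thesis using w(3)[of \<sigma>] by (rule incseq_le)
    qed
    show "wager M \<sigma> \<le> real_of_rat (w [str_code \<sigma>, s])" if "\<not> w [str_code \<sigma>, 0] < w [str_code \<sigma>, 1]"
    proof -
      have "\<forall>s. w [str_code \<sigma>, s] > w [str_code \<sigma>, Suc s]"
        using w(2)[of \<sigma>] that by (metis One_nat_def)
      then have "decseq (\<lambda>s. real_of_rat (w [str_code \<sigma>, s]))"
        by (intro decseq_SucI) (simp add: of_rat_less_eq less_imp_le)
      then show ?thesis using w(3)[of \<sigma>] by (rule decseq_ge)
    qed
  qed (use q w in blast)+
qed

text \<open>Along a string that follows the direction of the wager approximations at most \<open>k\<close> times,
  the gap between the martingale and its approximation at most doubles \<open>k\<close> times. On the other
  steps the approximated wager already exceeds the true one.\<close>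

lemma gap_bound:
  fixes D :: "nat \<Rightarrow> real"
  assumes "\<And>j. j < n \<Longrightarrow> \<tau> ! j = u (take j \<tau>) \<Longrightarrow> D (Suc j) \<le> 2 * D j + e"
    and "\<And>j. j < n \<Longrightarrow> \<tau> ! j \<noteq> u (take j \<tau>) \<Longrightarrow> D (Suc j) \<le> D j + e"
    and "0 \<le> D 0" "0 \<le> e" "l \<le> n"
  shows "D l \<le> 2 ^ hits u \<tau> l * (D 0 + real l * e)"
  using \<open>l \<le> n\<close>
proof (induction l)
  case (Suc l)
  define H where "H = (2::real) ^ hits u \<tau> l"
  define Y where "Y = D 0 + real l * e"
  have H: "1 \<le> H" unfolding H_def by simp
  have IH: "D l \<le> H * Y" using Suc unfolding H_def Y_def by simp
  have e: "e \<le> H * e" using mult_right_mono[OF H \<open>0 \<le> e\<close>] by simp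
  have Y: "D 0 + real (Suc l) * e = Y + e" unfolding Y_def by (simp add: algebra_simps)
  show ?case
  proof (cases "\<tau> ! l = u (take l \<tau>)")
    case True
    then have "(2::real) ^ hits u \<tau> (Suc l) = 2 * H" unfolding H_def hits_def by simp
    moreover have "D (Suc l) \<le> 2 * D l + e" using assms(1) Suc.prems True by simp
    ultimately show ?thesis unfolding Y using IH e \<open>0 \<le> e\<close> by (simp add: algebra_simps)
  next
    case False
    then have "(2::real) ^ hits u \<tau> (Suc l) = H" unfolding H_def hits_def by simp
    moreover have "D (Suc l) \<le> D l + e" using assms(2) Suc.prems False by simp
    ultimately show ?thesis unfolding Y using IH e by (simp add: algebra_simps)
  qed
qed (use assms in \<open>simp add: hits_def\<close>)

lemma hits_mono: "l \<le> l' \<Longrightarrow> hits u \<tau> l \<le> hits u \<tau> l'"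
  unfolding hits_def by (rule sum_mono2) auto

text \<open>The test \<open>R\<close> counts hits and checks, at each step of the string, one-sided
  approximate forms of the martingale equation and of the identity that defines the wager. In the
  limit both hold exactly, so the positive tolerance makes the checks pass eventually; together they
  supply the step bounds of \<open>gap_bound\<close>.\<close>

lemma tame_strongly_left_ce:
  assumes mart: "martingale M" and sce: "strongly_left_ce M" and m: "3 \<le> m"
  shows "tame m M"
proof -
  from strongly_left_ceE[OF sce] obtain q w where q: "computable_rat 2 q"
    "\<And>\<sigma>. (\<lambda>s. real_of_rat (q [str_code \<sigma>, s])) \<longlonglongrightarrow> M \<sigma>"
    "\<And>\<sigma> s. real_of_rat (q [str_code \<sigma>, s]) \<le> M \<sigma>"
    and w: "computable_rat 2 w"
    "\<And>\<sigma>. (\<lambda>s. real_of_rat (w [str_code \<sigma>, s])) \<longlonglongrightarrow> wager M \<sigma>"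
    "\<And>\<sigma> s. w [str_code \<sigma>, 0] < w [str_code \<sigma>, 1] \<Longrightarrow> real_of_rat (w [str_code \<sigma>, s]) \<le> wager M \<sigma>"
    "\<And>\<sigma> s. \<not> w [str_code \<sigma>, 0] < w [str_code \<sigma>, 1] \<Longrightarrow> wager M \<sigma> \<le> real_of_rat (w [str_code \<sigma>, s])"
    by metis
  define u where "u = (\<lambda>\<sigma>. w [str_code \<sigma>, 0] < w [str_code \<sigma>, 1])"
  define Q where "Q = (\<lambda>\<sigma> s. real_of_rat (q [str_code \<sigma>, s]))"
  define W where "W = (\<lambda>\<sigma> s. real_of_rat (w [str_code \<sigma>, s]))"
  define e where "e = (\<lambda>\<tau> :: str. (1 / 2 :: real) ^ (2 * length \<tau>))"
  \<comment> \<open>The first conjunct is the bound \<open>a * (m + 2)\<close> on the hits,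
    multiplied by \<open>2 * m\<close>; in this form it refers to the length instead of
    \<open>a\<close>.\<close>
  define R where "R = (\<lambda>xs.
    (\<Sum>j<code_length (xs ! 0). of_bool (code_nth (xs ! 0) j =
        (w [code_take j (xs ! 0), 0] < w [code_take j (xs ! 0), 1]))) * (2 * m)
      \<le> (m + 2) * code_length (xs ! 0) \<and>
    (\<forall>j<code_length (xs ! 0).
      2 * q [code_take j (xs ! 0), xs ! 1] \<le> q [code_snoc (code_take j (xs ! 0)) False, xs ! 1] +
        q [code_snoc (code_take j (xs ! 0)) True, xs ! 1] + (1 / 2) ^ (2 * code_length (xs ! 0)) \<and>
      q [code_take j (xs ! 0), xs ! 1] +
        (if code_nth (xs ! 0) j then 1 else - 1) * w [code_take j (xs ! 0), xs ! 1]
        \<le> q [code_take (Suc j) (xs ! 0), xs ! 1] + (1 / 2) ^ (2 * code_length (xs ! 0))))"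
  have R: "R [str_code \<tau>, s] \<longleftrightarrow> hits u \<tau> (length \<tau>) * (2 * m) \<le> (m + 2) * length \<tau> \<and>
      (\<forall>j<length \<tau>. 2 * Q (take j \<tau>) s \<le> Q (take j \<tau> @ [False]) s + Q (take j \<tau> @ [True]) s + e \<tau> \<and>
        Q (take j \<tau>) s + (if \<tau> ! j then 1 else - 1) * W (take j \<tau>) s \<le> Q (take (Suc j) \<tau>) s + e \<tau>)" for \<tau> s
  proof -
    have "(\<Sum>j<length \<tau>. of_bool (code_nth (str_code \<tau>) j =
        (w [code_take j (str_code \<tau>), 0] < w [code_take j (str_code \<tau>), 1]))) = hits u \<tau> (length \<tau>)"
      unfolding hits_def u_def by (rule sum.cong) auto
    moreover have "2 * q [code_take j (str_code \<tau>), s] \<le> q [code_snoc (code_take j (str_code \<tau>)) False, s] +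
        q [code_snoc (code_take j (str_code \<tau>)) True, s] + (1 / 2) ^ (2 * length \<tau>) \<longleftrightarrow>
        2 * Q (take j \<tau>) s \<le> Q (take j \<tau> @ [False]) s + Q (take j \<tau> @ [True]) s + e \<tau>" if "j < length \<tau>" for j
    proof -
      have "real_of_rat (2 * q [str_code (take j \<tau>), s]) \<le> real_of_rat (q [str_code (take j \<tau> @ [False]), s] +
        q [str_code (take j \<tau> @ [True]), s] + (1 / 2) ^ (2 * length \<tau>)) \<longleftrightarrow>
        2 * Q (take j \<tau>) s \<le> Q (take j \<tau> @ [False]) s + Q (take j \<tau> @ [True]) s + e \<tau>"
        unfolding Q_def e_def of_rat_add of_rat_mult of_rat_power of_rat_divide by simp
      then show ?thesis unfolding of_rat_less_eq using that by simp
    qed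
    moreover have "q [code_take j (str_code \<tau>), s] +
        (if code_nth (str_code \<tau>) j then 1 else - 1) * w [code_take j (str_code \<tau>), s]
        \<le> q [code_take (Suc j) (str_code \<tau>), s] + (1 / 2) ^ (2 * length \<tau>) \<longleftrightarrow>
        Q (take j \<tau>) s + (if \<tau> ! j then 1 else - 1) * W (take j \<tau>) s \<le> Q (take (Suc j) \<tau>) s + e \<tau>"
      if "j < length \<tau>" for j
    proof -
      have "real_of_rat (q [str_code (take j \<tau>), s] +
          (if \<tau> ! j then 1 else - 1) * w [str_code (take j \<tau>), s])
          \<le> real_of_rat (q [str_code (take (Suc j) \<tau>), s] + (1 / 2) ^ (2 * length \<tau>)) \<longleftrightarrow>
        Q (take j \<tau>) s + (if \<tau> ! j then 1 else - 1) * W (take j \<tau>) s \<le> Q (take (Suc j) \<tau>) s + e \<tau>"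
        unfolding Q_def W_def e_def of_rat_add of_rat_mult of_rat_power of_rat_divide
        by (simp add: of_rat_minus)
      then show ?thesis unfolding of_rat_less_eq using that by simp
    qed
    ultimately show ?thesis unfolding R_def by simp
  qed
  show ?thesis
    unfolding tame_def
  proof (intro conjI exI[of _ q] exI[of _ R] exI[of _ "biased (1 / real m) u"] exI[of _ "1 :: real"] allI impI)
    show "decidable 2 R"
      unfolding R_def
      by (intro computable_rat_intros computable_intros code_intros computable_of_bool
          computable_rat_app2 q(1) w(1)) simp_all
    show "martingale (biased (1 / real m) u)" using m by (intro martingale_biased) auto
    show "\<exists>a0. \<forall>a\<ge>a0. \<forall>\<tau>. length \<tau> = 2 * m * a \<longrightarrow> biased (1 / real m) u \<tau> \<le> C \<longrightarrow>
        (\<forall>\<^sub>F s in sequentially. R [str_code \<tau>, s])" for C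
    proof -
      obtain a0 where a0: "\<forall>a\<ge>a0. \<forall>\<tau>. length \<tau> = 2 * m * a \<longrightarrow> biased (1 / real m) u \<tau> \<le> C \<longrightarrow>
          hits u \<tau> (length \<tau>) \<le> a * (m + 2)"
        using few_hits[of m u C] m by auto
      have Qlim: "(\<lambda>s. Q \<sigma> s) \<longlonglongrightarrow> M \<sigma>" and Wlim: "(\<lambda>s. W \<sigma> s) \<longlonglongrightarrow> wager M \<sigma>" for \<sigma>
        unfolding Q_def W_def by (rule q w)+
      have "\<forall>\<^sub>F s in sequentially. R [str_code \<tau>, s]"
        if \<tau>: "length \<tau> = 2 * m * a" "hits u \<tau> (length \<tau>) \<le> a * (m + 2)" for a \<tau>
      proof -
        have e: "e \<tau> > 0" unfolding e_def by simp
        have hit: "hits u \<tau> (length \<tau>) * (2 * m) \<le> (m + 2) * length \<tau>"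
          using mult_right_mono[OF \<tau>(2), of "2 * m"] by (simp add: \<tau>(1) algebra_simps)
        have 1: "\<forall>\<^sub>F s in sequentially. 2 * Q \<sigma> s \<le> Q (\<sigma> @ [False]) s + Q (\<sigma> @ [True]) s + e \<tau>" for \<sigma>
        proof -
          have "(\<lambda>s. Q (\<sigma> @ [False]) s + Q (\<sigma> @ [True]) s + e \<tau> - 2 * Q \<sigma> s) \<longlonglongrightarrow>
              M (\<sigma> @ [False]) + M (\<sigma> @ [True]) + e \<tau> - 2 * M \<sigma>"
            by (intro tendsto_intros Qlim)
          from order_tendstoD(1)[OF this, of 0] show ?thesis
            using e martingale_snoc[OF mart, of \<sigma>] by (auto elim: eventually_mono)
        qed
        have 2: "\<forall>\<^sub>F s in sequentially.
            Q (take j \<tau>) s + (if \<tau> ! j then 1 else - 1) * W (take j \<tau>) s \<le> Q (take (Suc j) \<tau>) s + e \<tau>"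
          if j: "j < length \<tau>" for j
        proof -
          let ?c = "if \<tau> ! j then 1 else - 1 :: real"
          have "(\<lambda>s. Q (take (Suc j) \<tau>) s + e \<tau> - (Q (take j \<tau>) s + ?c * W (take j \<tau>) s)) \<longlonglongrightarrow>
              M (take (Suc j) \<tau>) + e \<tau> - (M (take j \<tau>) + ?c * wager M (take j \<tau>))"
            by (intro tendsto_intros Qlim Wlim)
          moreover have "M (take (Suc j) \<tau>) = M (take j \<tau>) + ?c * wager M (take j \<tau>)"
            using martingale_snoc[OF mart, of "take j \<tau>"]
            unfolding take_Suc_conv_app_nth[OF j] wager_def by (cases "\<tau> ! j") auto
          ultimately have "(\<lambda>s. Q (take (Suc j) \<tau>) s + e \<tau> - (Q (take j \<tau>) s + ?c * W (take j \<tau>) s))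
              \<longlonglongrightarrow> e \<tau>" by simp
          from order_tendstoD(1)[OF this e] show ?thesis by (rule eventually_mono) simp
        qed
        have "\<forall>\<^sub>F s in sequentially. \<forall>j\<in>{..<length \<tau>}.
            2 * Q (take j \<tau>) s \<le> Q (take j \<tau> @ [False]) s + Q (take j \<tau> @ [True]) s + e \<tau> \<and>
            Q (take j \<tau>) s + (if \<tau> ! j then 1 else - 1) * W (take j \<tau>) s \<le> Q (take (Suc j) \<tau>) s + e \<tau>"
          by (intro eventually_ball_finite ballI eventually_conj 1 2) simp_all
        then show ?thesis unfolding R by (rule eventually_mono) (use hit in blast)
      qed
      then show ?thesis using a0 by blast
    qed
    fix a \<tau> s l assume \<tau>: "length \<tau> = 2 * m * a" and r: "R [str_code \<tau>, s]" and l: "l \<le> length \<tau>"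
    define D where "D = (\<lambda>j. M (take j \<tau>) - Q (take j \<tau>) s)"
    have D: "M \<sigma> - Q \<sigma> s \<ge> 0" for \<sigma> using q(3) unfolding Q_def by simp
    have "hits u \<tau> (length \<tau>) * (2 * m) \<le> (a * (m + 2)) * (2 * m)"
      using r unfolding R by (simp add: \<tau> algebra_simps)
    then have hit: "hits u \<tau> l \<le> a * (m + 2)"
      using hits_mono[OF l, of u \<tau>] m by (simp only: mult_le_cancel2) linarith
    have "D l \<le> 2 ^ hits u \<tau> l * (D 0 + real l * e \<tau>)"
    proof (rule gap_bound[where n = "length \<tau>"])
      fix j assume j: "j < length \<tau>"
      have tk: "take (Suc j) \<tau> = take j \<tau> @ [\<tau> ! j]" using j by (rule take_Suc_conv_app_nth)
      have r1: "2 * Q (take j \<tau>) s \<le> Q (take j \<tau> @ [False]) s + Q (take j \<tau> @ [True]) s + e \<tau>"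
        and r2: "Q (take j \<tau>) s + (if \<tau> ! j then 1 else - 1) * W (take j \<tau>) s \<le> Q (take (Suc j) \<tau>) s + e \<tau>"
        using r j unfolding R by auto
      have sn: "M (take j \<tau> @ [False]) + M (take j \<tau> @ [True]) = 2 * M (take j \<tau>)"
        by (rule martingale_snoc[OF mart])
      show "D (Suc j) \<le> 2 * D j + e \<tau>"
        using r1 sn D[of "take j \<tau> @ [\<not> \<tau> ! j]"] unfolding D_def tk by (cases "\<tau> ! j") auto
      assume ne: "\<tau> ! j \<noteq> u (take j \<tau>)"
      have wg: "wager M (take j \<tau>) = M (take j \<tau> @ [True]) - M (take j \<tau>)" unfolding wager_def ..
      show "D (Suc j) \<le> D j + e \<tau>"
      proof (cases "\<tau> ! j")
        case True
        then have "wager M (take j \<tau>) \<le> W (take j \<tau>) s"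
          using ne w(4) unfolding u_def W_def by simp
        then show ?thesis using r2 True wg unfolding D_def tk by simp
      next
        case False
        then have "W (take j \<tau>) s \<le> wager M (take j \<tau>)"
          using ne w(3) unfolding u_def W_def by simp
        then show ?thesis using r2 False wg sn unfolding D_def tk by simp
      qed
    qed (use D l in \<open>auto simp: D_def e_def\<close>)
    also have "\<dots> \<le> 2 ^ (a * (m + 2)) * (D 0 + 1 * (1 / 2) ^ (a * (m + 3)))"
    proof (rule mult_mono)
      show "(2::real) ^ hits u \<tau> l \<le> 2 ^ (a * (m + 2))" using hit by (rule power_increasing) simp
      have "real l * e \<tau> \<le> real (2 * m * a) * (1 / 2) ^ (2 * (2 * m * a))"
        unfolding e_def \<tau> using l[unfolded \<tau>] by (intro mult_right_mono of_nat_mono) auto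
      then show "D 0 + real l * e \<tau> \<le> D 0 + 1 * (1 / 2) ^ (a * (m + 3))"
        using half_power_error[OF m, of a] by linarith
      show "0 \<le> D 0 + real l * e \<tau>" using D unfolding D_def e_def by simp
    qed auto
    finally show "M (take l \<tau>) - real_of_rat (q [str_code (take l \<tau>), s]) \<le>
        2 ^ (a * (m + 2)) * (M [] - real_of_rat (q [str_code [], s]) + 1 * (1 / 2) ^ (a * (m + 3)))"
      unfolding D_def Q_def by simp
  qed (use mart q in auto)
qed

text \<open>At each string one of the two children has at most the value of the string
  itself.\<close>

lemma greedy_path:
  assumes "martingale E"
  shows "\<exists>\<tau>. prefix \<sigma> \<tau> \<and> length \<tau> = length \<sigma> + k \<and>
    (\<forall>l. length \<sigma> \<le> l \<longrightarrow> l \<le> length \<tau> \<longrightarrow> E (take l \<tau>) \<le> E \<sigma>)"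
proof (induction k)
  case 0
  show ?case by (intro exI[of _ \<sigma>]) simp
next
  case (Suc k)
  then obtain \<tau> where \<tau>: "prefix \<sigma> \<tau>" "length \<tau> = length \<sigma> + k"
    "\<And>l. length \<sigma> \<le> l \<Longrightarrow> l \<le> length \<tau> \<Longrightarrow> E (take l \<tau>) \<le> E \<sigma>" by blast
  have "E (\<tau> @ [False]) \<le> E \<tau> \<or> E (\<tau> @ [True]) \<le> E \<tau>"
    using martingale_snoc[OF assms, of \<tau>] by linarith
  then obtain b where b: "E (\<tau> @ [b]) \<le> E \<tau>" by blast
  have "E \<tau> \<le> E \<sigma>" using \<tau>(3)[of "length \<tau>"] \<tau>(2) by simp
  then have "E (take l (\<tau> @ [b])) \<le> E \<sigma>" if "length \<sigma> \<le> l" "l \<le> length (\<tau> @ [b])" for l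
    using that \<tau>(3)[of l] b by (cases "l \<le> length \<tau>") (auto simp: le_Suc_eq)
  then show ?case using \<tau> by (intro exI[of _ "\<tau> @ [b]"]) (auto intro: prefix_prefix)
qed

section \<open>Machines that search\<close>

text \<open>On a program, the machine looks for the first stage \<open>s\<close> at which a string
  with code below \<open>s\<close> passes the test \<open>G\<close>; bounding the string by the
  stage makes each stage decidable. \<open>H\<close> fixes the shape of the programs, and
  prefix-freeness is inherited from the shapes.\<close>

lemma search_machine:
  assumes H: "decidable 1 H"
    and free: "\<And>p q. H [str_code p] \<Longrightarrow> H [str_code q] \<Longrightarrow> prefix p q \<Longrightarrow> p = q"
    and G: "decidable 3 G"
  obtains V where "prefix_free_machine V"
    "\<And>p \<tau>. V p = Some \<tau> \<Longrightarrow> \<exists>s. G [str_code \<tau>, s, str_code p]"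
    "\<And>p \<tau> s. H [str_code p] \<Longrightarrow> G [str_code \<tau>, s, str_code p] \<Longrightarrow> str_code \<tau> < s \<Longrightarrow> V p \<noteq> None"
proof -
  define S where "S = (\<lambda>s x. H [x] \<and> (\<exists>t<s. G [t, s, x]))"
  \<comment> \<open>The second disjunct makes the minimization total at every stage; at the stage
    found by the search the least candidate satisfies the first one.\<close>
  define out where "out = (\<lambda>xs. LEAST t. G [t, xs ! 0, xs ! 1] \<or> xs ! 0 \<le> t)"
  have app: "decidable k (\<lambda>xs. G [a xs, b xs, c xs])" if "computable k a" "computable k b" "computable k c"
    for k a b c
    using computable_app3[OF G[unfolded decidable_def] that] by (simp add: decidable_def)
  have S: "decidable 2 (\<lambda>ys. S (hd ys) (hd (tl ys)))"
    unfolding S_def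
    by (intro computable_intros decidable_app1[OF H] app computable_tl
        computable_hd_tl) (simp_all add: numeral_2_eq_2 computable_hd computable_hd_tl computable_hd_tl_tl
        computable_tl[OF computable_hd])
  have out: "computable 2 out"
    unfolding out_def
    by (rule computable_Least) (intro computable_intros app, auto)
  obtain r where r: "\<And>x. eval r [x] = (if \<exists>s. S s x then Some (out [LEAST s. S s x, x]) else None)"
    using partial_search[OF S out] by blast
  have inv: "str_code (inv str_code x) = x" for x
    using bij_str_code by (simp add: bij_is_surj surj_f_inv_f)
  define V where "V = (\<lambda>p. if \<exists>s. S s (str_code p)
      then Some (inv str_code (out [LEAST s. S s (str_code p), str_code p])) else None)"
  show ?thesis
  proof (rule that[of V])
    have "\<forall>p. eval r [str_code p] = map_option str_code (V p)"
      unfolding r V_def by (simp add: inv)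
    moreover have "p = q" if "p \<in> dom V" "q \<in> dom V" "prefix p q" for p q
      by (rule free) (use that in \<open>auto simp: V_def S_def split: if_splits\<close>)
    ultimately show "prefix_free_machine V" unfolding prefix_free_machine_def by blast
  next
    fix p \<tau> assume V: "V p = Some \<tau>"
    define s where "s = (LEAST s. S s (str_code p))"
    have "\<exists>s. S s (str_code p)" and \<tau>: "str_code \<tau> = out [s, str_code p]"
      using V unfolding V_def s_def by (auto simp: inv split: if_splits)
    then have "S s (str_code p)" unfolding s_def by (metis LeastI)
    then obtain t where t: "t < s" "G [t, s, str_code p]" unfolding S_def by blast
    let ?P = "\<lambda>t. G [t, s, str_code p] \<or> s \<le> t"
    have "out [s, str_code p] = (LEAST t. ?P t)" unfolding out_def by simp
    moreover have "?P (LEAST t. ?P t)" using t by (intro LeastI[of ?P t]) simp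
    moreover have "(LEAST t. ?P t) \<le> t" using t by (intro Least_le) simp
    ultimately show "\<exists>s. G [str_code \<tau>, s, str_code p]" using t(1) \<tau> by auto
  next
    fix p \<tau> s assume "H [str_code p]" "G [str_code \<tau>, s, str_code p]" "str_code \<tau> < s"
    then have "\<exists>s. S s (str_code p)" unfolding S_def by blast
    then show "V p \<noteq> None" unfolding V_def by simp
  qed
qed

text \<open>The length of the initial block of ones. Past the end of the string lie a one (the leading
  bit of the code plus one) and then zeros only.\<close>

definition unary :: "nat \<Rightarrow> nat" where
  "unary x = (LEAST l. \<not> code_nth x l)"

lemma ex_not_code_nth: "\<exists>l. \<not> code_nth x l"
proof
  have "Suc x < 2 ^ Suc x" by (rule less_exp)
  then show "\<not> code_nth x (Suc x)" unfolding code_nth_def by simp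
qed

lemma unary_eqI: "(\<And>l. l < a \<Longrightarrow> code_nth x l) \<Longrightarrow> \<not> code_nth x a \<Longrightarrow> unary x = a"
  unfolding unary_def by (rule Least_equality) (auto intro: leI)

lemma code_nth_unary: "l < unary x \<Longrightarrow> code_nth x l" "\<not> code_nth x (unary x)"
  unfolding unary_def using not_less_Least LeastI_ex[OF ex_not_code_nth] by blast+

lemma computable_unary: "computable k f \<Longrightarrow> computable k (\<lambda>xs. unary (f xs))"
  unfolding unary_def
  by (rule computable_Least)
    (intro computable_intros code_intros computable_tl, simp_all add: ex_not_code_nth)

lemma unary_prefix:
  assumes "prefix p q" "unary (str_code p) < length p"
  shows "unary (str_code q) = unary (str_code p)"
proof (rule unary_eqI)
  have *: "code_nth (str_code q) l = code_nth (str_code p) l" if "l < length p" for l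
    using that assms(1) prefix_length_le[OF assms(1)] by (auto simp: prefix_def nth_append)
  show "code_nth (str_code q) l" if "l < unary (str_code p)" for l
    using * code_nth_unary(1)[OF that] that assms(2) by simp
  show "\<not> code_nth (str_code q) (unary (str_code p))"
    unfolding *[OF assms(2)] by (rule code_nth_unary(2))
qed

text \<open>In binary, from the most significant bit, \<open>Suc (str_code p)\<close> is
  \<open>J\<close> followed by a zero and \<open>a\<close> ones. The leading one of \<open>J\<close>
  serves as the leading one of the code, so that \<open>J\<close> costs only \<open>k\<close> of the
  bits of \<open>p\<close>.\<close>

lemma ex_program:
  assumes "2 ^ k \<le> J" "J < 2 ^ Suc k"
  obtains p where "length p = a + 1 + k" "unary (str_code p) = a" "Suc (str_code p) div 2 ^ Suc a = J"
proof -
  obtain p where p: "str_code p = J * 2 ^ Suc a + 2 ^ a - 2"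
    using bij_str_code by (metis bij_is_surj surjD)
  have "1 \<le> J" using assms(1) by (metis le_trans one_le_numeral one_le_power)
  then have "2 * 1 \<le> 2 ^ Suc a * J" by (intro mult_mono) auto
  then have S: "Suc (str_code p) = 2 ^ Suc a * J + (2 ^ a - 1)"
  proof -
    have "Suc (x + y - 2) = x + (y - 1)" if "2 \<le> x" "1 \<le> y" for x y :: nat using that by simp
    then show ?thesis using \<open>2 * 1 \<le> 2 ^ Suc a * J\<close> unfolding p mult.commute[of J] by simp
  qed
  have 1: "Suc (str_code p) div 2 ^ Suc a = J" unfolding S by (subst div_mult_self4) (simp_all add: div_eq_0_iff less_imp_diff_less)
  have 2: "unary (str_code p) = a"
  proof (rule unary_eqI)
    have S': "Suc (str_code p) = 2 ^ a * (2 * J) + (2 ^ a - 1)" unfolding S by simp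
    have "Suc (str_code p) div 2 ^ a = 2 * J"
      unfolding S' by (subst div_mult_self4) simp_all
    then show "\<not> code_nth (str_code p) a" unfolding code_nth_def by simp
    show "code_nth (str_code p) l" if less: "l < a" for l
    proof -
      obtain d where a: "a = Suc l + d" using le_Suc_ex[OF Suc_leI[OF less]] by blast
      \<comment> \<open>\<open>2 ^ l * (2 * c) - 1\<close> has the odd number
        \<open>2 * c - 1\<close> above its lowest \<open>l\<close> bits, which is why bit
        \<open>l\<close> is set.\<close>
      define c where "c = 2 ^ d * (2 * J + 1)"
      have "0 < 2 ^ d * (2 * J + 1)" by (intro mult_pos_pos) auto
      then have c: "1 \<le> c" unfolding c_def by linarith
      have e: "2 ^ Suc a * J + 2 ^ a = 2 ^ l * (2 * c)" unfolding a c_def by (simp add: power_add algebra_simps)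
      have "2 ^ l * (2 * c - 1) + (2 ^ l - 1) = 2 ^ l * (2 * c) - (1 :: nat)"
        using c by (simp add: diff_mult_distrib2)
      also have "\<dots> = Suc (str_code p)" unfolding S e[symmetric] by simp
      finally have S'': "Suc (str_code p) = 2 ^ l * (2 * c - 1) + (2 ^ l - 1)" by simp
      have "Suc (str_code p) div 2 ^ l = 2 * c - 1"
        unfolding S'' by (subst div_mult_self4) simp_all
      moreover have "(2 * c - 1) mod 2 = 1" using c by presburger
      ultimately show ?thesis unfolding code_nth_def by simp
    qed
  qed
  have "(2::nat) ^ Suc a * 2 ^ k \<le> 2 ^ Suc a * J" using assms(1) by (intro mult_left_mono) auto
  then have "2 ^ (a + 1 + k) \<le> 2 ^ Suc a * J" by (simp add: power_add)
  also have "\<dots> \<le> Suc (str_code p)" unfolding S by (rule le_add1)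
  finally have "2 ^ (a + 1 + k) \<le> Suc (str_code p)" .
  then have "(2::nat) ^ (a + 1 + k) < 2 ^ Suc (length p)" using str_code_bounds(2)[of p] by linarith
  then have l1: "a + 1 + k < Suc (length p)" by (rule power_less_imp_less_exp[rotated]) simp
  have "(2::nat) ^ Suc a * Suc J \<le> 2 ^ Suc a * 2 ^ Suc k" using assms(2) by (intro mult_left_mono) auto
  moreover have "Suc (str_code p) < 2 ^ Suc a * Suc J"
  proof -
    have "(2::nat) ^ a - 1 < 2 ^ Suc a" by (simp add: less_imp_diff_less)
    then show ?thesis unfolding S mult_Suc_right by linarith
  qed
  ultimately have "Suc (str_code p) < 2 ^ (Suc a + Suc k)" unfolding power_add by linarith
  then have "(2::nat) ^ length p < 2 ^ (Suc a + Suc k)" using str_code_bounds(1)[of p] by linarith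
  then have "length p < Suc a + Suc k" by (rule power_less_imp_less_exp[rotated]) simp
  with l1 have "length p = a + 1 + k" by simp
  with 1 2 show ?thesis using that by blast
qed


text \<open>The block of ones of \<open>p\<close> ends inside \<open>p\<close>, so \<open>q\<close>
  has the same block. The block determines the length, and a prefix of equal length is the whole
  string.\<close>

lemma program_shape_prefix_free:
  assumes "code_length (str_code p) = unary (str_code p) * d + 1" "0 < d"
    and "code_length (str_code q) = unary (str_code q) * d + 1" "prefix p q"
  shows "p = q"
proof -
  have "unary (str_code p) * 1 \<le> unary (str_code p) * d" using assms(2) by (intro mult_left_mono) auto
  then have "unary (str_code p) < length p" using assms(1) unfolding code_length_str_code by linarith
  then have "length p = length q" using unary_prefix[OF assms(4)] assms(1,3) by simp
  then show ?thesis using assms(4) by (metis prefix_order.eq_iff prefix_def append_eq_conv_conj take_all le_refl)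
qed

lemma prefix_complexity_le:
  assumes "U p = Some \<sigma>" shows "prefix_complexity U \<sigma> \<le> length p"
  unfolding prefix_complexity_def using assms by (intro Least_le) blast

section \<open>Extending a string\<close>

text \<open>A program consists of \<open>a\<close> in unary and of \<open>a * (m + 3)\<close> bits that give the value of the
  martingale at the empty string to that precision. From a stage that reaches this precision on,
  the martingale can no longer grow substantially along any string accepted by the search.\<close>

lemma tame_extension:
  assumes tame: "tame m M" and M1: "M [] < 1" and m: "3 \<le> m"
    and U: "optimal_prefix_free_machine U" and \<delta>: "0 < \<delta>"
  shows "\<exists>\<tau>. prefix \<sigma> \<tau> \<and> N \<le> length \<tau> \<and>
    real (prefix_complexity U \<tau>) \<le> (1 / 2 + 3 / real m) * real (length \<tau>) \<and>
    (\<forall>l. length \<sigma> \<le> l \<longrightarrow> l \<le> length \<tau> \<longrightarrow> M (take l \<tau>) \<le> M \<sigma> + \<delta>)"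
proof -
  obtain q R B K where mart: "martingale M" and q: "computable_rat 2 q" and R: "decidable 2 R"
    and B: "martingale B" and K: "0 \<le> K"
    and qM: "\<And>\<sigma> s. real_of_rat (q [str_code \<sigma>, s]) \<le> M \<sigma>"
    and qlim: "\<And>\<sigma>. (\<lambda>s. real_of_rat (q [str_code \<sigma>, s])) \<longlonglongrightarrow> M \<sigma>"
    and compl: "\<And>C. \<exists>a0. \<forall>a\<ge>a0. \<forall>\<tau>. length \<tau> = 2 * m * a \<longrightarrow> B \<tau> \<le> C \<longrightarrow>
         eventually (\<lambda>s. R [str_code \<tau>, s]) sequentially"
    and sound: "\<And>a \<tau> s l. length \<tau> = 2 * m * a \<Longrightarrow> R [str_code \<tau>, s] \<Longrightarrow> l \<le> length \<tau> \<Longrightarrow>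
         M (take l \<tau>) - real_of_rat (q [str_code (take l \<tau>), s]) \<le>
         2 ^ (a * (m + 2)) * (M [] - real_of_rat (q [str_code [], s]) + K * (1 / 2) ^ (a * (m + 3)))"
    using tame unfolding tame_def by blast
  \<comment> \<open>Makes \<open>\<kappa> * B \<sigma>\<close> at most \<open>\<delta> / 4\<close>;
    the added 1 keeps the denominator positive.\<close>
  define \<kappa> where "\<kappa> = \<delta> / (4 * (B \<sigma> + 1))"
  have B0: "0 \<le> B \<tau>" and M0: "0 \<le> M \<tau>" for \<tau> using martingale_nonneg B mart by auto
  have \<kappa>: "0 < \<kappa>" unfolding \<kappa>_def using \<delta> B0[of \<sigma>] by (intro divide_pos_pos) auto
  have \<kappa>B: "\<kappa> * B \<sigma> \<le> \<delta> / 4"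
    unfolding \<kappa>_def using \<delta> B0[of \<sigma>] by (simp add: field_simps)
  \<comment> \<open>The bound on \<open>B\<close> that descent along \<open>M + \<kappa> * B\<close>
    guarantees.\<close>
  define C where "C = (M \<sigma> + \<kappa> * B \<sigma>) / \<kappa>"
  obtain a0 where a0: "\<And>a \<tau>. a0 \<le> a \<Longrightarrow> length \<tau> = 2 * m * a \<Longrightarrow> B \<tau> \<le> C \<Longrightarrow>
      eventually (\<lambda>s. R [str_code \<tau>, s]) sequentially"
    using compl[of C] by blast
  \<comment> \<open>The rational threshold \<open>c\<close> lies above everything the greedy string
    reaches and still leaves \<open>\<delta> / 2\<close> for the growth after the accepting
    stage.\<close>
  obtain c where c: "M \<sigma> + \<delta> / 4 < real_of_rat c" "real_of_rat c < M \<sigma> + \<delta> / 2"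
    using of_rat_dense[of "M \<sigma> + \<delta> / 4" "M \<sigma> + \<delta> / 2"] \<delta> by auto
  define L where "L = length \<sigma>"
  \<comment> \<open>The shape is \<open>a\<close> ones, a zero and \<open>a * (m + 3)\<close>
    further bits.\<close>
  define H where "H = (\<lambda>xs. code_length (hd xs) = unary (hd xs) * (m + 4) + 1)"
  \<comment> \<open>The last conjunct compares the number coded in the program with the stage's
    value at the empty string, whose code is 0. For the program chosen below, the final
    \<open>+ 1\<close> makes it true at all late stages.\<close>
  define G where "G = (\<lambda>xs. code_length (xs ! 0) = 2 * m * unary (xs ! 2) \<and>
    L \<le> code_length (xs ! 0) \<and> code_take L (xs ! 0) = str_code \<sigma> \<and> R [xs ! 0, xs ! 1] \<and>
    (\<forall>l<Suc (code_length (xs ! 0)). L \<le> l \<longrightarrow> q [code_take l (xs ! 0), xs ! 1] \<le> c) \<and>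
    of_nat (Suc (xs ! 2) div 2 ^ Suc (unary (xs ! 2))) <
      of_nat (2 ^ (unary (xs ! 2) * (m + 3))) * (1 + q [0, xs ! 1]) + 1)"
  have H: "decidable 1 H"
    unfolding H_def by (intro computable_intros code_intros computable_unary) simp_all
  have G: "decidable 3 G"
    unfolding G_def
    by (intro computable_rat_intros computable_intros code_intros computable_unary
        computable_rat_app2 decidable_app2 q R) simp_all
  have free: "p = p'" if "H [str_code p]" "H [str_code p']" "prefix p p'" for p p'
    by (rule program_shape_prefix_free[of p "m + 4" p']) (use that in \<open>auto simp: H_def\<close>)
  obtain V where V: "prefix_free_machine V"
    "\<And>p \<tau>. V p = Some \<tau> \<Longrightarrow> \<exists>s. G [str_code \<tau>, s, str_code p]"
    "\<And>p \<tau> s. H [str_code p] \<Longrightarrow> G [str_code \<tau>, s, str_code p] \<Longrightarrow> str_code \<tau> < s \<Longrightarrow> V p \<noteq> None"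
    using search_machine[OF H free G] by blast
  obtain cV where cV: "\<And>p \<tau>. V p = Some \<tau> \<Longrightarrow> \<exists>p'. U p' = Some \<tau> \<and> length p' \<le> length p + cV"
    using U V(1) unfolding optimal_prefix_free_machine_def by blast
  obtain a1 where a1: "(2 + K) * (1 / 2) ^ a < \<delta> / 2" if "a \<ge> a1" for a
    using order_tendstoD(2)[OF tendsto_half_power[of "2 + K"], of "\<delta> / 2"] \<delta>
    unfolding eventually_sequentially by auto
  \<comment> \<open>The summand \<open>1 + cV\<close> lets \<open>a\<close> absorb the zero in the
    program and the constant of the simulation by \<open>U\<close>.\<close>
  define a where "a = a0 + a1 + N + L + 1 + cV"
  have a: "a0 \<le> a" "a1 \<le> a" "N \<le> a" "L \<le> a" "1 + cV \<le> a" unfolding a_def by auto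
  define n where "n = 2 * m * a"
  have an: "a \<le> n" unfolding n_def using m by simp
  define h where "h = (1 / 2 :: real) ^ (a * (m + 3))"
  define k where "k = a * (m + 3)"
  have h: "0 < h" "2 ^ k * h = 1" "2 ^ (a * (m + 2)) * h = (1 / 2) ^ a"
  proof -
    show "0 < h" unfolding h_def by simp
    show "2 ^ k * h = 1" unfolding h_def k_def by (simp flip: power_mult_distrib)
    have "a * (m + 3) = a * (m + 2) + a" by (simp add: algebra_simps)
    then have "h = (1 / 2) ^ (a * (m + 2)) * (1 / 2) ^ a" unfolding h_def by (simp only: power_add)
    then have "2 ^ (a * (m + 2)) * h = (2 * (1 / 2)) ^ (a * (m + 2)) * (1 / 2) ^ a"
      unfolding power_mult_distrib by (simp only: mult.assoc)
    then show "2 ^ (a * (m + 2)) * h = (1 / 2) ^ a" by simp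
  qed
  \<comment> \<open>Adding 1 to the value at the empty string, which lies below 1, places
    \<open>J\<close> between \<open>2 ^ k\<close> and \<open>2 ^ Suc k\<close>, as a program with
    \<open>k\<close> data bits requires.\<close>
  define J where "J = nat \<lfloor>2 ^ k * (1 + M [])\<rfloor>"
  have k0: "(2::real) ^ k \<le> 2 ^ k * (1 + M [])" using M0[of "[]"] by simp
  have J: "real J \<le> 2 ^ k * (1 + M [])" "2 ^ k * (1 + M []) < real J + 1"
    unfolding J_def using k0 zero_le_power[of "2::real" k] by (linarith, linarith)
  obtain p where p: "length p = a + 1 + k" "unary (str_code p) = a" "Suc (str_code p) div 2 ^ Suc a = J"
  proof (rule ex_program[of k J a])
    have "(2::real) ^ k < real (Suc J)" using k0 J(2) unfolding of_nat_Suc by linarith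
    then have "2 ^ k < Suc J" by (metis of_nat_less_iff of_nat_numeral of_nat_power)
    then show "2 ^ k \<le> J" by simp
    have "real J < 2 ^ k * 2" using J(1) M1 by (intro le_less_trans[OF J(1)]) simp
    then have "real J < real (2 ^ Suc k)" by simp
    then show "J < 2 ^ Suc k" unfolding of_nat_less_iff .
  qed
  have Hp: "H [str_code p]" unfolding H_def using p by (simp add: k_def algebra_simps)
  have Gp: "G [str_code \<tau>, s, str_code p] \<longleftrightarrow> length \<tau> = n \<and> L \<le> length \<tau> \<and>
      code_take L (str_code \<tau>) = str_code \<sigma> \<and> R [str_code \<tau>, s] \<and>
      (\<forall>l. L \<le> l \<longrightarrow> l \<le> length \<tau> \<longrightarrow> real_of_rat (q [str_code (take l \<tau>), s]) \<le> real_of_rat c) \<and>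
      real J < 2 ^ k * (1 + real_of_rat (q [str_code [], s])) + 1" for \<tau> s
  proof -
    have "of_nat J < of_nat (2 ^ k) * (1 + q [0, s]) + 1 \<longleftrightarrow>
        real_of_rat (of_nat J) < real_of_rat (of_nat (2 ^ k) * (1 + q [0, s]) + 1)"
      by (simp only: of_rat_less)
    also have "\<dots> \<longleftrightarrow> real J < 2 ^ k * (1 + real_of_rat (q [0, s])) + 1"
      unfolding of_rat_add of_rat_mult by (simp add: of_rat_power)
    finally show ?thesis
      unfolding G_def using p(2,3) by (auto simp: n_def k_def of_rat_less_eq less_Suc_eq_le)
  qed
  \<comment> \<open>\<open>\<rho>\<close> witnesses that the search succeeds. The machine may output
    a different string, for which everything is derived from the test \<open>G\<close>.\<close>
  obtain \<rho> where \<rho>: "prefix \<sigma> \<rho>" "length \<rho> = n"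
    and greedy: "\<And>l. L \<le> l \<Longrightarrow> l \<le> n \<Longrightarrow> M (take l \<rho>) + \<kappa> * B (take l \<rho>) \<le> M \<sigma> + \<kappa> * B \<sigma>"
    using greedy_path[OF martingale_add[OF mart martingale_scale[OF B less_imp_le[OF \<kappa>]]], of \<sigma> "n - L"]
      a(4) an unfolding L_def by auto
  have "B \<rho> \<le> C"
    using greedy[of n] \<rho>(2) a(4) an M0[of \<rho>] \<kappa> unfolding C_def by (simp add: field_simps)
  then have "eventually (\<lambda>s. R [str_code \<rho>, s]) sequentially"
    using a0[OF a(1)] \<rho>(2) unfolding n_def by blast
  moreover have "eventually (\<lambda>s. \<forall>l\<in>{L..n}. real_of_rat (q [str_code (take l \<rho>), s]) \<le> real_of_rat c) sequentially"
  proof (intro always_eventually allI ballI)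
    fix s l assume "l \<in> {L..n}"
    then have "M (take l \<rho>) \<le> M \<sigma> + \<kappa> * B \<sigma>"
      using greedy[of l] mult_nonneg_nonneg[OF less_imp_le[OF \<kappa>] B0[of "take l \<rho>"]] by auto
    then show "real_of_rat (q [str_code (take l \<rho>), s]) \<le> real_of_rat c"
      using qM[of "take l \<rho>" s] \<kappa>B c(1) by linarith
  qed
  moreover have "eventually (\<lambda>s. real J < 2 ^ k * (1 + real_of_rat (q [str_code [], s])) + 1) sequentially"
  proof (rule order_tendstoD(1))
    show "(\<lambda>s. 2 ^ k * (1 + real_of_rat (q [str_code [], s])) + 1) \<longlonglongrightarrow> 2 ^ k * (1 + M []) + 1"
      by (intro tendsto_intros qlim)
    show "real J < 2 ^ k * (1 + M []) + 1" using J(1) by simp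
  qed
  moreover have "eventually (\<lambda>s. str_code \<rho> < s) sequentially" by (rule eventually_gt_at_top)
  ultimately have "eventually (\<lambda>s. G [str_code \<rho>, s, str_code p] \<and> str_code \<rho> < s) sequentially"
  proof eventually_elim
    case (elim s)
    have "code_take L (str_code \<rho>) = str_code \<sigma>"
      using \<rho> a(4) an unfolding L_def by (simp add: prefix_def) auto
    then show ?case unfolding Gp using elim \<rho>(2) a(4) an by auto
  qed
  then obtain s where "G [str_code \<rho>, s, str_code p]" "str_code \<rho> < s"
    unfolding eventually_sequentially by blast
  then obtain \<tau> where \<tau>: "V p = Some \<tau>" using V(3)[OF Hp] by blast
  then obtain s where s: "G [str_code \<tau>, s, str_code p]" using V(2) by blast
  then have len: "length \<tau> = n" and R\<tau>: "R [str_code \<tau>, s]" and Jq: "real J < 2 ^ k * (1 + real_of_rat (q [str_code [], s])) + 1"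
    and qc: "\<And>l. L \<le> l \<Longrightarrow> l \<le> n \<Longrightarrow> real_of_rat (q [str_code (take l \<tau>), s]) \<le> real_of_rat c"
    and ct: "code_take L (str_code \<tau>) = str_code \<sigma>"
    unfolding Gp by auto
  have "str_code (take L \<tau>) = str_code \<sigma>" using ct a(4) an len by simp
  then have tk: "take L \<tau> = \<sigma>" using bij_str_code by (metis bij_is_inj injD)
  show ?thesis
  proof (intro exI[of _ \<tau>] conjI allI impI)
    show "prefix \<sigma> \<tau>" using tk take_is_prefix by metis
    show "N \<le> length \<tau>" using len a(3) an by simp
    obtain p' where p': "U p' = Some \<tau>" "length p' \<le> length p + cV" using cV[OF \<tau>] by blast
    have "prefix_complexity U \<tau> \<le> a * (m + 6)"
      using prefix_complexity_le[of U, OF p'(1)] p'(2) a(5) unfolding p(1) k_def by (simp add: algebra_simps)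
    then have "real (prefix_complexity U \<tau>) \<le> real (a * (m + 6))" by (rule of_nat_mono)
    also have "\<dots> = (1 / 2 + 3 / real m) * real (length \<tau>)"
      unfolding len n_def using m by (simp add: field_simps)
    finally show "real (prefix_complexity U \<tau>) \<le> (1 / 2 + 3 / real m) * real (length \<tau>)" .
    fix l assume l: "length \<sigma> \<le> l" "l \<le> length \<tau>"
    \<comment> \<open>Rounding \<open>J\<close> down and the slack in the test cost at most 1 each
      at scale \<open>2 ^ k\<close>, hence the gap \<open>2 * h\<close>.\<close>
    have "2 ^ k * (M [] - real_of_rat (q [str_code [], s])) < 2 ^ k * (2 * h)"
      using J(2) Jq h(2) by (simp add: algebra_simps)
    then have gap: "M [] - real_of_rat (q [str_code [], s]) < 2 * h" by simp
    have "M (take l \<tau>) - real_of_rat (q [str_code (take l \<tau>), s]) \<le>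
        2 ^ (a * (m + 2)) * (M [] - real_of_rat (q [str_code [], s]) + K * h)"
      unfolding h_def by (rule sound) (use len l R\<tau> in \<open>auto simp: n_def\<close>)
    also have "\<dots> \<le> 2 ^ (a * (m + 2)) * (2 * h + K * h)"
      using gap by (intro mult_left_mono) auto
    also have "\<dots> = (2 + K) * (2 ^ (a * (m + 2)) * h)" by (simp add: algebra_simps)
    also have "\<dots> = (2 + K) * (1 / 2) ^ a" unfolding h(3) ..
    also have "\<dots> < \<delta> / 2" using a1 a(2) by blast
    finally show "M (take l \<tau>) \<le> M \<sigma> + \<delta>"
      using qc[of l] l len c(2) unfolding L_def by linarith
  qed
qed

section \<open>Meeting all opponents along one sequence\<close>

instance recf :: countable by countable_datatype

text \<open>The construction of the sequence is not effective, so countability of the triples of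
  programs suffices. Triples that describe no approximation receive whatever \<open>the\<close> and
  \<open>lim\<close> return.\<close>

lemma enumeration_left_ce: "\<exists>F :: nat \<Rightarrow> str \<Rightarrow> real. \<forall>M. left_ce M \<longrightarrow> M \<in> range F"
proof -
  define v where "v = (\<lambda>r xs. the (eval r xs))"
  define F where "F = (\<lambda>i \<sigma>. case from_nat i of (ra, rb, rc) \<Rightarrow>
    lim (\<lambda>s. real_of_rat ((of_nat (v ra [str_code \<sigma>, s]) - of_nat (v rb [str_code \<sigma>, s])) /
      of_nat (Suc (v rc [str_code \<sigma>, s])))))"
  have "M \<in> range F" if M: "left_ce M" for M
  proof -
    obtain q where q: "computable_rat 2 q" "\<And>\<sigma>. (\<lambda>s. real_of_rat (q [str_code \<sigma>, s])) \<longlonglongrightarrow> M \<sigma>"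
      using M unfolding left_ce_def by blast
    from computable_ratE[OF q(1)] obtain a b c where
      abc: "computable 2 a" "computable 2 b" "computable 2 c"
      "\<And>xs. length xs = 2 \<Longrightarrow> q xs = (of_nat (a xs) - of_nat (b xs)) / of_nat (Suc (c xs))" by metis
    obtain ra where ra: "\<And>xs. length xs = 2 \<Longrightarrow> eval ra xs = Some (a xs)"
      using abc(1) unfolding computable_def by blast
    obtain rb where rb: "\<And>xs. length xs = 2 \<Longrightarrow> eval rb xs = Some (b xs)"
      using abc(2) unfolding computable_def by blast
    obtain rc where rc: "\<And>xs. length xs = 2 \<Longrightarrow> eval rc xs = Some (c xs)"
      using abc(3) unfolding computable_def by blast
    have "F (to_nat (ra, rb, rc)) = M"
    proof
      fix \<sigma>
      have "F (to_nat (ra, rb, rc)) \<sigma> = lim (\<lambda>s. real_of_rat (q [str_code \<sigma>, s]))"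
        unfolding F_def by (simp add: v_def ra rb rc abc(4))
      then show "F (to_nat (ra, rb, rc)) \<sigma> = M \<sigma>" using limI[OF q(2)] by simp
    qed
    then show ?thesis by blast
  qed
  then show ?thesis by blast
qed

lemma not_succeedsI:
  assumes "\<And>n. n \<ge> N \<Longrightarrow> M (initial X n) \<le> c"
  shows "\<not> succeeds M X"
proof -
  have "limsup (\<lambda>n. ereal (M (initial X n))) \<le> ereal c"
    by (rule Limsup_bounded) (use assms in \<open>auto simp: eventually_sequentially\<close>)
  then show ?thesis unfolding succeeds_def by auto
qed

lemma not_succeedsD:
  assumes "\<not> succeeds M X"
  obtains c N where "0 < c" "\<And>n. n \<ge> N \<Longrightarrow> M (initial X n) \<le> c"
proof -
  have "limsup (\<lambda>n. ereal (M (initial X n))) < \<infinity>"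
    using assms unfolding succeeds_def by (simp add: less_top[symmetric] top_ereal_def)
  then obtain k :: nat where "limsup (\<lambda>n. ereal (M (initial X n))) < ereal (real k)"
    using less_PInf_Ex_of_nat by auto
  from Limsup_lessD[OF this] obtain N where N: "\<And>n. n \<ge> N \<Longrightarrow> M (initial X n) < real k"
    unfolding eventually_sequentially by auto
  show ?thesis
    by (rule that[of "real k + 1" N]) (use N in \<open>auto intro: less_imp_le order_trans[OF less_imp_le[OF N]]\<close>)
qed

lemma initial_chain:
  assumes "\<And>n. prefix (\<sigma> n) (\<sigma> (Suc n))" "\<And>n. length (\<sigma> n) < length (\<sigma> (Suc n))"
  obtains X where "\<And>e l. l \<le> length (\<sigma> e) \<Longrightarrow> initial X l = take l (\<sigma> e)"
proof -
  have pre: "prefix (\<sigma> i) (\<sigma> j)" if "i \<le> j" for i j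
    using that by (induction j rule: dec_induct) (auto intro: assms(1) prefix_order.trans)
  have len: "n \<le> length (\<sigma> n)" for n
  proof (induction n)
    case (Suc n)
    then show ?case using assms(2)[of n] by simp
  qed simp
  \<comment> \<open>\<open>\<sigma> (Suc n)\<close> has more than \<open>n\<close> bits, since the
    lengths increase strictly.\<close>
  define X where "X = (\<lambda>n. \<sigma> (Suc n) ! n)"
  have X: "X n = \<sigma> e ! n" if "n < length (\<sigma> e)" for n e
  proof (cases "Suc n \<le> e")
    case True
    then obtain zs where "\<sigma> e = \<sigma> (Suc n) @ zs" using pre unfolding prefix_def by blast
    then show ?thesis unfolding X_def using len[of "Suc n"] by (simp add: nth_append)
  next
    case False
    then obtain zs where "\<sigma> (Suc n) = \<sigma> e @ zs" using pre[of e "Suc n"] unfolding prefix_def by auto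
    then show ?thesis unfolding X_def using that by (simp add: nth_append)
  qed
  have "initial X l = take l (\<sigma> e)" if "l \<le> length (\<sigma> e)" for l e
    unfolding initial_def using that X by (intro nth_equalityI) auto
  then show ?thesis by (rule that)
qed

lemma small_multiple:
  fixes y z :: real
  assumes "0 < e" shows "\<exists>c>0. real_of_rat c * y \<le> e \<and> real_of_rat c * z \<le> e"
proof -
  define t where "t = e / (\<bar>y\<bar> + \<bar>z\<bar> + 1)"
  have "0 < t" unfolding t_def using assms by (intro divide_pos_pos) auto
  then obtain c where c: "0 < real_of_rat c" "real_of_rat c < t" using of_rat_dense[of 0 t] by auto
  have "real_of_rat c * v \<le> e" if "v \<le> \<bar>y\<bar> + \<bar>z\<bar> + 1" for v
  proof -
    have "real_of_rat c * v \<le> real_of_rat c * (\<bar>y\<bar> + \<bar>z\<bar> + 1)" using c(1) that by (intro mult_left_mono) auto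
    also have "\<dots> \<le> t * (\<bar>y\<bar> + \<bar>z\<bar> + 1)" using c(2) by (intro mult_right_mono) auto
    also have "\<dots> = e" unfolding t_def by (simp add: field_simps)
    finally show ?thesis .
  qed
  from this[of y] this[of z] show ?thesis using c(1) by (intro exI[of _ c]) auto
qed

text \<open>The opponents enter one after the other, each scaled so that it adds little at the string
  reached so far.\<close>

lemma unbeaten_sequence:
  assumes ext: "\<And>m M \<sigma> N \<delta>. tame m M \<Longrightarrow> M [] < 1 \<Longrightarrow> 3 \<le> m \<Longrightarrow> 0 < \<delta> \<Longrightarrow>
    \<exists>\<tau>. prefix \<sigma> \<tau> \<and> N \<le> length \<tau> \<and> G m \<tau> \<and>
      (\<forall>l. length \<sigma> \<le> l \<longrightarrow> l \<le> length \<tau> \<longrightarrow> M (take l \<tau>) \<le> M \<sigma> + \<delta>)"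
  obtains X where "\<And>M. martingale M \<Longrightarrow> strongly_left_ce M \<Longrightarrow> \<not> succeeds M X"
    "\<And>m N. \<exists>n\<ge>N. \<exists>m'\<ge>m. G m' (initial X n)"
proof -
  obtain F :: "nat \<Rightarrow> str \<Rightarrow> real" where F: "\<And>M. left_ce M \<Longrightarrow> M \<in> range F"
    using enumeration_left_ce by blast
  \<comment> \<open>List entries that are not opponents become the zero martingale, which is tame
    for every \<open>m\<close>.\<close>
  define S where "S = (\<lambda>i. if martingale (F i) \<and> strongly_left_ce (F i) then F i else (\<lambda>_. 0))"
  have tameS: "tame m (S i)" if "3 \<le> m" for m i
    unfolding S_def using that tame_zero tame_strongly_left_ce by auto
  have S0: "0 \<le> S i \<rho>" for i \<rho>
    using tameS[of 3 i] martingale_nonneg unfolding tame_def by blast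
  \<comment> \<open>Stage \<open>e\<close> may spend \<open>(1 / 2) ^ Suc e\<close> at the empty
    string, on the new opponent, which keeps the value there below 1. At the current string it may
    spend twice as much: once on the opponent and once on the extension. Tameness is kept for all
    \<open>m\<close> because the parameter changes with the stage.\<close>
  define P where "P = (\<lambda>e (\<sigma> :: str, E :: str \<Rightarrow> real). (\<forall>m\<ge>3. tame m E) \<and> E [] \<le> 1 - (1 / 2) ^ e \<and>
    E \<sigma> \<le> 2 - 2 * (1 / 2) ^ e)"
  \<comment> \<open>The parameter \<open>e + 3\<close> starts at the least admissible value and
    tends to infinity, which drives the complexity ratio to 1/2.\<close>
  define Q where "Q = (\<lambda>e (\<sigma> :: str, E :: str \<Rightarrow> real) (\<sigma>' :: str, E' :: str \<Rightarrow> real).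
    (\<exists>c>0. E' = (\<lambda>\<rho>. E \<rho> + real_of_rat c * S e \<rho>)) \<and> prefix \<sigma> \<sigma>' \<and> length \<sigma> < length \<sigma>' \<and>
    G (e + 3) \<sigma>' \<and>
    (\<forall>l. length \<sigma> \<le> l \<longrightarrow> l \<le> length \<sigma>' \<longrightarrow> E' (take l \<sigma>') \<le> 2))"
  have "\<exists>f. \<forall>n. P n (f n) \<and> Q n (f n) (f (Suc n))"
  proof (rule dependent_nat_choice)
    show "\<exists>x. P 0 x" unfolding P_def by (intro exI[of _ "([], \<lambda>_. 0)"]) (auto intro: tame_zero)
    fix x e assume Px: "P e x"
    obtain \<sigma> E where x: "x = (\<sigma>, E)" by (cases x)
    have E: "\<And>m. 3 \<le> m \<Longrightarrow> tame m E" "E [] \<le> 1 - (1 / 2) ^ e" "E \<sigma> \<le> 2 - 2 * (1 / 2) ^ e"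
      using Px unfolding P_def x by auto
    define d where "d = (1 / 2 :: real) ^ Suc e"
    have d: "0 < d" "(1 / 2) ^ e = 2 * d" unfolding d_def by auto
    obtain c where c: "0 < c" "real_of_rat c * S e [] \<le> d" "real_of_rat c * S e \<sigma> \<le> d"
      using small_multiple[OF d(1)] by blast
    define E' where "E' = (\<lambda>\<rho>. E \<rho> + real_of_rat c * S e \<rho>)"
    have tE': "tame m E'" if "3 \<le> m" for m
      unfolding E'_def using that c(1) by (intro tame_add tame_scale E tameS) auto
    have E'0: "E' [] \<le> 1 - d" and E'\<sigma>: "E' \<sigma> \<le> 2 - 3 * d"
      using E(2,3) c(2,3) unfolding E'_def d(2) by auto
    obtain \<sigma>' where \<sigma>': "prefix \<sigma> \<sigma>'" "Suc (length \<sigma>) \<le> length \<sigma>'"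
        "G (e + 3) \<sigma>'"
        "\<And>l. length \<sigma> \<le> l \<Longrightarrow> l \<le> length \<sigma>' \<Longrightarrow> E' (take l \<sigma>') \<le> E' \<sigma> + d"
      using ext[where \<sigma> = \<sigma> and N = "Suc (length \<sigma>)", OF tE'[of "e + 3"] _ _ d(1)] E'0 d(1) by auto
    have "E' \<sigma>' \<le> 2 - 2 * d" using \<sigma>'(4)[of "length \<sigma>'"] \<sigma>'(2) E'\<sigma> by simp
    moreover have "E' (take l \<sigma>') \<le> 2" if "length \<sigma> \<le> l" "l \<le> length \<sigma>'" for l
      using \<sigma>'(4)[OF that] E'\<sigma> d(1) by linarith
    ultimately have "P (Suc e) (\<sigma>', E')" "Q e x (\<sigma>', E')"
      unfolding P_def Q_def x d_def[symmetric] using tE' E'0 \<sigma>' c(1) by (auto simp: E'_def)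
    then show "\<exists>y. P (Suc e) y \<and> Q e x y" by blast
  qed
  then obtain f where f: "\<And>n. Q n (f n) (f (Suc n))" and fP: "\<And>n. P n (f n)" by blast
  define \<sigma> where "\<sigma> = (\<lambda>n. fst (f n))"
  define E where "E = (\<lambda>n. snd (f n))"
  have f': "f n = (\<sigma> n, E n)" for n unfolding \<sigma>_def E_def by simp
  have Q: "\<exists>c>0. E (Suc n) = (\<lambda>\<rho>. E n \<rho> + real_of_rat c * S n \<rho>)"
    "prefix (\<sigma> n) (\<sigma> (Suc n))" "length (\<sigma> n) < length (\<sigma> (Suc n))"
    "G (n + 3) (\<sigma> (Suc n))"
    "\<And>l. length (\<sigma> n) \<le> l \<Longrightarrow> l \<le> length (\<sigma> (Suc n)) \<Longrightarrow> E (Suc n) (take l (\<sigma> (Suc n))) \<le> 2" for n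
    using f[of n] unfolding f' Q_def by auto
  have E0: "0 \<le> E n \<rho>" for n \<rho>
  proof -
    have "tame 3 (E n)" using fP[of n] unfolding P_def f' by auto
    then show ?thesis unfolding tame_def using martingale_nonneg by blast
  qed
  have mono: "E i \<rho> \<le> E j \<rho>" if "i \<le> j" for i j \<rho>
    using that
  proof (induction j rule: dec_induct)
    case (step n)
    obtain c where "c > 0" "E (Suc n) \<rho> = E n \<rho> + real_of_rat c * S n \<rho>" using Q(1)[of n] by auto
    then show ?case using step.IH mult_nonneg_nonneg[OF _ S0, of "real_of_rat c" n \<rho>] by simp
  qed simp
  obtain X where X: "\<And>e l. l \<le> length (\<sigma> e) \<Longrightarrow> initial X l = take l (\<sigma> e)"
    using initial_chain[of \<sigma>] Q(2,3) by blast
  have len: "n \<le> length (\<sigma> n)" for n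
  proof (induction n)
    case (Suc n)
    then show ?case using Q(3)[of n] by simp
  qed simp
  show ?thesis
  proof (rule that[of X])
    fix M assume M: "martingale M" "strongly_left_ce M"
    then obtain i where i: "F i = M" using F unfolding strongly_left_ce_def by blast
    then have Si: "S i = M" unfolding S_def using M by simp
    obtain c where c: "c > 0" "E (Suc i) = (\<lambda>\<rho>. E i \<rho> + real_of_rat c * S i \<rho>)" using Q(1) by blast
    have c0: "0 < real_of_rat c" using c(1) by simp
    show "\<not> succeeds M X"
    proof (rule not_succeedsI)
      fix l assume l: "length (\<sigma> i) \<le> l"
      \<comment> \<open>The stage whose extension covers length \<open>l\<close>, and no earlier
        than the entry of opponent \<open>i\<close>.\<close>
      define e where "e = (LEAST e. l \<le> length (\<sigma> (Suc e)) \<and> i \<le> e)"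
      have ex: "l \<le> length (\<sigma> (Suc (max i l))) \<and> i \<le> max i l"
        using len[of "Suc (max i l)"] by auto
      have e: "l \<le> length (\<sigma> (Suc e))" "i \<le> e" unfolding e_def using LeastI[where P = "\<lambda>e. l \<le> length (\<sigma> (Suc e)) \<and> i \<le> e", OF ex] by auto
      have "length (\<sigma> e) \<le> l"
      proof (cases "e = i")
        case False
        then obtain e' where e': "e = Suc e'" "i \<le> e'" using e(2) by (cases e) auto
        have "e' < (LEAST e. l \<le> length (\<sigma> (Suc e)) \<and> i \<le> e)" using e'(1) unfolding e_def by simp
        from not_less_Least[OF this] have "\<not> (l \<le> length (\<sigma> (Suc e')) \<and> i \<le> e')" .
        then show ?thesis using e' by simp
      qed (use l in simp)
      then have "E (Suc e) (initial X l) \<le> 2" unfolding X[OF e(1)] using e(1) by (rule Q(5))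
      moreover have "E (Suc i) (initial X l) \<le> E (Suc e) (initial X l)" using e(2) by (intro mono) simp
      ultimately have "real_of_rat c * M (initial X l) \<le> 2"
        using c(2) E0[of i "initial X l"] unfolding Si by simp
      then show "M (initial X l) \<le> 2 / real_of_rat c" using c0 by (simp add: field_simps)
    qed
  next
    fix m N :: nat
    define e where "e = m + N"
    define n where "n = length (\<sigma> (Suc e))"
    have "Suc e \<le> n" unfolding n_def by (rule len)
    moreover have "initial X n = \<sigma> (Suc e)" unfolding n_def using X[of _ "Suc e"] by simp
    ultimately show "\<exists>n\<ge>N. \<exists>m'\<ge>m. G m' (initial X n)"
      using Q(4)[of e] by (intro exI[of _ n] conjI exI[of _ "e + 3"]) (auto simp: e_def)
  qed
qed

section \<open>The lower bound on the dimension\<close>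

text \<open>As a function of \<open>\<sigma>\<close> this is a martingale with capital 1 at the
  empty string that stakes everything on \<open>b\<close> at the positions where
  \<open>\<tau>\<close> has \<open>b\<close>. All its wagers point to \<open>b\<close>, whatever
  \<open>\<tau>\<close> is.\<close>

definition bet :: "bool \<Rightarrow> str \<Rightarrow> str \<Rightarrow> nat" where
  "bet b \<tau> \<sigma> = (\<Prod>j<length \<sigma>. if j < length \<tau> \<and> \<tau> ! j = b then (if \<sigma> ! j = b then 2 else 0) else 1)"

lemma bet_snoc:
  "bet b \<tau> (\<sigma> @ [c]) = bet b \<tau> \<sigma> *
    (if length \<sigma> < length \<tau> \<and> \<tau> ! length \<sigma> = b then (if c = b then 2 else 0) else 1)"
proof -
  have "(\<Prod>j<length \<sigma>. if j < length \<tau> \<and> \<tau> ! j = b then (if (\<sigma> @ [c]) ! j = b then 2 else 0) else 1) = bet b \<tau> \<sigma>"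
    unfolding bet_def by (rule prod.cong) (auto simp: nth_append)
  then show ?thesis unfolding bet_def by simp
qed

text \<open>Every position of \<open>\<tau>\<close> doubles exactly one of the two capitals.\<close>

lemma bet_True_False: "bet True \<tau> \<tau> * bet False \<tau> \<tau> = 2 ^ length \<tau>"
proof -
  have "bet True \<tau> \<tau> * bet False \<tau> \<tau> = (\<Prod>j<length \<tau>. 2)"
    unfolding bet_def prod.distrib[symmetric] by (rule prod.cong) auto
  then show ?thesis by simp
qed

lemma bet_le: "bet b \<tau> \<sigma> \<le> 2 ^ length \<sigma>"
proof -
  have "bet b \<tau> \<sigma> \<le> (\<Prod>j<length \<sigma>. 2)" unfolding bet_def by (rule prod_mono) auto
  then show ?thesis by simp
qed

definition code_bet :: "bool \<Rightarrow> nat \<Rightarrow> nat \<Rightarrow> nat" where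
  "code_bet b x y = (\<Prod>j<code_length y. if j < code_length x \<and> (code_nth x j \<longleftrightarrow> b)
     then (if code_nth y j \<longleftrightarrow> b then 2 else 0) else 1)"

lemma code_bet_str_code [simp]: "code_bet b (str_code \<tau>) (str_code \<sigma>) = bet b \<tau> \<sigma>"
  unfolding code_bet_def bet_def by (rule prod.cong) auto

lemma computable_code_bet:
  assumes "computable k f" "computable k g"
  shows "computable k (\<lambda>xs. code_bet b (f xs) (g xs))"
  unfolding code_bet_def
  by (intro computable_intros code_intros computable_tl assms) simp_all

text \<open>Induction on the maximal length. Unless \<open>A\<close> contains the empty string, and
  hence nothing else, removing the first bit yields two prefix-free sets of shorter strings, each of
  which enters the sum with half its weight.\<close>

lemma kraft:
  fixes A :: "str set"
  assumes "finite A" "\<And>p q. p \<in> A \<Longrightarrow> q \<in> A \<Longrightarrow> prefix p q \<Longrightarrow> p = q"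
  shows "(\<Sum>p\<in>A. (1 / 2 :: real) ^ length p) \<le> 1"
proof -
  have "(\<Sum>p\<in>A. (1 / 2 :: real) ^ length p) \<le> 1"
    if "finite A" "\<And>p q. p \<in> A \<Longrightarrow> q \<in> A \<Longrightarrow> prefix p q \<Longrightarrow> p = q" "\<And>p. p \<in> A \<Longrightarrow> length p \<le> n"
    for A :: "str set" and n
    using that
  proof (induction n arbitrary: A)
    case 0
    then have "A \<subseteq> {[]}" by auto
    then have "A = {} \<or> A = {[]}" by blast
    then show ?case by auto
  next
    case (Suc n)
    show ?case
    proof (cases "[] \<in> A")
      case True
      then have "A = {[]}" using Suc.prems(2)[of "[]"] by auto
      then show ?thesis by simp
    next
      case False
      define T where "T = (\<lambda>b. {p. b # p \<in> A})"
      have fin: "finite (T b)" for b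
        using finite_vimageI[OF Suc.prems(1), of "Cons b"] unfolding T_def vimage_def by auto
      have IH: "(\<Sum>p\<in>T b. (1 / 2 :: real) ^ length p) \<le> 1" for b
      proof (rule Suc.IH[OF fin])
        show "p = q" if "p \<in> T b" "q \<in> T b" "prefix p q" for p q
          using Suc.prems(2)[of "b # p" "b # q"] that unfolding T_def by simp
        show "length p \<le> n" if "p \<in> T b" for p
          using Suc.prems(3)[of "b # p"] that unfolding T_def by simp
      qed
      have A: "A = Cons True ` T True \<union> Cons False ` T False"
      proof (intro set_eqI iffI)
        fix p assume p: "p \<in> A"
        then obtain b p' where "p = b # p'" using False by (cases p) auto
        then show "p \<in> Cons True ` T True \<union> Cons False ` T False"
          using p unfolding T_def by (cases b) auto
      qed (auto simp: T_def)
      have "(\<Sum>p\<in>A. (1 / 2 :: real) ^ length p) =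
          (\<Sum>p\<in>Cons True ` T True. (1 / 2) ^ length p) + (\<Sum>p\<in>Cons False ` T False. (1 / 2) ^ length p)"
        unfolding A by (rule sum.union_disjoint) (auto simp: fin)
      also have "\<dots> = (\<Sum>p\<in>T True. (1 / 2) ^ length p) / 2 + (\<Sum>p\<in>T False. (1 / 2) ^ length p) / 2"
        by (simp add: sum.reindex sum_divide_distrib)
      also have "\<dots> \<le> 1" using IH[of True] IH[of False] by simp
      finally show ?thesis .
    qed
  qed
  note * = this
  show ?thesis
    by (rule *[of A "Max (length ` A)"]) (use assms in auto)
qed

lemma computable_prediction_const: "computable_prediction (\<lambda>_. b)"
proof -
  obtain r where "\<And>xs. length xs = 1 \<Longrightarrow> eval r xs = Some (of_bool b)"
    using computable_const[of 1 "of_bool b"] unfolding computable_def by blast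
  then show ?thesis unfolding computable_prediction_def by (intro exI[of _ r]) simp
qed

text \<open>Capital \<open>(1 / 2) ^ length p\<close> is invested in betting on \<open>U p\<close>
  as soon as \<open>U\<close> is seen to halt on \<open>p\<close>. Kraft's inequality bounds the
  sum, so it converges; further halting programs move all wagers towards \<open>b\<close>, so the
  constant prediction \<open>b\<close> satisfies \<open>strongly_left_ceI\<close>.\<close>

lemma betting_martingale:
  assumes U: "prefix_free_machine U"
  obtains M where "martingale M" "strongly_left_ce M"
    "\<And>p \<tau>. U p = Some \<tau> \<Longrightarrow> (1 / 2) ^ length p * real (bet b \<tau> \<tau>) \<le> M \<tau>"
proof -
  obtain r where r: "\<And>p. eval r [str_code p] = map_option str_code (U p)"
    and free: "\<And>p q. p \<in> dom U \<Longrightarrow> q \<in> dom U \<Longrightarrow> prefix p q \<Longrightarrow> p = q"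
    using U unfolding prefix_free_machine_def by blast
  obtain h where h: "step_eval r 1 h" using step_eval_exists by blast
  have hc: "computable 2 h" using h unfolding step_eval_def numeral_2_eq_2 by simp
  have inv: "str_code (inv str_code x) = x" for x
    using bij_str_code by (simp add: bij_is_surj surj_f_inv_f)
  have code_eq: "str_code \<sigma> = str_code \<tau> \<longleftrightarrow> \<sigma> = \<tau>" for \<sigma> \<tau>
    using bij_str_code by (metis bij_is_inj injD)
  define ps where "ps = (inv str_code :: nat \<Rightarrow> str)"
  have ps: "str_code (ps x) = x" for x unfolding ps_def by (rule inv)
  have h_sound: "U (ps x) = Some (ps (h [s, x] - 1))" if "0 < h [s, x]" for s x
  proof -
    have "eval r [x] = Some (h [s, x] - 1)" using step_evalD(2)[OF h, of "[x]" s "h [s, x] - 1"] that by simp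
    then have "map_option str_code (U (ps x)) = Some (str_code (ps (h [s, x] - 1)))"
      using r[of "ps x"] by (simp add: ps)
    then show ?thesis by (auto simp: code_eq)
  qed
  have h_mono: "h [s', x] = h [s, x]" if "0 < h [s, x]" "s \<le> s'" for s s' x
    using step_evalD(1)[OF h, of "[x]" s "h [s, x] - 1" s'] that by simp
  have h_compl: "\<exists>s. h [s, str_code p] = Suc (str_code \<tau>)" if "U p = Some \<tau>" for p \<tau>
    using step_evalD(3)[OF h, of "[str_code p]" "str_code \<tau>"] r[of p] that by simp
  \<comment> \<open>At stage \<open>s\<close> the programs with code below \<open>s\<close> are run
    with time bound \<open>s\<close>; the \<open>- 1\<close> removes the successor that signals
    convergence.\<close>
  define A where "A = (\<lambda>xs. \<Sum>x<xs ! 1. if 0 < h [xs ! 1, x]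
    then (1 / 2) ^ code_length x * of_nat (code_bet b (h [xs ! 1, x] - 1) (xs ! 0)) else (0 :: rat))"
  have Ac: "computable_rat 2 A"
    unfolding A_def
    by (intro computable_rat_intros computable_intros code_intros computable_code_bet
        computable_app2[OF hc]) simp_all
  define T where "T = (\<lambda>s x \<sigma>. if 0 < h [s, x]
    then (1 / 2) ^ length (ps x) * real (bet b (ps (h [s, x] - 1)) \<sigma>) else 0)"
  define a where "a = (\<lambda>\<sigma> s. \<Sum>x<s. T s x \<sigma>)"
  have cl: "code_length x = length (ps x)" for x using code_length_str_code[of "ps x"] by (simp add: ps)
  have cb: "code_bet b x (str_code \<sigma>) = bet b (ps x) \<sigma>" for x \<sigma>
    using code_bet_str_code[of b "ps x" \<sigma>] by (simp add: ps)
  have a: "real_of_rat (A [str_code \<sigma>, s]) = a \<sigma> s" for \<sigma> s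
    unfolding A_def a_def T_def
    by (simp add: of_rat_sum if_distrib[of real_of_rat] of_rat_mult of_rat_power of_rat_divide cl cb cong: if_cong)
  have T0: "0 \<le> T s x \<sigma>" for s x \<sigma> unfolding T_def by simp
  have Tmart: "2 * T s x \<sigma> = T s x (\<sigma> @ [False]) + T s x (\<sigma> @ [True])" for s x \<sigma>
    unfolding T_def bet_snoc by (cases b) auto
  \<comment> \<open>Between consecutive stages a program contributes either no change or a whole new
    bet, hence always a nonnegative multiple of a one-sided martingale.\<close>
  have Tdiff: "\<exists>c\<ge>0. \<exists>\<tau>. \<forall>\<sigma>. T (Suc s) x \<sigma> - T s x \<sigma> = c * real (bet b \<tau> \<sigma>)" for s x
  proof (cases "0 < h [s, x]")
    case True
    then show ?thesis using h_mono[OF True, of "Suc s"] unfolding T_def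
      by (intro exI[of _ 0]) simp
  next
    case False
    then show ?thesis unfolding T_def
      by (intro exI[of _ "if 0 < h [Suc s, x] then (1 / 2) ^ length (ps x) else 0"] conjI
          exI[of _ "ps (h [Suc s, x] - 1)"]) auto
  qed
  have Tinc: "T s x \<sigma> \<le> T (Suc s) x \<sigma>" for s x \<sigma>
  proof -
    obtain c \<tau> where c: "0 \<le> c" and d: "T (Suc s) x \<sigma> - T s x \<sigma> = c * real (bet b \<tau> \<sigma>)"
      using Tdiff by blast
    from mult_nonneg_nonneg[OF c of_nat_0_le_iff] have "0 \<le> c * real (bet b \<tau> \<sigma>)" .
    then show ?thesis using d by linarith
  qed
  have aS: "a \<sigma> (Suc s) - a \<sigma> s = (\<Sum>x<s. T (Suc s) x \<sigma> - T s x \<sigma>) + T (Suc s) s \<sigma>" for \<sigma> s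
    unfolding a_def by (simp add: sum_subtractf)
  have inc: "incseq (a \<sigma>)" for \<sigma>
  proof (rule incseq_SucI)
    fix s
    have "0 \<le> (\<Sum>x<s. T (Suc s) x \<sigma> - T s x \<sigma>)" using Tinc by (intro sum_nonneg) simp
    then show "a \<sigma> s \<le> a \<sigma> (Suc s)" using aS[of \<sigma> s] T0[of "Suc s" s \<sigma>] by linarith
  qed
  have bound: "a \<sigma> s \<le> 2 ^ length \<sigma>" for \<sigma> s
  proof -
    define D where "D = {x. x < s \<and> 0 < h [s, x]}"
    have "inj_on ps D" by (metis inj_onI ps)
    then have "(\<Sum>x\<in>D. (1 / 2 :: real) ^ length (ps x)) = (\<Sum>p\<in>ps ` D. (1 / 2) ^ length p)"
      by (simp add: sum.reindex)
    also have "\<dots> \<le> 1"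
    proof (rule kraft)
      show "finite (ps ` D)" unfolding D_def by simp
      show "p = q" if "p \<in> ps ` D" "q \<in> ps ` D" "prefix p q" for p q
        by (rule free) (use that h_sound in \<open>auto simp: D_def\<close>)
    qed
    finally have K: "(\<Sum>x\<in>D. (1 / 2 :: real) ^ length (ps x)) \<le> 1" .
    have "a \<sigma> s = (\<Sum>x\<in>D. T s x \<sigma>)"
      unfolding a_def D_def by (rule sum.mono_neutral_right) (auto simp: T_def)
    also have "\<dots> \<le> (\<Sum>x\<in>D. (1 / 2) ^ length (ps x) * 2 ^ length \<sigma>)"
    proof (rule sum_mono)
      fix x assume "x \<in> D"
      have "real (bet b (ps (h [s, x] - 1)) \<sigma>) \<le> 2 ^ length \<sigma>"
        using bet_le[of b "ps (h [s, x] - 1)" \<sigma>] by (metis of_nat_le_iff of_nat_numeral of_nat_power)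
      then show "T s x \<sigma> \<le> (1 / 2) ^ length (ps x) * 2 ^ length \<sigma>"
        unfolding T_def by (auto intro: mult_left_mono)
    qed
    also have "\<dots> \<le> 1 * 2 ^ length \<sigma>"
      unfolding sum_distrib_right[symmetric] using K by (intro mult_right_mono) auto
    finally show ?thesis by simp
  qed
  have "\<forall>\<sigma>. \<exists>L. a \<sigma> \<longlonglongrightarrow> L \<and> (\<forall>s. a \<sigma> s \<le> L)"
  proof
    fix \<sigma>
    have "\<forall>s. a \<sigma> s \<le> 2 ^ length \<sigma>" using bound by simp
    from incseq_convergent[OF inc[of \<sigma>] this]
    show "\<exists>L. a \<sigma> \<longlonglongrightarrow> L \<and> (\<forall>s. a \<sigma> s \<le> L)" by metis
  qed
  from choice[OF this] obtain M where
    M: "\<And>\<sigma>. a \<sigma> \<longlonglongrightarrow> M \<sigma>" "\<And>\<sigma> s. a \<sigma> s \<le> M \<sigma>" by auto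
  have amart: "2 * a \<sigma> s = a (\<sigma> @ [False]) s + a (\<sigma> @ [True]) s" for \<sigma> s
    unfolding a_def sum_distrib_left sum.distrib[symmetric] by (rule sum.cong[OF refl Tmart])
  have a0: "0 \<le> a \<sigma> s" for \<sigma> s unfolding a_def by (intro sum_nonneg T0)
  show ?thesis
  proof (rule that[of M])
    show "martingale M"
      unfolding martingale_def
    proof (intro allI conjI)
      fix \<sigma>
      show "0 \<le> M \<sigma>" using a0[of \<sigma> 0] M(2)[of \<sigma> 0] by linarith
      have "(\<lambda>s. 2 * a \<sigma> s) \<longlonglongrightarrow> M (\<sigma> @ [False]) + M (\<sigma> @ [True])"
        unfolding amart by (intro tendsto_add M)
      moreover have "(\<lambda>s. 2 * a \<sigma> s) \<longlonglongrightarrow> 2 * M \<sigma>" by (intro tendsto_mult_left M)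
      ultimately show "2 * M \<sigma> = M (\<sigma> @ [False]) + M (\<sigma> @ [True])" by (metis LIMSEQ_unique)
    qed
    have wag: "(if b then 0 \<le> d else d \<le> 0)"
      if d: "d = (a (\<sigma> @ [True]) (Suc s) - a (\<sigma> @ [True]) s) - (a \<sigma> (Suc s) - a \<sigma> s)" for d \<sigma> s
    proof -
      define W where "W = (\<lambda>x. (T (Suc s) x (\<sigma> @ [True]) - T s x (\<sigma> @ [True])) - (T (Suc s) x \<sigma> - T s x \<sigma>))"
      define W' where "W' = T (Suc s) s (\<sigma> @ [True]) - T (Suc s) s \<sigma>"
      have "d = (\<Sum>x<s. W x) + W'" unfolding d aS W_def W'_def by (simp add: sum_subtractf)
      moreover have sgn: "if b then bet b \<tau> \<sigma> \<le> bet b \<tau> (\<sigma> @ [True]) else bet b \<tau> (\<sigma> @ [True]) \<le> bet b \<tau> \<sigma>" for \<tau>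
        unfolding bet_snoc by auto
      have "if b then 0 \<le> W x else W x \<le> 0" for x
      proof -
        obtain c \<tau> where "0 \<le> c" "\<And>\<sigma>. T (Suc s) x \<sigma> - T s x \<sigma> = c * real (bet b \<tau> \<sigma>)"
          using Tdiff by blast
        then show ?thesis unfolding W_def using sgn[of \<tau>] by (auto intro: mult_left_mono)
      qed
      moreover have "if b then 0 \<le> W' else W' \<le> 0"
        unfolding W'_def T_def using sgn by (auto intro: mult_left_mono)
      ultimately show ?thesis
        by (auto intro!: add_nonneg_nonneg add_nonpos_nonpos sum_nonneg sum_nonpos split: if_splits)
    qed
    show "strongly_left_ce M"
    proof (rule strongly_left_ceI[where A = A, OF Ac _ _ computable_prediction_const[of b]], unfold a)
      fix \<sigma> s
      have pos: "0 \<le> (1 / 2 :: real) ^ s" by simp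
      show "a \<sigma> \<longlonglongrightarrow> M \<sigma>" by (rule M)
      show "a \<sigma> s - (1 / 2) ^ s \<le> a \<sigma> (Suc s)"
        using incseq_SucD[OF inc[of \<sigma>], of s] pos by linarith
      show "a (\<sigma> @ [True]) s - a \<sigma> s - (1 / 2) ^ s \<le> a (\<sigma> @ [True]) (Suc s) - a \<sigma> (Suc s)" if b
        using wag[OF refl, of \<sigma> s] that pos by (simp only: if_True if_False)
      show "a (\<sigma> @ [True]) (Suc s) - a \<sigma> (Suc s) \<le> a (\<sigma> @ [True]) s - a \<sigma> s + (1 / 2) ^ s" if "\<not> b"
        using wag[OF refl, of \<sigma> s] that pos by (simp only: if_True if_False)
    qed
    fix p \<tau> assume U: "U p = Some \<tau>"
    obtain t where t: "h [t, str_code p] = Suc (str_code \<tau>)" using h_compl[OF U] by blast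
    \<comment> \<open>The stage must be late enough both for the computation on \<open>p\<close> to
      have converged and for the code of \<open>p\<close> to be in the range of the sum.\<close>
    define s where "s = max t (Suc (str_code p))"
    have hs: "h [s, str_code p] = Suc (str_code \<tau>)" using h_mono[of t "str_code p" s] t unfolding s_def by simp
    have pp: "ps (str_code \<rho>) = \<rho>" for \<rho> using ps[of "str_code \<rho>"] code_eq by blast
    have "(1 / 2) ^ length p * real (bet b \<tau> \<tau>) = T s (str_code p) \<tau>"
      unfolding T_def hs by (simp add: pp)
    also have "\<dots> \<le> a \<tau> s"
      unfolding a_def by (rule member_le_sum) (auto simp: s_def T0)
    also have "\<dots> \<le> M \<tau>" by (rule M)
    finally show "(1 / 2) ^ length p * real (bet b \<tau> \<tau>) \<le> M \<tau>" .
  qed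
qed

text \<open>Some prefix-free machine maps the empty program to \<open>\<sigma>\<close>, so an
  optimal one has a program for \<open>\<sigma>\<close> as well.\<close>

lemma optimal_onto:
  assumes U: "optimal_prefix_free_machine U"
  obtains p where "U p = Some \<sigma>"
proof -
  define V where "V = (\<lambda>p :: str. if p = [] then Some \<sigma> else None)"
  have "decidable 2 (\<lambda>ys. (\<lambda>s x. x = 0) (hd ys) (hd (tl ys)))"
    by (intro computable_intros) simp
  from partial_search[OF this computable_const[of 2 "str_code \<sigma>"]]
  obtain r where r: "\<And>x. eval r [x] = (if \<exists>s::nat. x = 0 then Some (str_code \<sigma>) else None)" by blast
  have "str_code p = 0 \<longleftrightarrow> p = []" for p by (cases p) auto
  then have "\<forall>p. eval r [str_code p] = map_option str_code (V p)" unfolding r V_def by simp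
  then have "prefix_free_machine V" unfolding prefix_free_machine_def V_def by (auto split: if_splits)
  then have "\<exists>c. \<forall>p \<sigma>. V p = Some \<sigma> \<longrightarrow> (\<exists>q. U q = Some \<sigma> \<and> length q \<le> length p + c)"
    using U unfolding optimal_prefix_free_machine_def by blast
  moreover have "V [] = Some \<sigma>" unfolding V_def by simp
  ultimately show ?thesis using that by blast
qed

lemma prefix_complexity_witness:
  assumes U: "optimal_prefix_free_machine U"
  obtains p where "U p = Some \<sigma>" "length p = prefix_complexity U \<sigma>"
proof -
  obtain p where "U p = Some \<sigma>" using optimal_onto[OF U] .
  then have "\<exists>p'. U p' = Some \<sigma> \<and> length p' = length p" by blast
  then have "\<exists>p. U p = Some \<sigma> \<and> length p = prefix_complexity U \<sigma>"
    unfolding prefix_complexity_def by (rule LeastI)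
  then show ?thesis using that by blast
qed

lemma complexity_lower_bound:
  assumes U: "optimal_prefix_free_machine U"
    and X: "\<And>M. martingale M \<Longrightarrow> strongly_left_ce M \<Longrightarrow> \<not> succeeds M X"
  obtains d N where "\<And>n. n \<ge> N \<Longrightarrow> n \<le> 2 * prefix_complexity U (initial X n) + d"
proof -
  have "prefix_free_machine U" using U unfolding optimal_prefix_free_machine_def by blast
  note bm = betting_martingale[OF this]
  \<comment> \<open>The bound covers all programs of the initial segment, so that one shortest
    program can be used for both values of \<open>b\<close>.\<close>
  have "\<exists>c N. 0 < c \<and> (\<forall>n\<ge>N. \<forall>p. U p = Some (initial X n) \<longrightarrow>
      (1 / 2) ^ length p * real (bet b (initial X n) (initial X n)) \<le> c)" for b
  proof -
    obtain M where M: "martingale M" "strongly_left_ce M"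
      "\<And>p \<tau>. U p = Some \<tau> \<Longrightarrow> (1 / 2) ^ length p * real (bet b \<tau> \<tau>) \<le> M \<tau>" using bm[of b] by blast
    obtain c N where "0 < c" "\<And>n. n \<ge> N \<Longrightarrow> M (initial X n) \<le> c"
      using not_succeedsD[OF X[OF M(1,2)]] by blast
    then show ?thesis using M(3) by (meson order_trans)
  qed
  then obtain c N where c: "\<And>b. 0 < c b" and bd: "\<And>b n p. n \<ge> N b \<Longrightarrow> U p = Some (initial X n) \<Longrightarrow>
      (1 / 2) ^ length p * real (bet b (initial X n) (initial X n)) \<le> c b" by metis
  obtain d where d: "c True * c False < 2 ^ d" using real_arch_pow[of 2 "c True * c False"] by auto
  have "n \<le> 2 * prefix_complexity U (initial X n) + d" if n: "n \<ge> max (N True) (N False)" for n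
  proof -
    define \<tau> where "\<tau> = initial X n"
    have len: "length \<tau> = n" unfolding \<tau>_def initial_def by simp
    obtain p where p: "U p = Some \<tau>" "length p = prefix_complexity U \<tau>" using prefix_complexity_witness[OF U] .
    define K where "K = length p"
    have "real (bet True \<tau> \<tau>) * real (bet False \<tau> \<tau>) = 2 ^ n"
      using bet_True_False[of \<tau>] len by (metis of_nat_mult of_nat_numeral of_nat_power)
    note prod = this
    have "(1 / 2) ^ (2 * K) * 2 ^ n =
        ((1 / 2) ^ K * real (bet True \<tau> \<tau>)) * ((1 / 2) ^ K * real (bet False \<tau> \<tau>))"
      unfolding mult_2 power_add prod[symmetric] by (simp only: mult_ac)
    also have "\<dots> \<le> c True * c False"
      using bd[of True n p] bd[of False n p] n p(1) c[of True] unfolding \<tau>_def K_def by (intro mult_mono) auto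
    finally have "(1 / 2) ^ (2 * K) * 2 ^ n < (2 :: real) ^ d" using d by linarith
    then have "2 ^ (2 * K) * ((1 / 2) ^ (2 * K) * 2 ^ n) < 2 ^ (2 * K) * (2 :: real) ^ d" by simp
    moreover have "2 ^ (2 * K) * (1 / 2) ^ (2 * K) = (1 :: real)" by (simp flip: power_mult_distrib)
    ultimately have "(2 :: real) ^ n < 2 ^ (2 * K + d)" by (simp only: mult.assoc[symmetric] mult_1_left power_add)
    then have "n < 2 * K + d" by (rule power_less_imp_less_exp[rotated]) simp
    then show ?thesis using p(2) unfolding K_def \<tau>_def by simp
  qed
  then show ?thesis by (rule that)
qed

section \<open>From complexity to dimension\<close>

lemma prefix_complexity_invariance:
  assumes U: "optimal_prefix_free_machine U" and V: "optimal_prefix_free_machine V"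
  obtains c where "\<And>\<sigma>. prefix_complexity V \<sigma> \<le> prefix_complexity U \<sigma> + c"
proof -
  obtain c where c: "\<And>p \<sigma>. U p = Some \<sigma> \<Longrightarrow> \<exists>q. V q = Some \<sigma> \<and> length q \<le> length p + c"
    using U V unfolding optimal_prefix_free_machine_def by meson
  have "prefix_complexity V \<sigma> \<le> prefix_complexity U \<sigma> + c" for \<sigma>
  proof -
    obtain p where p: "U p = Some \<sigma>" "length p = prefix_complexity U \<sigma>" using prefix_complexity_witness[OF U] .
    obtain q where q: "V q = Some \<sigma>" "length q \<le> length p + c" using c[OF p(1)] by blast
    show ?thesis using prefix_complexity_le[of V, OF q(1)] q(2) p(2) by simp
  qed
  then show ?thesis by (rule that)
qed

text \<open>Short descriptions are known only for the machine \<open>U\<close> used in the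
  construction. Invariance transfers them to \<open>V\<close> up to an additive constant, which
  becomes negligible after division by the length. The lower bound applies to \<open>V\<close>
  directly.\<close>

lemma effective_hdim_half:
  assumes U: "optimal_prefix_free_machine U" and V: "optimal_prefix_free_machine V"
    and X: "\<And>M. martingale M \<Longrightarrow> strongly_left_ce M \<Longrightarrow> \<not> succeeds M X"
    and up: "\<And>m N. \<exists>n\<ge>N. \<exists>m'\<ge>m.
       real (prefix_complexity U (initial X n)) \<le> (1 / 2 + 3 / real m') * real (length (initial X n))"
  shows "effective_hdim V X = ereal (1 / 2)"
proof (rule antisym)
  define K where "K = (\<lambda>n. real (prefix_complexity V (initial X n)))"
  have hd: "effective_hdim V X = liminf (\<lambda>n. ereal (K n / real n))" unfolding effective_hdim_def K_def ..
  obtain d N where dN: "\<And>n. n \<ge> N \<Longrightarrow> n \<le> 2 * prefix_complexity V (initial X n) + d"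
    using complexity_lower_bound[OF V X] by blast
  have "(\<lambda>n. 1 / 2 - real d / 2 * inverse (real n)) \<longlonglongrightarrow> 1 / 2 - real d / 2 * 0"
    by (intro tendsto_intros lim_inverse_n)
  then have "(\<lambda>n. ereal (1 / 2 - real d / 2 * inverse (real n))) \<longlonglongrightarrow> ereal (1 / 2)" by simp
  then have "liminf (\<lambda>n. ereal (1 / 2 - real d / 2 * inverse (real n))) = ereal (1 / 2)"
    by (intro lim_imp_Liminf) auto
  moreover have "liminf (\<lambda>n. ereal (1 / 2 - real d / 2 * inverse (real n))) \<le> liminf (\<lambda>n. ereal (K n / real n))"
  proof (rule Liminf_mono)
    show "\<forall>\<^sub>F n in sequentially. ereal (1 / 2 - real d / 2 * inverse (real n)) \<le> ereal (K n / real n)"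
      using eventually_ge_at_top[of "max N 1"]
    proof eventually_elim
      case (elim n)
      then have "real n \<le> real (2 * prefix_complexity V (initial X n) + d)"
        using dN[of n] by (intro of_nat_mono) simp
      then have "real n \<le> 2 * K n + real d" unfolding K_def by simp
      then have "(real n - real d) / (2 * real n) \<le> 2 * K n / (2 * real n)" by (intro divide_right_mono) auto
      then show ?case using elim by (simp add: field_simps)
    qed
  qed
  ultimately show "ereal (1 / 2) \<le> effective_hdim V X" unfolding hd by simp
  show "effective_hdim V X \<le> ereal (1 / 2)"
  proof (rule ccontr)
    assume "\<not> ?thesis"
    then have "ereal (1 / 2) < liminf (\<lambda>n. ereal (K n / real n))" unfolding hd by simp
    then obtain e where e: "ereal (1 / 2) < ereal e" "ereal e < liminf (\<lambda>n. ereal (K n / real n))"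
      using ereal_dense2 by blast
    obtain N where N: "\<And>n. n \<ge> N \<Longrightarrow> e < K n / real n"
      using less_LiminfD[OF e(2)] unfolding eventually_sequentially by auto
    obtain c where c: "\<And>\<sigma>. prefix_complexity V \<sigma> \<le> prefix_complexity U \<sigma> + c"
      using prefix_complexity_invariance[OF U V] by blast
    define t where "t = e - 1 / 2"
    have t: "0 < t" using e(1) unfolding t_def by simp
    \<comment> \<open>With \<open>m > 6 / t\<close> and \<open>n > 2 * c / t\<close>, each of the
      two error terms is at most \<open>t / 2 * n\<close>. The complexity is then at most
      \<open>e * n\<close>, which contradicts the choice of \<open>e\<close>.\<close>
    obtain m :: nat where m: "6 / t < real m" using reals_Archimedean2 by blast
    obtain N' :: nat where N': "2 * real c / t < real N'" using reals_Archimedean2 by blast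
    have "0 < 6 / t" using t by simp
    then have m0: "0 < m" using m by linarith
    obtain n m' where n: "max 1 (max N N') \<le> n" and m': "m \<le> m'"
      and Un: "real (prefix_complexity U (initial X n)) \<le> (1 / 2 + 3 / real m') * real n"
      using up[of "max 1 (max N N')" m] unfolding initial_def by auto
    have "e < K n / real n" using N n by simp
    then have 1: "e * real n < K n" using n by (simp add: field_simps)
    have "K n \<le> real (prefix_complexity U (initial X n) + c)" unfolding K_def using c by (intro of_nat_mono)
    then have 2: "K n \<le> (1 / 2 + 3 / real m') * real n + real c" using Un by simp
    have "6 / t < real m'" using m m' by (meson less_le_trans of_nat_mono)
    then have "3 / real m' \<le> t / 2" using m0 m' t by (simp add: field_simps)
    then have 3: "3 / real m' * real n \<le> t / 2 * real n" by (intro mult_right_mono) auto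
    have "2 * real c / t \<le> real n" using N' n by simp
    then have 4: "real c \<le> t / 2 * real n" using t by (simp add: field_simps)
    have "e = 1 / 2 + t" unfolding t_def by simp
    then show False using 1 2 3 4 by (simp only: distrib_right)
  qed
qed

theorem theorem4p3:
  "\<exists>X :: nat \<Rightarrow> bool.
     (\<forall>U. optimal_prefix_free_machine U \<longrightarrow> effective_hdim U X = ereal (1 / 2)) \<and>
     (\<forall>M. martingale M \<and> strongly_left_ce M \<and> decidably_sided M \<longrightarrow> \<not> succeeds M X) \<and>
     (\<forall>f. computable_prediction f \<longrightarrow>
        (\<forall>N M. computable_martingale_family N \<and> (\<forall>i. sided f (N i)) \<and> mixture N M \<longrightarrow>
           \<not> succeeds M X))"
proof -
  have "\<exists>X. (\<forall>M. martingale M \<longrightarrow> strongly_left_ce M \<longrightarrow> \<not> succeeds M X) \<and>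
    (\<forall>V. optimal_prefix_free_machine V \<longrightarrow> effective_hdim V X = ereal (1 / 2))"
  proof (cases "\<exists>U. optimal_prefix_free_machine U")
    case True
    then obtain U where U: "optimal_prefix_free_machine U" ..
    obtain X where X: "\<And>M. martingale M \<Longrightarrow> strongly_left_ce M \<Longrightarrow> \<not> succeeds M X"
      "\<And>m N. \<exists>n\<ge>N. \<exists>m'\<ge>m.
         real (prefix_complexity U (initial X n)) \<le> (1 / 2 + 3 / real m') * real (length (initial X n))"
      using unbeaten_sequence[where G = "\<lambda>m \<tau>. real (prefix_complexity U \<tau>) \<le>
          (1 / 2 + 3 / real m) * real (length \<tau>)", OF tame_extension[OF _ _ _ U]] by blast
    have "effective_hdim V X = ereal (1 / 2)" if "optimal_prefix_free_machine V" for V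
      by (rule effective_hdim_half[OF U that X])
    then show ?thesis using X(1) by blast
  next
    case False
    \<comment> \<open>Without an optimal machine the dimension clause holds vacuously, and plain
      greedy descent provides the extensions.\<close>
    have "\<exists>\<tau>. prefix \<sigma> \<tau> \<and> N \<le> length \<tau> \<and> True \<and>
        (\<forall>l. length \<sigma> \<le> l \<longrightarrow> l \<le> length \<tau> \<longrightarrow> M (take l \<tau>) \<le> M \<sigma> + \<delta>)"
      if "tame m M" "0 < \<delta>" for m M \<sigma> N and \<delta> :: real
    proof -
      have "martingale M" using that(1) unfolding tame_def by blast
      from greedy_path[OF this, of \<sigma> N] obtain \<tau> where "prefix \<sigma> \<tau>" "length \<tau> = length \<sigma> + N"
        "\<forall>l. length \<sigma> \<le> l \<longrightarrow> l \<le> length \<tau> \<longrightarrow> M (take l \<tau>) \<le> M \<sigma>" by blast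
      then show ?thesis using that(2) by (intro exI[of _ \<tau>]) (auto intro: add_increasing2)
    qed
    note ext = this
    show ?thesis
    proof (rule unbeaten_sequence[where G = "\<lambda>_ _. True"])
      fix m M \<sigma> N and \<delta> :: real assume "tame m M" "0 < \<delta>"
      then show "\<exists>\<tau>. prefix \<sigma> \<tau> \<and> N \<le> length \<tau> \<and> True \<and>
          (\<forall>l. length \<sigma> \<le> l \<longrightarrow> l \<le> length \<tau> \<longrightarrow> M (take l \<tau>) \<le> M \<sigma> + \<delta>)" by (rule ext)
    next
      fix X assume "\<And>M. martingale M \<Longrightarrow> strongly_left_ce M \<Longrightarrow> \<not> succeeds M X"
      then show ?thesis using False by (intro exI[of _ X]) auto
    qed
  qed
  then obtain X where X: "\<And>M. martingale M \<Longrightarrow> strongly_left_ce M \<Longrightarrow> \<not> succeeds M X"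
    and dim: "\<And>V. optimal_prefix_free_machine V \<Longrightarrow> effective_hdim V X = ereal (1 / 2)" by blast
  have "\<not> succeeds M X"
    if "computable_prediction f" "computable_martingale_family N" "\<forall>i. sided f (N i)" "mixture N M"
    for f N M
  proof (rule X)
    show "martingale M"
      by (rule martingale_mixture[OF _ that(4)]) (use that(2) in \<open>auto simp: computable_martingale_family_def\<close>)
    show "strongly_left_ce M" using that by (intro strongly_left_ce_mixture[of f N M]) auto
  qed
  then show ?thesis using X dim by (intro exI[of _ X]) blast
qed

end
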